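(* There exists an algorithm running in time polynomial in $n$ that, given oracle access to all principal minors of order at most $4$ of a matrix $A \in \mathbb{F}^{n \times n}$ satisfying property $\mathcal{R}$ (i.e. an oracle returning $\det(A[S])$ on input a nonempty $S\subseteq[n]$ with $|S|\le 4$), outputs a matrix $B \in \mathbb{F}^{n\times n}$ such that $\det(A[S]) = \det(B[S])$ for every nonempty $S \subseteq [n]$.
   Context: For $S, T \subseteq [n]$, $A[S,T]$ denotes the submatrix of $A$ with rows indexed by $S$ and columns indexed by $T$, $A[S] = A[S,S]$, and $\overline{S} = [n] \setminus S$. A matrix $A \in \mathbb{F}^{n \times n}$ satisfies property $\mathcal{R}$ if (i) all off-diagonal entries of $A$ are nonzero, and (ii) whenever $i,j,k,\ell \in [n]$ are distinct with $\mathrm{rank}(A[\{i,j\},\{k,\ell\}]) = 1$, there exists $S \subseteq [n]$ with $i, j \in S$ and $k, \ell \in \overline{S}$ such that $\mathrm{rank}(A[S, \overline{S}]) = 1$. Standing computational assumptions: each field operation takes unit time and square roots in $\mathbb{F}$ can be computed in polynomial time.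
   Formalization: In characteristic 2, where square roots alone cannot solve the needed quadratics and the claim fails, the field is also assumed to have a polynomial-time procedure finding a solution z of z^2 + z = x whenever one exists; in other characteristics nothing is added. *)

theory Defs
  imports "Jordan_Normal_Form.DL_Rank_Submatrix"
begin

section \<open>Principal minors and property R\<close>

text \<open>Indices are 0-based: the index set of an \<open>n \<times> n\<close> matrix is \<open>{..<n}\<close>.\<close>

definition principal_minor :: "'a::comm_ring_1 mat \<Rightarrow> nat set \<Rightarrow> 'a" where
  "principal_minor A S = det (submatrix A S S)"

definition mat_rank :: "'a::field mat \<Rightarrow> nat" where
  "mat_rank A = vec_space.rank (dim_row A) A"

definition property_R :: "nat \<Rightarrow> 'a::field mat \<Rightarrow> bool" where
  "property_R n A \<longleftrightarrow>
     (\<forall>i<n. \<forall>j<n. i \<noteq> j \<longrightarrow> A $$ (i, j) \<noteq> 0) \<and>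
     (\<forall>i<n. \<forall>j<n. \<forall>k<n. \<forall>l<n.
        distinct [i, j, k, l] \<and> mat_rank (submatrix A {i, j} {k, l}) = 1 \<longrightarrow>
        (\<exists>S \<subseteq> {..<n}. i \<in> S \<and> j \<in> S \<and> k \<in> {..<n} - S \<and> l \<in> {..<n} - S \<and>
           mat_rank (submatrix A S ({..<n} - S)) = 1))"

section \<open>The model of computation\<close>

text \<open>
  An algorithm is a finite program of an imperative language, the same program for all \<open>n\<close>.
  Its memory consists of named two-dimensional arrays, some holding natural numbers and some
  holding field elements; a scalar is an array used at index \<open>(0, 0)\<close>.
  This is a unit-cost random access machine over the field.

  On natural numbers only addition, truncated subtraction and comparison are available at unit
  cost, so numbers computed in \<open>t\<close> steps have \<open>O(t)\<close> bits; unit-cost multiplication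
  would allow numbers with exponentially many bits.
  On field elements the four field operations and equality tests have unit cost; the only field
  constants in programs are \<open>0\<close> and \<open>1\<close>.  Division by zero yields \<open>0\<close>, as in HOL.
\<close>

datatype nexp =
    NConst nat
  | NRead string nexp nexp
  | NAdd nexp nexp
  | NSub nexp nexp

text \<open>
  \<open>FSqrt\<close> calls the procedure for square roots.  \<open>FArtin\<close> calls a procedure for
  Artin-Schreier roots, i.e. solutions \<open>z\<close> of \<open>z\<^sup>2 + z = x\<close>.  The latter is given a meaning in
  characteristic 2 only, where solving a quadratic equation does not reduce to square roots;
  in all other characteristics its result is completely arbitrary.
\<close>

datatype fexp =
    FZero
  | FOne
  | FRead string nexp nexp
  | FAdd fexp fexp
  | FSub fexp fexp
  | FMul fexp fexp
  | FDiv fexp fexp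
  | FSqrt fexp
  | FArtin fexp

datatype bexp =
    NLess nexp nexp
  | FEq fexp fexp
  | BNot bexp
  | BAnd bexp bexp

text \<open>
  \<open>Query X i j a b c d\<close> asks the oracle for the set \<open>{a, b, c, d}\<close> and stores the answer in
  \<open>X[i, j]\<close>.  Repetitions are allowed, so the sets that can be asked are precisely the nonempty
  ones with at most four elements.
\<close>

datatype com =
    Skip
  | NAssign string nexp nexp nexp
  | FAssign string nexp nexp fexp
  | Query string nexp nexp nexp nexp nexp nexp
  | Seq com com
  | Cond bexp com com
  | While bexp com

record 'a state =
  nmem :: "string \<Rightarrow> nat \<Rightarrow> nat \<Rightarrow> nat"
  fmem :: "string \<Rightarrow> nat \<Rightarrow> nat \<Rightarrow> 'a"

definition upd :: "(string \<Rightarrow> nat \<Rightarrow> nat \<Rightarrow> 'v) \<Rightarrow> string \<Rightarrow> nat \<Rightarrow> nat \<Rightarrow> 'v \<Rightarrow> string \<Rightarrow> nat \<Rightarrow> nat \<Rightarrow> 'v"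
  where "upd m X i j v = m(X := (m X)(i := (m X i)(j := v)))"

primrec neval :: "'a state \<Rightarrow> nexp \<Rightarrow> nat" where
  "neval s (NConst k) = k"
| "neval s (NRead X a b) = nmem s X (neval s a) (neval s b)"
| "neval s (NAdd a b) = neval s a + neval s b"
| "neval s (NSub a b) = neval s a - neval s b"

primrec feval :: "('a::field \<Rightarrow> 'a) \<Rightarrow> ('a \<Rightarrow> 'a) \<Rightarrow> 'a state \<Rightarrow> fexp \<Rightarrow> 'a" where
  "feval rt as s FZero = 0"
| "feval rt as s FOne = 1"
| "feval rt as s (FRead X a b) = fmem s X (neval s a) (neval s b)"
| "feval rt as s (FAdd e f) = feval rt as s e + feval rt as s f"
| "feval rt as s (FSub e f) = feval rt as s e - feval rt as s f"
| "feval rt as s (FMul e f) = feval rt as s e * feval rt as s f"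
| "feval rt as s (FDiv e f) = feval rt as s e / feval rt as s f"
| "feval rt as s (FSqrt e) = rt (feval rt as s e)"
| "feval rt as s (FArtin e) = as (feval rt as s e)"

primrec beval :: "('a::field \<Rightarrow> 'a) \<Rightarrow> ('a \<Rightarrow> 'a) \<Rightarrow> 'a state \<Rightarrow> bexp \<Rightarrow> bool" where
  "beval rt as s (NLess a b) \<longleftrightarrow> neval s a < neval s b"
| "beval rt as s (FEq e f) \<longleftrightarrow> feval rt as s e = feval rt as s f"
| "beval rt as s (BNot b) \<longleftrightarrow> \<not> beval rt as s b"
| "beval rt as s (BAnd b c) \<longleftrightarrow> beval rt as s b \<and> beval rt as s c"

text \<open>Every operation takes one step, except that a call of a root procedure takes \<open>\<tau>\<close> steps.\<close>

primrec ncost :: "nexp \<Rightarrow> nat" where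
  "ncost (NConst k) = 1"
| "ncost (NRead X a b) = 1 + ncost a + ncost b"
| "ncost (NAdd a b) = 1 + ncost a + ncost b"
| "ncost (NSub a b) = 1 + ncost a + ncost b"

primrec fcost :: "nat \<Rightarrow> fexp \<Rightarrow> nat" where
  "fcost \<tau> FZero = 1"
| "fcost \<tau> FOne = 1"
| "fcost \<tau> (FRead X a b) = 1 + ncost a + ncost b"
| "fcost \<tau> (FAdd e f) = 1 + fcost \<tau> e + fcost \<tau> f"
| "fcost \<tau> (FSub e f) = 1 + fcost \<tau> e + fcost \<tau> f"
| "fcost \<tau> (FMul e f) = 1 + fcost \<tau> e + fcost \<tau> f"
| "fcost \<tau> (FDiv e f) = 1 + fcost \<tau> e + fcost \<tau> f"
| "fcost \<tau> (FSqrt e) = \<tau> + fcost \<tau> e"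
| "fcost \<tau> (FArtin e) = \<tau> + fcost \<tau> e"

primrec bcost :: "nat \<Rightarrow> bexp \<Rightarrow> nat" where
  "bcost \<tau> (NLess a b) = 1 + ncost a + ncost b"
| "bcost \<tau> (FEq e f) = 1 + fcost \<tau> e + fcost \<tau> f"
| "bcost \<tau> (BNot b) = 1 + bcost \<tau> b"
| "bcost \<tau> (BAnd b c) = 1 + bcost \<tau> b + bcost \<tau> c"

text \<open>
  \<open>exec orc rt as \<tau> c s t s'\<close>: started in \<open>s\<close>, the program \<open>c\<close> terminates after exactly \<open>t\<close>
  steps in \<open>s'\<close>, with oracle \<open>orc\<close> and root procedures \<open>rt\<close>, \<open>as\<close>.
\<close>

inductive exec ::
  "(nat set \<Rightarrow> 'a::field) \<Rightarrow> ('a \<Rightarrow> 'a) \<Rightarrow> ('a \<Rightarrow> 'a) \<Rightarrow> nat \<Rightarrow> com \<Rightarrow> 'a state \<Rightarrow> nat \<Rightarrow> 'a state \<Rightarrow> bool"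
  for orc :: "nat set \<Rightarrow> 'a" and rt as :: "'a \<Rightarrow> 'a" and \<tau> :: nat
where
  Skip: "exec orc rt as \<tau> Skip s 1 s"
| NAssign: "exec orc rt as \<tau> (NAssign X i j e) s (1 + ncost i + ncost j + ncost e)
    (s\<lparr>nmem := upd (nmem s) X (neval s i) (neval s j) (neval s e)\<rparr>)"
| FAssign: "exec orc rt as \<tau> (FAssign X i j e) s (1 + ncost i + ncost j + fcost \<tau> e)
    (s\<lparr>fmem := upd (fmem s) X (neval s i) (neval s j) (feval rt as s e)\<rparr>)"
| Query: "exec orc rt as \<tau> (Query X i j a b c d) s
    (1 + ncost i + ncost j + ncost a + ncost b + ncost c + ncost d)
    (s\<lparr>fmem := upd (fmem s) X (neval s i) (neval s j)
        (orc {neval s a, neval s b, neval s c, neval s d})\<rparr>)"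
| Seq: "exec orc rt as \<tau> c1 s t1 s1 \<Longrightarrow> exec orc rt as \<tau> c2 s1 t2 s2 \<Longrightarrow>
    exec orc rt as \<tau> (Seq c1 c2) s (1 + t1 + t2) s2"
| CondTrue: "beval rt as s b \<Longrightarrow> exec orc rt as \<tau> c1 s t s' \<Longrightarrow>
    exec orc rt as \<tau> (Cond b c1 c2) s (1 + bcost \<tau> b + t) s'"
| CondFalse: "\<not> beval rt as s b \<Longrightarrow> exec orc rt as \<tau> c2 s t s' \<Longrightarrow>
    exec orc rt as \<tau> (Cond b c1 c2) s (1 + bcost \<tau> b + t) s'"
| WhileFalse: "\<not> beval rt as s b \<Longrightarrow>
    exec orc rt as \<tau> (While b c) s (1 + bcost \<tau> b) s"
| WhileTrue: "beval rt as s b \<Longrightarrow> exec orc rt as \<tau> c s t1 s1 \<Longrightarrow>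
    exec orc rt as \<tau> (While b c) s1 t2 s2 \<Longrightarrow>
    exec orc rt as \<tau> (While b c) s (1 + bcost \<tau> b + t1 + t2) s2"

inductive_cases exec_SkipE: "exec orc rt as \<tau> Skip s t s'"
  and exec_NAssignE: "exec orc rt as \<tau> (NAssign X i j e) s t s'"
  and exec_FAssignE: "exec orc rt as \<tau> (FAssign X i j f) s t s'"
  and exec_QueryE: "exec orc rt as \<tau> (Query X i j a b c d) s t s'"
  and exec_SeqE: "exec orc rt as \<tau> (Seq c1 c2) s t s'"
  and exec_CondE: "exec orc rt as \<tau> (Cond b c1 c2) s t s'"
  and exec_WhileE: "exec orc rt as \<tau> (While b c) s t s'"

text \<open>Execution is deterministic, so a terminating run is the only run of the program.\<close>

lemma exec_deterministic:
  assumes "exec orc rt as \<tau> c s t s'" and "exec orc rt as \<tau> c s u s''"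
  shows "t = u \<and> s' = s''"
  using assms
proof (induction arbitrary: u s'' rule: exec.induct)
  case (Skip s)
  then show ?case by (rule exec_SkipE) simp
next
  case (NAssign X i j e s)
  then show ?case by (rule exec_NAssignE) simp
next
  case (FAssign X i j e s)
  then show ?case by (rule exec_FAssignE) simp
next
  case (Query X i j a b c d s)
  then show ?case by (rule exec_QueryE) simp
next
  case (Seq c1 s t1 s1 c2 t2 s2)
  from Seq.prems obtain v1 v2 r where 1: "exec orc rt as \<tau> c1 s v1 r"
    and 2: "exec orc rt as \<tau> c2 r v2 s''" and u: "u = Suc (v1 + v2)" by (rule exec_SeqE)
  from Seq.IH(1)[OF 1] have "t1 = v1" "s1 = r" by blast+
  moreover from this 2 have "t2 = v2 \<and> s2 = s''" by (intro Seq.IH(2)) blast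
  ultimately show ?case by (simp add: u)
next
  case (CondTrue s b c1 t s' c2)
  from CondTrue.prems obtain v where 1: "exec orc rt as \<tau> c1 s v s''"
    and u: "u = Suc (bcost \<tau> b + v)" by (rule exec_CondE) (use CondTrue.hyps(1) in blast)+
  from CondTrue.IH[OF 1] u show ?case by simp
next
  case (CondFalse s b c2 t s' c1)
  from CondFalse.prems obtain v where 1: "exec orc rt as \<tau> c2 s v s''"
    and u: "u = Suc (bcost \<tau> b + v)" by (rule exec_CondE) (use CondFalse.hyps(1) in blast)+
  from CondFalse.IH[OF 1] u show ?case by simp
next
  case (WhileFalse s b c)
  from WhileFalse.prems show ?case
    by (rule exec_WhileE) (use WhileFalse.hyps in simp_all)
next
  case (WhileTrue s b c t1 s1 t2 s2)
  from WhileTrue.prems obtain v1 v2 r where 1: "exec orc rt as \<tau> c s v1 r"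
    and 2: "exec orc rt as \<tau> (While b c) r v2 s''" and u: "u = Suc (bcost \<tau> b + v1 + v2)"
    by (rule exec_WhileE) (use WhileTrue.hyps(1) in blast)+
  from WhileTrue.IH(1)[OF 1] have "t1 = v1" "s1 = r" by blast+
  moreover from this 2 have "t2 = v2 \<and> s2 = s''" by (intro WhileTrue.IH(2)) blast
  ultimately show ?case by (simp add: u)
qed

text \<open>The input \<open>n\<close> is in the natural-number scalar \<open>n\<close>; the output is the field array \<open>B\<close>.\<close>

definition init_state :: "nat \<Rightarrow> 'a::zero state" where
  "init_state n = \<lparr>nmem = upd (\<lambda>_ _ _. 0) ''n'' 0 0 n, fmem = (\<lambda>_ _ _. 0)\<rparr>"

definition output_mat :: "nat \<Rightarrow> 'a state \<Rightarrow> 'a mat" where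
  "output_mat n s = mat n n (\<lambda>(i, j). fmem s ''B'' i j)"

text \<open>The values of the oracle on all other sets are unconstrained, hence useless to a program.\<close>

definition minor_oracle :: "nat \<Rightarrow> 'a::field mat \<Rightarrow> (nat set \<Rightarrow> 'a) \<Rightarrow> bool" where
  "minor_oracle n A orc \<longleftrightarrow>
     (\<forall>S. S \<noteq> {} \<and> S \<subseteq> {..<n} \<and> card S \<le> 4 \<longrightarrow> orc S = principal_minor A S)"

definition computes_square_roots :: "('a::field \<Rightarrow> 'a) \<Rightarrow> bool" where
  "computes_square_roots rt \<longleftrightarrow> (\<forall>x. (\<exists>z. z\<^sup>2 = x) \<longrightarrow> (rt x)\<^sup>2 = x)"

definition computes_artin_schreier_roots :: "('a::field \<Rightarrow> 'a) \<Rightarrow> bool" where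
  "computes_artin_schreier_roots as \<longleftrightarrow>
     (\<forall>x. (\<exists>z. z\<^sup>2 + z = x) \<longrightarrow> (as x)\<^sup>2 + as x = x)"

definition polynomially_bounded :: "(nat \<Rightarrow> nat) \<Rightarrow> bool" where
  "polynomially_bounded f \<longleftrightarrow> (\<exists>p :: nat poly. \<forall>n. f n \<le> poly p n)"

end

theory Submission
  imports Defs "HOL-Combinatorics.List_Permutation"
begin

text \<open>
  Scaling rows and columns turns row and column \<open>0\<close> of \<open>A\<close> into ones, and property R becomes a
  condition on coincidences among the remaining entries.  The minors of order at most three give
  the sum and the product of the entries \<open>r i j\<close> and \<open>r j i\<close>, so these are known up to
  exchange, and it remains to choose an orientation of every pair
  \<open>{i, j}\<close> with \<open>r i j \<noteq> r j i\<close>.  Minors of order three and four relate the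
  orientations of two pairs with a common index, or of two disjoint pairs with symmetric entries
  between them, unless some rows and columns coincide.  Pairs related in this way are merged into
  classes, and in every class the representative with the least first index gets the orientation
  that a fixed symmetric choice between the two roots prescribes.

  The result \<open>r'\<close> agrees with \<open>r\<close> or its transpose on every class, and the coincidences left over
  make pairs that are changed (red) and pairs that are not (blue) compatible.  Compatibility
  implies equality of all minors by induction: if \<open>r\<close> and \<open>r'\<close> have a common nontrivial module,
  the minors are determined by those of the module and of the quotient.  Otherwise a module \<open>Q\<close>
  of \<open>r\<close> alone contains a red pair, and the matrix that equals \<open>r'\<close> inside \<open>Q\<close> and \<open>r\<close>
  elsewhere lies strictly between \<open>r\<close> and \<open>r'\<close>.
\<close>

section \<open>Compatible reorientations\<close>

text \<open>Property R for the rows \<open>o, i\<close> and columns \<open>k, l\<close>, where \<open>o\<close> is the normalised index, whose row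
  consists of ones: either \<open>j\<close> lies on the side of \<open>i\<close> of the cut, or \<open>r i j = r i k\<close>.\<close>

definition coherent :: "'v set \<Rightarrow> ('v \<Rightarrow> 'v \<Rightarrow> 'c) \<Rightarrow> bool" where
  "coherent V r \<longleftrightarrow> (\<forall>i\<in>V. \<forall>j\<in>V. \<forall>k\<in>V. \<forall>l\<in>V. distinct [i, j, k, l] \<longrightarrow>
     (r i k = r i l \<longrightarrow> r i k \<noteq> r i j \<longrightarrow> r j k = r j l) \<and>
     (r k i = r l i \<longrightarrow> r k i \<noteq> r j i \<longrightarrow> r k j = r l j))"

definition twins :: "('v \<Rightarrow> 'v \<Rightarrow> 'c) \<Rightarrow> 'v \<Rightarrow> 'v \<Rightarrow> 'v \<Rightarrow> bool" where
  "twins r x a b \<longleftrightarrow> r x a = r x b \<and> r a x = r b x"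

definition reoriented :: "'v set \<Rightarrow> ('v \<Rightarrow> 'v \<Rightarrow> 'c) \<Rightarrow> ('v \<Rightarrow> 'v \<Rightarrow> 'c) \<Rightarrow> bool" where
  "reoriented V r r' \<longleftrightarrow> (\<forall>i\<in>V. \<forall>j\<in>V. i \<noteq> j \<longrightarrow>
     (r' i j = r i j \<and> r' j i = r j i) \<or> (r' i j = r j i \<and> r' j i = r i j))"

definition red :: "('v \<Rightarrow> 'v \<Rightarrow> 'c) \<Rightarrow> ('v \<Rightarrow> 'v \<Rightarrow> 'c) \<Rightarrow> 'v \<Rightarrow> 'v \<Rightarrow> bool" where
  "red r r' i j \<longleftrightarrow> i \<noteq> j \<and> r' i j \<noteq> r i j"

definition blue :: "('v \<Rightarrow> 'v \<Rightarrow> 'c) \<Rightarrow> ('v \<Rightarrow> 'v \<Rightarrow> 'c) \<Rightarrow> 'v \<Rightarrow> 'v \<Rightarrow> bool" where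
  "blue r r' i j \<longleftrightarrow> r' i j = r i j \<and> r i j \<noteq> r j i"

definition triple_compat :: "'v set \<Rightarrow> ('v \<Rightarrow> 'v \<Rightarrow> 'c) \<Rightarrow> ('v \<Rightarrow> 'v \<Rightarrow> 'c) \<Rightarrow> bool" where
  "triple_compat V r r' \<longleftrightarrow> (\<forall>i\<in>V. \<forall>j\<in>V. \<forall>k\<in>V. distinct [i, j, k] \<longrightarrow>
     red r r' i j \<longrightarrow> blue r r' i k \<longrightarrow>
     (red r r' j k \<and> twins r j i k) \<or> (blue r r' j k \<and> twins r k i j))"

definition quad_compat :: "'v set \<Rightarrow> ('v \<Rightarrow> 'v \<Rightarrow> 'c) \<Rightarrow> ('v \<Rightarrow> 'v \<Rightarrow> 'c) \<Rightarrow> bool" where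
  "quad_compat V r r' \<longleftrightarrow> (\<forall>i\<in>V. \<forall>j\<in>V. \<forall>k\<in>V. \<forall>l\<in>V. distinct [i, j, k, l] \<longrightarrow>
     red r r' i j \<longrightarrow> blue r r' k l \<longrightarrow>
     r i k = r k i \<longrightarrow> r i l = r l i \<longrightarrow> r j k = r k j \<longrightarrow> r j l = r l j \<longrightarrow>
     (twins r i k l \<and> twins r j k l) \<or> (twins r k i j \<and> twins r l i j))"

lemma coherent_subset: "coherent V r \<Longrightarrow> W \<subseteq> V \<Longrightarrow> coherent W r"
  unfolding coherent_def by (meson subsetD)
lemma reoriented_subset: "reoriented V r r' \<Longrightarrow> W \<subseteq> V \<Longrightarrow> reoriented W r r'"
  unfolding reoriented_def by (meson subsetD)
lemma triple_compat_subset: "triple_compat V r r' \<Longrightarrow> W \<subseteq> V \<Longrightarrow> triple_compat W r r'"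
  unfolding triple_compat_def by (meson subsetD)
lemma quad_compat_subset: "quad_compat V r r' \<Longrightarrow> W \<subseteq> V \<Longrightarrow> quad_compat W r r'"
  unfolding quad_compat_def by (meson subsetD)

definition connected_on :: "('v \<Rightarrow> 'v \<Rightarrow> bool) \<Rightarrow> 'v set \<Rightarrow> bool" where
  "connected_on E C \<longleftrightarrow> (\<forall>S \<subseteq> C. S \<noteq> {} \<longrightarrow> (\<forall>a\<in>S. \<forall>b\<in>C. E a b \<longrightarrow> b \<in> S) \<longrightarrow> S = C)"

lemma component_exists:
  assumes sym: "\<And>a b. a \<in> V \<Longrightarrow> b \<in> V \<Longrightarrow> E a b \<Longrightarrow> E b a" and c: "c \<in> V"
  obtains C where "C \<subseteq> V" "c \<in> C" "connected_on E C" "\<And>a b. a \<in> C \<Longrightarrow> b \<in> V \<Longrightarrow> E a b \<Longrightarrow> b \<in> C"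
proof
  define F where "F = (\<lambda>a b. a \<in> V \<and> b \<in> V \<and> E a b)"
  define C where "C = {v. F\<^sup>*\<^sup>* c v}"
  show CV: "C \<subseteq> V"
  proof
    fix v assume "v \<in> C"
    hence "F\<^sup>*\<^sup>* c v" by (simp add: C_def)
    thus "v \<in> V" by (induction) (use c F_def in auto)
  qed
  show "c \<in> C" by (simp add: C_def)
  show closed: "b \<in> C" if "a \<in> C" "b \<in> V" "E a b" for a b
  proof -
    have "F a b" using that CV by (auto simp: F_def)
    thus ?thesis using that(1) by (auto simp: C_def)
  qed
  have symF: "symp F" using sym by (auto simp: symp_def F_def)
  show "connected_on E C"
    unfolding connected_on_def
  proof (intro allI impI)
    fix S assume S: "S \<subseteq> C" "S \<noteq> {}" "\<forall>a\<in>S. \<forall>b\<in>C. E a b \<longrightarrow> b \<in> S"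
    then obtain a where a: "a \<in> S" by blast
    have step: "v \<in> S" if "F\<^sup>*\<^sup>* a v" for v
      using that
    proof induction
      case base then show ?case using a .
    next
      case (step y z)
      have "z \<in> C" using closed[of y z] step S(1) by (auto simp: F_def)
      then show ?case using step S(3) by (auto simp: F_def)
    qed
    have "F\<^sup>*\<^sup>* a c" using a S(1) symF by (auto simp: C_def dest: sympD[OF symp_rtranclp])
    hence "F\<^sup>*\<^sup>* a v" if "v \<in> C" for v using that by (auto simp: C_def)
    thus "S = C" using S(1) step by blast
  qed
qed

lemma connected_onD:
  "connected_on E C \<Longrightarrow> S \<subseteq> C \<Longrightarrow> S \<noteq> {} \<Longrightarrow> (\<And>a b. a \<in> S \<Longrightarrow> b \<in> C \<Longrightarrow> E a b \<Longrightarrow> b \<in> S) \<Longrightarrow> S = C"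
  unfolding connected_on_def by blast

lemma connected_on_switch:
  assumes "connected_on E C" "a \<in> C" "b \<in> C" "P a" "\<not> P b"
  obtains c d where "c \<in> C" "d \<in> C" "E c d" "P c" "\<not> P d"
proof (rule ccontr)
  assume no: "\<not> thesis"
  have "{x \<in> C. P x} = C"
    by (rule connected_onD[OF assms(1)]) (use no that assms(2,4) in auto)
  thus False using assms(3,5) by auto
qed

lemma connected_on_const:
  assumes "connected_on E C" "\<And>a b. a \<in> C \<Longrightarrow> b \<in> C \<Longrightarrow> E a b \<Longrightarrow> f a = f b" "a \<in> C" "b \<in> C"
  shows "f a = f b"
proof (rule ccontr)
  assume "f a \<noteq> f b"
  then obtain c d where "c \<in> C" "d \<in> C" "E c d" "f a = f c" "\<not> f a = f d"
    using connected_on_switch[OF assms(1,3,4), of "\<lambda>x. f a = f x"] by blast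
  thus False using assms(2) by auto
qed

lemma twins_sym: "twins r x a b \<longleftrightarrow> twins r x b a" by (auto simp: twins_def)

locale compatible =
  fixes V :: "'v set" and r r' :: "'v \<Rightarrow> 'v \<Rightarrow> 'c"
  assumes coh: "coherent V r" and reo: "reoriented V r r'"
    and tri: "triple_compat V r r'" and quad: "quad_compat V r r'"
begin

abbreviation R where "R \<equiv> red r r'"
abbreviation B where "B \<equiv> blue r r'"
abbreviation N where "N i j \<equiv> r i j = r j i"

lemma reoD: "i \<in> V \<Longrightarrow> j \<in> V \<Longrightarrow> i \<noteq> j \<Longrightarrow>
    (r' i j = r i j \<and> r' j i = r j i) \<or> (r' i j = r j i \<and> r' j i = r i j)"
  using reo by (auto simp: reoriented_def)

lemma R_sym: "i \<in> V \<Longrightarrow> j \<in> V \<Longrightarrow> i \<noteq> j \<Longrightarrow> R i j \<Longrightarrow> R j i"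
  using reoD[of i j] by (auto simp: red_def)
lemma B_sym: "i \<in> V \<Longrightarrow> j \<in> V \<Longrightarrow> B i j \<Longrightarrow> B j i"
  using reoD[of i j] by (auto simp: blue_def)
lemma B_neq: "B i j \<Longrightarrow> i \<noteq> j" by (auto simp: blue_def)
lemma colours: "i \<in> V \<Longrightarrow> j \<in> V \<Longrightarrow> i \<noteq> j \<Longrightarrow> (R i j \<and> \<not> B i j \<and> \<not> N i j) \<or> (B i j \<and> \<not> R i j \<and> \<not> N i j) \<or> (N i j \<and> \<not> R i j \<and> \<not> B i j)"
  using reoD[of i j] by (auto simp: blue_def red_def)

lemma tri_RB: "\<lbrakk>i \<in> V; j \<in> V; k \<in> V; i \<noteq> j; i \<noteq> k; j \<noteq> k; R i j; B i k\<rbrakk> \<Longrightarrow>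
    (R j k \<and> twins r j i k) \<or> (B j k \<and> twins r k i j)"
  using tri by (auto simp: triple_compat_def)

lemma quadD: "\<lbrakk>i \<in> V; j \<in> V; k \<in> V; l \<in> V; distinct [i, j, k, l]; R i j; B k l;
     N i k; N i l; N j k; N j l\<rbrakk> \<Longrightarrow>
     (twins r i k l \<and> twins r j k l) \<or> (twins r k i j \<and> twins r l i j)"
  using quad unfolding quad_compat_def by blast

lemma coh_out: "\<lbrakk>i \<in> V; j \<in> V; k \<in> V; l \<in> V; i \<noteq> j; i \<noteq> k; i \<noteq> l; j \<noteq> k; j \<noteq> l;
    r i k = r i l; r j k \<noteq> r j l\<rbrakk> \<Longrightarrow> r i j = r i k"
  using coh[unfolded coherent_def, THEN bspec, THEN bspec, THEN bspec, THEN bspec, of i j k l]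
  by (cases "k = l") auto
lemma coh_in: "\<lbrakk>i \<in> V; j \<in> V; k \<in> V; l \<in> V; i \<noteq> j; i \<noteq> k; i \<noteq> l; j \<noteq> k; j \<noteq> l;
    r k i = r l i; r k j \<noteq> r l j\<rbrakk> \<Longrightarrow> r j i = r k i"
  using coh[unfolded coherent_def, THEN bspec, THEN bspec, THEN bspec, THEN bspec, of i j k l]
  by (cases "k = l") auto

definition hmodule where
  "hmodule Z \<longleftrightarrow> Z \<subseteq> V \<and> (\<forall>x\<in>V - Z. \<forall>a\<in>Z. \<forall>b\<in>Z. twins r x a b \<and> twins r' x a b)"

lemma transposed: "compatible V r (\<lambda>i j. r' j i)"
proof -
  have rb: "red r (\<lambda>i j. r' j i) i j = B i j" "blue r (\<lambda>i j. r' j i) i j = R i j"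
    if "i \<in> V" "j \<in> V" "i \<noteq> j" for i j
    using reoD[OF that] by (auto simp: red_def blue_def)
  show ?thesis
  proof
    show "coherent V r" by (rule coh)
    show "reoriented V r (\<lambda>i j. r' j i)"
      using reo unfolding reoriented_def by blast
    show "triple_compat V r (\<lambda>i j. r' j i)"
      unfolding triple_compat_def
    proof (intro ballI impI, goal_cases)
      case (1 i j k)
      have d: "i \<noteq> j" "i \<noteq> k" "j \<noteq> k" using 1 by auto
      have "B i j" "R i k" using 1 d rb by auto
      hence "(R k j \<and> twins r k i j) \<or> (B k j \<and> twins r j i k)"
        using tri_RB[of i k j] 1 d by auto
      then show ?case using 1 d rb[of j k] R_sym[of k j] B_sym[of k j] by auto
    qed
    show "quad_compat V r (\<lambda>i j. r' j i)"
      unfolding quad_compat_def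
    proof (intro ballI impI, goal_cases)
      case (1 i j k l)
      have "B i j" "R k l" using 1 rb by auto
      then show ?case using quadD[of k l i j] 1 by auto
    qed
  qed
qed

lemma closure_uniform:
  assumes C: "C \<subseteq> V" and both: "\<And>x. x \<in> V - C \<Longrightarrow> \<exists>a\<in>C. \<exists>b\<in>C. \<not> twins r x a b \<Longrightarrow>
      (\<exists>a\<in>C. \<exists>b\<in>C. r x a \<noteq> r x b) \<and> (\<exists>a\<in>C. \<exists>b\<in>C. r a x \<noteq> r b x)"
    and Z: "Z = C \<union> {x \<in> V - C. \<exists>a\<in>C. \<exists>b\<in>C. \<not> twins r x a b}"
    and x: "x \<in> V - Z" "u \<in> Z" "v \<in> Z"
  shows "twins r x u v"
proof -
  have unif: "twins r x a b" if "a \<in> C" "b \<in> C" for a b using x(1) that by (auto simp: Z)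
  have "twins r x a w" if a: "a \<in> C" and w: "w \<in> Z" for a w
  proof (cases "w \<in> C")
    case True thus ?thesis using unif a by blast
  next
    case False
    hence w': "w \<in> V - C" "\<exists>a\<in>C. \<exists>b\<in>C. \<not> twins r w a b" using w by (auto simp: Z)
    from both[OF w'] obtain c d e f where cd: "c \<in> C" "d \<in> C" "r w c \<noteq> r w d"
      and ef: "e \<in> C" "f \<in> C" "r e w \<noteq> r f w" by blast
    have "r x w = r x c"
      by (rule coh_out[of x w c d]) (use x w w' C cd unif[OF cd(1,2)] in \<open>auto simp: Z twins_def\<close>)
    moreover have "r w x = r e x"
      by (rule coh_in[of x w e f]) (use x w w' C ef unif[OF ef(1,2)] in \<open>auto simp: Z twins_def\<close>)
    ultimately show ?thesis using unif[OF a cd(1)] unif[OF a ef(1)] by (auto simp: twins_def)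
  qed
  moreover obtain a where "a \<in> C" using x(2) by (auto simp: Z)
  ultimately have "twins r x a u" "twins r x a v" using x(2,3) by blast+
  thus ?thesis by (auto simp: twins_def)
qed

lemma blue_component:
  assumes simple: "\<And>Z a b. hmodule Z \<Longrightarrow> a \<in> Z \<Longrightarrow> b \<in> Z \<Longrightarrow> a \<noteq> b \<Longrightarrow> Z = V"
    and C: "C \<subseteq> V" "connected_on B C" "\<And>a b. a \<in> C \<Longrightarrow> b \<in> V \<Longrightarrow> B a b \<Longrightarrow> b \<in> C"
    and two: "a \<in> C" "b \<in> C" "a \<noteq> b" and x: "x \<in> V - C"
  shows "(\<forall>c\<in>C. N x c) \<and> (\<exists>c\<in>C. \<exists>d\<in>C. B c d \<and> \<not> twins r x c d)"
proof -
  have red_step: "R y d \<and> twins r y c d" if "y \<in> V - C" "c \<in> C" "d \<in> C" "B c d" "R y c" for y c d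
  proof -
    have "(R y d \<and> twins r y c d) \<or> (B y d \<and> twins r d c y)"
      using tri_RB[of c y d] that C(1) R_sym[of y c] B_neq by blast
    moreover have "\<not> B y d" using that C(1,3) B_sym[of y d] by blast
    ultimately show ?thesis by blast
  qed
  have red_all: "R y d \<and> twins r y c d" if y: "y \<in> V - C" and "c \<in> C" "d \<in> C" "R y c" for y c d
  proof -
    have R: "R y e" if "e \<in> C" for e
      using connected_on_const[OF C(2) _ \<open>c \<in> C\<close> that, of "R y"] red_step[OF y] \<open>R y c\<close>
        B_sym C(1) by (meson subsetD)
    have "twins r y c d"
    proof (rule ccontr)
      assume "\<not> twins r y c d"
      then obtain e f where "e \<in> C" "f \<in> C" "B e f" "twins r y c e" "\<not> twins r y c f"
        using connected_on_switch[OF C(2) \<open>c \<in> C\<close> \<open>d \<in> C\<close>, of "twins r y c"] by (auto simp: twins_def)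
      thus False using red_step[OF y _ _ _ R[of e], of f] by (auto simp: twins_def)
    qed
    thus ?thesis using R that by blast
  qed
  have N_all: "N y c" if "y \<in> V - C" "c \<in> C" "\<not> R y c" for y c
    using colours[of y c] that C(1,3) B_sym[of y c] by blast
  define Z where "Z = C \<union> {x \<in> V - C. \<exists>a\<in>C. \<exists>b\<in>C. \<not> twins r x a b}"
  have dist_N: "\<not> R y c" if "y \<in> V - C" "\<exists>a\<in>C. \<exists>b\<in>C. \<not> twins r y a b" "c \<in> C" for y c
  proof
    assume R: "R y c"
    obtain a b where ab: "a \<in> C" "b \<in> C" "\<not> twins r y a b" using \<open>\<exists>a\<in>C. \<exists>b\<in>C. \<not> twins r y a b\<close> by blast
    show False using red_all[OF that(1) that(3) ab(1) R] red_all[OF that(1) that(3) ab(2) R] ab(3)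
      by (auto simp: twins_def)
  qed
  have unif: "twins r y u v" if "y \<in> V - Z" "u \<in> Z" "v \<in> Z" for y u v
  proof (rule closure_uniform[OF C(1) _ Z_def that], goal_cases)
    case (1 y)
    have n: "N y c" if "c \<in> C" for c using N_all[OF 1(1) that] dist_N[OF 1] that by blast
    obtain c d where "c \<in> C" "d \<in> C" "r y c \<noteq> r y d \<or> r c y \<noteq> r d y"
      using 1(2) by (auto simp: twins_def)
    then show ?case using n by metis
  qed
  have "hmodule Z"
    unfolding hmodule_def
  proof (intro conjI ballI)
    show "Z \<subseteq> V" using C(1) by (auto simp: Z_def)
    fix y u v assume y: "y \<in> V - Z" and u: "u \<in> Z" and v: "v \<in> Z"
    show "twins r y u v" by (rule unif[OF y u v])
    have yC: "y \<in> V - C" using y by (auto simp: Z_def)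
    have red_Z: "R y w" if "R y a" "w \<in> Z" for w
    proof (cases "w \<in> C")
      case True thus ?thesis using red_all[OF yC two(1) True that(1)] by blast
    next
      case False
      hence w: "w \<in> V - C" "\<exists>a\<in>C. \<exists>b\<in>C. \<not> twins r w a b" using that by (auto simp: Z_def)
      have Nwa: "N w a" by (rule N_all[OF w(1) two(1) dist_N[OF w two(1)]])
      have tw: "twins r y a w" using unif[OF y _ that(2), of a] two by (auto simp: Z_def)
      have yw: "y \<noteq> w" using y that by blast
      have "\<not> N y a" using colours[of y a] that(1) yC two(1) C(1) by auto
      hence "\<not> N y w" using tw by (auto simp: twins_def)
      moreover have "\<not> B y w"
      proof
        assume "B y w"
        hence "R a w \<or> B a w" using tri_RB[of y a w] that(1) yC w(1) two C(1) yw by auto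
        thus False using Nwa colours[of a w] w(1) two C(1) by auto
      qed
      ultimately show ?thesis using colours[of y w] yC w(1) yw by auto
    qed
    have N_Z: "N y w" if "\<not> R y a" "w \<in> Z" for w
      using unif[OF y _ that(2), of a] N_all[OF yC two(1) that(1)] two by (auto simp: Z_def twins_def)
    have V: "y \<in> V" "u \<in> V" "v \<in> V" "y \<noteq> u" "y \<noteq> v" using y u v \<open>Z \<subseteq> V\<close> by auto
    show "twins r' y u v"
    proof (cases "R y a")
      case True
      thus ?thesis using red_Z[OF True u] red_Z[OF True v] reoD[of y u] reoD[of y v] V unif[OF y u v]
        by (auto simp: red_def twins_def)
    next
      case False
      thus ?thesis using N_Z[OF False u] N_Z[OF False v] reoD[of y u] reoD[of y v] V unif[OF y u v]
        by (auto simp: twins_def)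
    qed
  qed
  hence "Z = V" using simple[of Z a b] two by (auto simp: Z_def)
  hence dx: "\<exists>a\<in>C. \<exists>b\<in>C. \<not> twins r x a b" using x by (auto simp: Z_def)
  then obtain c d where cd: "c \<in> C" "d \<in> C" "\<not> twins r x c d" by blast
  obtain e f where ef: "e \<in> C" "f \<in> C" "B e f" "twins r x c e" "\<not> twins r x c f"
    using connected_on_switch[OF C(2) cd(1,2), of "twins r x c"] cd(3) by (auto simp: twins_def)
  hence "\<not> twins r x e f" by (auto simp: twins_def)
  with ef have "\<exists>e\<in>C. \<exists>f\<in>C. B e f \<and> \<not> twins r x e f" by blast
  moreover have "\<forall>c\<in>C. N x c" using N_all[OF x] dist_N[OF x dx] by simp
  ultimately show ?thesis by simp
qed

lemma hmodule_transposed: "compatible.hmodule V r (\<lambda>i j. r' j i) Z \<longleftrightarrow> hmodule Z"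
proof -
  interpret T: compatible V r "\<lambda>i j. r' j i" by (rule transposed)
  show ?thesis by (auto simp: hmodule_def T.hmodule_def twins_def)
qed

lemma blue_transposed: "i \<in> V \<Longrightarrow> j \<in> V \<Longrightarrow> i \<noteq> j \<Longrightarrow> blue r (\<lambda>i j. r' j i) i j = R i j"
  and red_transposed: "i \<in> V \<Longrightarrow> j \<in> V \<Longrightarrow> i \<noteq> j \<Longrightarrow> red r (\<lambda>i j. r' j i) i j = B i j"
  using reoD[of i j] by (auto simp: red_def blue_def)

lemma N_majority:
  assumes "j \<in> V" "k \<in> V" "l \<in> V" "x \<in> V" "x \<noteq> j" "x \<noteq> k" "x \<noteq> l" "j \<noteq> k" "j \<noteq> l"
    and "twins r j k l" "\<not> N j k" "N x j" "N x k" "N x l"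
  shows "twins r x k l"
proof (rule ccontr)
  assume "\<not> twins r x k l"
  hence ne: "r x k \<noteq> r x l" "r k x \<noteq> r l x" using assms by (auto simp: twins_def)
  have "r j x = r j k" using coh_out[of j x k l] assms ne by (auto simp: twins_def)
  moreover have "r x j = r k j" using coh_in[of j x k l] assms ne by (auto simp: twins_def)
  ultimately show False using assms by auto
qed
end

locale prime_compatible = compatible +
  assumes simple: "\<And>Z a b. hmodule Z \<Longrightarrow> a \<in> Z \<Longrightarrow> b \<in> Z \<Longrightarrow> a \<noteq> b \<Longrightarrow> Z = V"
    and red_ex: "\<exists>k\<in>V. \<exists>l\<in>V. k \<noteq> l \<and> R k l" and blue_ex: "\<exists>k\<in>V. \<exists>l\<in>V. B k l"
begin

lemma prime_transposed: "prime_compatible V r (\<lambda>i j. r' j i)"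
proof -
  interpret T: compatible V r "\<lambda>i j. r' j i" by (rule transposed)
  show ?thesis
  proof
    fix Z a b assume "T.hmodule Z" "a \<in> Z" "b \<in> Z" "a \<noteq> b"
    thus "Z = V" using simple hmodule_transposed by blast
  next
    show "\<exists>k\<in>V. \<exists>l\<in>V. k \<noteq> l \<and> T.R k l" using blue_ex red_transposed B_neq by meson
    show "\<exists>k\<in>V. \<exists>l\<in>V. T.B k l" using red_ex blue_transposed by meson
  qed
qed

lemma red_component:
  assumes C: "C \<subseteq> V" "connected_on R C" "\<And>a b. a \<in> C \<Longrightarrow> b \<in> V \<Longrightarrow> a \<noteq> b \<Longrightarrow> R a b \<Longrightarrow> b \<in> C"
    and two: "a \<in> C" "b \<in> C" "a \<noteq> b" and x: "x \<in> V - C"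
  shows "(\<forall>c\<in>C. N x c) \<and> (\<exists>c\<in>C. \<exists>d\<in>C. c \<noteq> d \<and> R c d \<and> \<not> twins r x c d)"
proof -
  interpret T: prime_compatible V r "\<lambda>i j. r' j i" by (rule prime_transposed)
  have conn: "connected_on T.B C"
    unfolding connected_on_def
  proof (intro allI impI)
    fix S assume S: "S \<subseteq> C" "S \<noteq> {}" "\<forall>a\<in>S. \<forall>b\<in>C. T.B a b \<longrightarrow> b \<in> S"
    have "b \<in> S" if "a \<in> S" "b \<in> C" "R a b" for a b
      using S that C(1) blue_transposed[of a b] by (cases "a = b") auto
    thus "S = C" using connected_onD[OF C(2) S(1,2)] by blast
  qed
  have "(\<forall>c\<in>C. N x c) \<and> (\<exists>c\<in>C. \<exists>d\<in>C. T.B c d \<and> \<not> twins r x c d)"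
  proof (rule T.blue_component[OF T.simple C(1) conn _ two x])
    fix a b assume "a \<in> C" "b \<in> V" "T.B a b"
    thus "b \<in> C" using C(1,3) blue_transposed[of a b] T.B_neq[of a b] by auto
  qed
  then obtain c d where "\<forall>c\<in>C. N x c" "c \<in> C" "d \<in> C" "T.B c d" "\<not> twins r x c d" by blast
  thus ?thesis using blue_transposed[of c d] T.B_neq[of c d] C(1) by blast
qed

lemma red_component_exists:
  assumes "c \<in> W" "W \<subseteq> V"
  obtains C where "C \<subseteq> W" "c \<in> C" "connected_on R C" "\<And>a b. a \<in> C \<Longrightarrow> b \<in> W \<Longrightarrow> a \<noteq> b \<Longrightarrow> R a b \<Longrightarrow> b \<in> C"
proof -
  have s: "a \<noteq> b \<and> R a b \<Longrightarrow> b \<noteq> a \<and> R b a" if "a \<in> W" "b \<in> W" for a b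
    using R_sym[of a b] that assms by blast
  obtain C where C: "C \<subseteq> W" "c \<in> C" "connected_on (\<lambda>a b. a \<noteq> b \<and> R a b) C"
    "\<And>a b. a \<in> C \<Longrightarrow> b \<in> W \<Longrightarrow> a \<noteq> b \<and> R a b \<Longrightarrow> b \<in> C"
    using component_exists[where E = "\<lambda>a b. a \<noteq> b \<and> R a b", OF s assms(1)] by blast
  show thesis
  proof (rule that[OF C(1,2)])
    show "connected_on R C" using C(3) unfolding connected_on_def by blast
  qed (use C(4) in blast)
qed

lemma blue_connected: "connected_on B V"
proof -
  obtain u v where uv: "u \<in> V" "v \<in> V" "B u v" using blue_ex by blast
  obtain k l where kl: "k \<in> V" "l \<in> V" "k \<noteq> l" "R k l" using red_ex by blast
  obtain C where C: "C \<subseteq> V" "u \<in> C" "connected_on B C" "\<And>a b. a \<in> C \<Longrightarrow> b \<in> V \<Longrightarrow> B a b \<Longrightarrow> b \<in> C"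
    using component_exists[where E = B, OF B_sym uv(1)] by blast
  obtain D where D: "D \<subseteq> V" "k \<in> D" "connected_on R D" "\<And>a b. a \<in> D \<Longrightarrow> b \<in> V \<Longrightarrow> a \<noteq> b \<Longrightarrow> R a b \<Longrightarrow> b \<in> D"
    using red_component_exists[OF kl(1) subset_refl] by blast
  have vC: "v \<in> C" "u \<noteq> v" and lD: "l \<in> D" using C D uv kl B_neq by auto
  have bc: "(\<forall>c\<in>C. N x c) \<and> (\<exists>c\<in>C. \<exists>d\<in>C. B c d \<and> \<not> twins r x c d)" if "x \<in> V - C" for x
    by (rule blue_component[where a = u and b = v]) (fact simple C vC that)+
  have rc: "(\<forall>c\<in>D. N x c) \<and> (\<exists>c\<in>D. \<exists>d\<in>D. c \<noteq> d \<and> R c d \<and> \<not> twins r x c d)" if "x \<in> V - D" for x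
    by (rule red_component[where a = k and b = l]) (fact D lD kl that)+
  have notR: "\<not> R a b" if "a \<in> C" "b \<in> V - C" for a b
    using bc[OF that(2)] that colours[of a b] C(1) by fastforce
  have notB: "\<not> B a b" if "a \<in> D" "b \<in> V - D" for a b
    using rc[OF that(2)] that colours[of a b] D(1) by fastforce
  have "C = V"
  proof (rule ccontr)
    assume "C \<noteq> V"
    then obtain x where x: "x \<in> V - C" using C(1) by blast
    show False
    proof (cases "C \<inter> D = {}")
      case False
      then obtain a where a: "a \<in> C" "a \<in> D" by blast
      have "D \<subseteq> C"
      proof
        fix b assume b: "b \<in> D"
        show "b \<in> C"
        proof (rule ccontr)
          assume "b \<notin> C"
          then obtain c d where "c \<in> D" "d \<in> D" "R c d" "c \<in> C" "d \<notin> C"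
            using connected_on_switch[OF D(3) a(2) b, of "\<lambda>x. x \<in> C"] a by blast
          thus False using notR[of c d] D(1) by blast
        qed
      qed
      moreover have "C \<subseteq> D"
      proof
        fix b assume b: "b \<in> C"
        show "b \<in> D"
        proof (rule ccontr)
          assume "b \<notin> D"
          then obtain c d where "c \<in> C" "d \<in> C" "B c d" "c \<in> D" "d \<notin> D"
            using connected_on_switch[OF C(3) a(1) b, of "\<lambda>x. x \<in> D"] a by blast
          thus False using notB[of c d] C(1) by blast
        qed
      qed
      ultimately have DC: "D = C" by blast
      have xN: "N x c" if "c \<in> C" for c using bc[OF x] that by blast
      obtain p q where pq: "p \<in> C" "q \<in> C" "p \<noteq> q" "R p q" "\<not> twins r x p q"
        using rc[of x] x DC by blast
      obtain c d where cd: "c \<in> C" "d \<in> C" "B c d" "c \<noteq> q \<and> R c q \<and> twins r x p c"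
        "\<not> (d \<noteq> q \<and> R d q \<and> twins r x p d)"
        using connected_on_switch[OF C(3) pq(1,2), of "\<lambda>a. a \<noteq> q \<and> R a q \<and> twins r x p a"] pq
        by (auto simp: twins_def)
      have V: "c \<in> V" "d \<in> V" "q \<in> V" "x \<in> V" "x \<noteq> c" "x \<noteq> d" "x \<noteq> q" using cd pq C(1) x by auto
      have ne: "c \<noteq> d" "d \<noteq> q" "c \<noteq> q" using cd colours[of c q] V B_neq by auto
      consider "R q d" "twins r q c d" | "B q d" "twins r d c q"
        using tri_RB[of c q d] cd V ne by blast
      thus False
      proof cases
        case 1
        have "twins r x c d"
          by (rule N_majority[of q]) (use V ne 1 xN cd pq colours[of q c] R_sym[of c q] in auto)
        thus False using cd R_sym[of q d] V ne 1 by (auto simp: twins_def)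
      next
        case 2
        have "twins r x c q"
          by (rule N_majority[of d]) (use V ne 2 xN cd pq colours[of d c] B_sym[of c d] in auto)
        thus False using cd pq by (auto simp: twins_def)
      qed
    next
      case True
      have kC: "k \<in> V - C" using D True by blast
      obtain i j where ij: "i \<in> C" "j \<in> C" "B i j" "\<not> twins r k i j" using bc[OF kC] by blast
      have iD: "i \<in> V - D" using ij C(1) True by blast
      have P: "\<not> twins r m i j \<and> twins r i k m" if m: "m \<in> D" for m
      proof (rule ccontr)
        assume "\<not> (\<not> twins r m i j \<and> twins r i k m)"
        then obtain c d where cd: "c \<in> D" "d \<in> D" "R c d" "\<not> twins r c i j \<and> twins r i k c"
          "\<not> (\<not> twins r d i j \<and> twins r i k d)"
          using connected_on_switch[OF D(3,2) m, of "\<lambda>m. \<not> twins r m i j \<and> twins r i k m"] ij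
          by (auto simp: twins_def)
        have VC: "c \<in> V - C" "d \<in> V - C" using cd D(1) True by auto
        have "c \<noteq> d" using cd by auto
        hence "(twins r c i j \<and> twins r d i j) \<or> (twins r i c d \<and> twins r j c d)"
          using quadD[of c d i j] cd VC ij C(1) bc[OF VC(1)] bc[OF VC(2)] B_neq[of i j] by auto
        thus False using cd by (auto simp: twins_def)
      qed
      obtain c d where cd: "c \<in> D" "d \<in> D" "\<not> twins r i c d" using rc[OF iD] by blast
      show False using cd(3) P[OF cd(1)] P[OF cd(2)] unfolding twins_def by metis
    qed
  qed
  thus ?thesis using C(3) by simp
qed

lemma mixed_triangle_exists:
  obtains y k l where "y \<in> V" "k \<in> V" "l \<in> V" "k \<noteq> l" "R k l" "B y k" "B y l"
proof -
  obtain k l where kl: "k \<in> V" "l \<in> V" "k \<noteq> l" "R k l" using red_ex by blast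
  obtain c d where cd: "c \<in> V" "d \<in> V" "B c d" "c \<noteq> l \<and> R c l" "\<not> (d \<noteq> l \<and> R d l)"
    using connected_on_switch[OF blue_connected kl(1,2), of "\<lambda>a. a \<noteq> l \<and> R a l"] kl by blast
  have ne: "c \<noteq> d" "d \<noteq> l" "c \<noteq> l" using cd colours[of c l] kl B_neq by auto
  have "B l d" using tri_RB[of c l d] cd kl ne R_sym[of l d] by blast
  show thesis by (rule that[of d c l]) (use cd kl ne B_sym \<open>B l d\<close> in auto)
qed

lemma red_module_exists:
  obtains Q y k l where "Q \<subseteq> V" "y \<in> V - Q" "k \<in> Q" "l \<in> Q" "k \<noteq> l" "R k l"
    "\<And>x a b. x \<in> V - Q \<Longrightarrow> a \<in> Q \<Longrightarrow> b \<in> Q \<Longrightarrow> twins r x a b"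
proof -
  obtain y k l where ykl: "y \<in> V" "k \<in> V" "l \<in> V" "k \<noteq> l" "R k l" "B y k" "B y l"
    by (rule mixed_triangle_exists)
  define W where "W = {v \<in> V. B y v}"
  have kW: "k \<in> W" and WV: "W \<subseteq> V" using ykl by (auto simp: W_def)
  obtain C where C: "C \<subseteq> W" "k \<in> C" "connected_on R C" "\<And>a b. a \<in> C \<Longrightarrow> b \<in> W \<Longrightarrow> a \<noteq> b \<Longrightarrow> R a b \<Longrightarrow> b \<in> C"
    using red_component_exists[OF kW WV] by blast
  have CV: "C \<subseteq> V" and lC: "l \<in> C" and By: "\<And>a. a \<in> C \<Longrightarrow> B y a" and yC: "y \<notin> C"
    using C ykl by (auto simp: W_def blue_def)
  have blue_step: "twins r b c d" if "b \<in> V" "c \<in> C" "d \<in> C" "c \<noteq> d" "R c d" "B b c" "B b d" for b c d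
    using tri_RB[of c d b] that CV B_sym[of b c] B_sym[of b d] B_neq colours[of d b] by blast
  have unif_of: "twins r b c d" if cd: "c \<in> C" "d \<in> C" and Bb: "\<And>a. a \<in> C \<Longrightarrow> B b a" and bV: "b \<in> V" for b c d
  proof (rule ccontr)
    assume "\<not> twins r b c d"
    then obtain e f where ef: "e \<in> C" "f \<in> C" "R e f" "twins r b c e" "\<not> twins r b c f"
      using connected_on_switch[OF C(3) cd, of "twins r b c"] by (auto simp: twins_def)
    hence "e \<noteq> f" by auto
    thus False using blue_step[OF bV ef(1,2) _ ef(3) Bb[OF ef(1)] Bb[OF ef(2)]] ef
      by (auto simp: twins_def)
  qed
  define w z where "w = r y k" and "z = r k y"
  have wz: "r y a = w" "r a y = z" if "a \<in> C" for a
    using unif_of[OF C(2) that By] ykl by (auto simp: w_def z_def twins_def)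
  have wz_ne: "w \<noteq> z" using ykl by (auto simp: w_def z_def blue_def)
  define Q where "Q = C \<union> {x \<in> V - C. \<exists>a\<in>C. \<exists>b\<in>C. \<not> twins r x a b}"
  have both: "(\<exists>a\<in>C. \<exists>b\<in>C. r x a \<noteq> r x b) \<and> (\<exists>a\<in>C. \<exists>b\<in>C. r a x \<noteq> r b x)"
    if x: "x \<in> V - C" and dist: "\<exists>a\<in>C. \<exists>b\<in>C. \<not> twins r x a b" for x
  proof -
    have xy: "x \<noteq> y" using dist wz by (auto simp: twins_def)
    obtain a0 b0 where ab0: "a0 \<in> C" "b0 \<in> C" "\<not> twins r x a0 b0" using dist by blast
    show ?thesis
    proof (cases "R y x")
      case False
      have noR: "\<not> R x a" if "a \<in> C" for a
      proof
        assume Rxa: "R x a"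
        have "\<not> B y x" using C(4)[OF \<open>a \<in> C\<close>, of x] x Rxa R_sym[of x a] that CV by (auto simp: W_def)
        moreover have "R y x \<or> B y x"
          using tri_RB[of a x y] Rxa R_sym[of x a] R_sym[of x y] B_sym[of x y] B_sym[of y a] that CV x ykl(1) By[OF that] xy yC by auto
        ultimately show False using False by blast
      qed
      have step: "B x d" if "c \<in> C" "d \<in> C" "R c d" "B x c" for c d
      proof -
        have "c \<noteq> d" using that by (auto simp: red_def)
        hence "R d x \<or> B d x" using tri_RB[of c d x] that CV x B_sym[of x c] by auto
        thus ?thesis using noR[of d] R_sym[of d x] B_sym[of d x] that CV x by auto
      qed
      have "\<not> B x c" if "c \<in> C" for c
      proof
        assume "B x c"
        hence "B x a" if "a \<in> C" for a
          using connected_on_switch[OF C(3) \<open>c \<in> C\<close> that, of "B x"] step by blast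
        thus False using unif_of[OF ab0(1,2), of x] x ab0 by blast
      qed
      hence "N x c" if "c \<in> C" for c using colours[of x c] noR x that CV by blast
      thus ?thesis using ab0 by (auto simp: twins_def)
    next
      case True
      have cases: "(R x a \<and> r x a = r x y \<and> r a x = r y x) \<or> (B x a \<and> r x a = w \<and> r a x = z)" if a: "a \<in> C" for a
      proof -
        have "y \<noteq> a" "x \<noteq> a" using a yC x by auto
        thus ?thesis
          using tri_RB[of y x a] True x a subsetD[OF CV a] ykl(1) xy By[OF a] wz[OF a] by (auto simp: twins_def)
      qed
      obtain a b where ab: "a \<in> C" "b \<in> C" "R x a" "\<not> R x b"
        using ab0 cases[OF ab0(1)] cases[OF ab0(2)] colours[of x a0] colours[of x b0] x CV
        by (auto simp: twins_def)
      obtain c d where cd: "c \<in> C" "d \<in> C" "R c d" "R x c" "\<not> R x d"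
        using connected_on_switch[OF C(3) ab] by blast
      hence c: "r x c = r x y" "r c x = r y x" using cases[of c] colours[of x c] x CV by auto
      have d: "B x d" "r x d = w" "r d x = z" using cases[of d] cd by auto
      have nN: "r x y \<noteq> r y x" using True colours[of y x] x ykl(1) xy by auto
      have "r y x = w \<or> r x y = z"
      proof (rule ccontr)
        assume n: "\<not> (r y x = w \<or> r x y = z)"
        have "r x c = r x d" using coh_out[of y x c d] n wz cd x CV ykl(1) xy yC by auto
        moreover have "r c x = r d x" using coh_in[of y x c d] n wz cd x CV ykl(1) xy yC by auto
        ultimately have "r x y = w" "r y x = z" using c d by auto
        hence "r x a = w \<and> r a x = z" if "a \<in> C" for a using cases[OF that] by auto
        thus False using ab0 by (auto simp: twins_def)
      qed
      hence "r x c \<noteq> r x d \<and> r c x \<noteq> r d x" using c d nN wz_ne by auto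
      thus ?thesis using cd by blast
    qed
  qed
  show thesis
  proof (rule that[of Q y k l])
    show "Q \<subseteq> V" using CV by (auto simp: Q_def)
    show "y \<in> V - Q" using ykl yC wz by (auto simp: Q_def twins_def)
    show "k \<in> Q" "l \<in> Q" using C lC by (auto simp: Q_def)
    show "twins r x a b" if "x \<in> V - Q" "a \<in> Q" "b \<in> Q" for x a b
      by (rule closure_uniform[OF CV both Q_def that])
  qed (use ykl in auto)
qed

end

section \<open>Determinants indexed by lists\<close>

definition pdet :: "('v \<Rightarrow> 'v \<Rightarrow> 'a::comm_ring_1) \<Rightarrow> 'v list \<Rightarrow> 'a" where
  "pdet f xs = det (mat (length xs) (length xs) (\<lambda>(i, j). f (xs ! i) (xs ! j)))"

lemma pdet_cong: "xs = ys \<Longrightarrow> (\<And>x y. x \<in> set xs \<Longrightarrow> y \<in> set xs \<Longrightarrow> f x y = g x y) \<Longrightarrow> pdet f xs = pdet g ys"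
  unfolding pdet_def by (intro arg_cong[where f = det] eq_matI) auto

lemma pdet_permute:
  assumes "mset xs = mset ys"
  shows "pdet f xs = pdet f ys"
proof -
  obtain p where p: "p permutes {..<length xs}" "permute_list p xs = ys"
    using mset_eq_permutation[of ys xs] assms by metis
  let ?n = "length xs"
  have p': "p permutes {0..<?n}" using p(1) by (simp add: lessThan_atLeast0)
  have n: "length ys = ?n" using p(2) by auto
  have ys: "ys ! i = xs ! p i" if "i < ?n" for i using p that by (simp add: permute_list_nth flip: p(2))
  have lt: "p i < ?n" if "i < ?n" for i using permutes_in_image[OF p(1)] that by auto
  define X where "X = mat ?n ?n (\<lambda>(i, j). f (xs ! i) (xs ! j))"
  define Y where "Y = mat ?n ?n (\<lambda>(i, j). X $$ (p i, j))"
  have X: "X \<in> carrier_mat ?n ?n" and Y: "Y \<in> carrier_mat ?n ?n" by (auto simp: X_def Y_def)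
  have "mat ?n ?n (\<lambda>(i, j). f (ys ! i) (ys ! j)) = transpose_mat (mat ?n ?n (\<lambda>(i, j). transpose_mat Y $$ (p i, j)))"
    by (intro eq_matI) (auto simp: ys lt X_def Y_def)
  hence "pdet f ys = det (mat ?n ?n (\<lambda>(i, j). transpose_mat Y $$ (p i, j)))"
    by (simp add: pdet_def n det_transpose[of _ ?n])
  also have "\<dots> = signof p * det (transpose_mat Y)"
    by (rule det_permute_rows[OF _ p']) (use Y in auto)
  also have "\<dots> = signof p * (signof p * det X)"
    using det_permute_rows[OF X p'] unfolding det_transpose[OF Y] Y_def[symmetric] by simp
  also have "\<dots> = det X" by (simp add: sign_def)
  finally show ?thesis by (simp add: pdet_def X_def)
qed

lemma pdet_transpose: "pdet (\<lambda>i j. f j i) xs = pdet f xs"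
proof -
  have "mat (length xs) (length xs) (\<lambda>(i, j). f (xs ! j) (xs ! i)) =
      transpose_mat (mat (length xs) (length xs) (\<lambda>(i, j). f (xs ! i) (xs ! j)))"
    by (intro eq_matI) auto
  thus ?thesis unfolding pdet_def by (simp add: det_transpose[of _ "length xs"])
qed

lemma pdet_scale:
  fixes f :: "'v \<Rightarrow> 'v \<Rightarrow> 'a::comm_ring_1"
  shows "pdet (\<lambda>i j. u i * f i j * v j) xs = (\<Prod>x\<leftarrow>xs. u x) * (\<Prod>x\<leftarrow>xs. v x) * pdet f xs"
proof -
  let ?n = "length xs"
  have prods: "(\<Prod>x\<leftarrow>xs. g x) = (\<Prod>i = 0..<?n. g (xs ! i))" for g :: "'v \<Rightarrow> 'a"
    by (simp add: prod.list_conv_set_nth)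
  have "pdet (\<lambda>i j. u i * f i j * v j) xs = (\<Sum>p | p permutes {0..<?n}. signof p *
      (\<Prod>i = 0..<?n. u (xs ! i) * f (xs ! i) (xs ! p i) * v (xs ! p i)))"
    unfolding pdet_def by (subst det_def'[of _ ?n]) (auto intro!: sum.cong arg_cong2[of _ _ _ _ times] prod.cong simp: permutes_in_image)
  also have "\<dots> = (\<Sum>p | p permutes {0..<?n}. (\<Prod>x\<leftarrow>xs. u x) * (\<Prod>x\<leftarrow>xs. v x) *
      (signof p * (\<Prod>i = 0..<?n. f (xs ! i) (xs ! p i))))"
  proof (intro sum.cong refl)
    fix p assume "p \<in> {p. p permutes {0..<?n}}"
    hence "(\<Prod>i = 0..<?n. v (xs ! p i)) = (\<Prod>i = 0..<?n. v (xs ! i))"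
      using prod.permute[of p "{0..<?n}" "\<lambda>i. v (xs ! i)"] by (simp add: comp_def)
    thus "signof p * (\<Prod>i = 0..<?n. u (xs ! i) * f (xs ! i) (xs ! p i) * v (xs ! p i)) =
      (\<Prod>x\<leftarrow>xs. u x) * (\<Prod>x\<leftarrow>xs. v x) * (signof p * (\<Prod>i = 0..<?n. f (xs ! i) (xs ! p i)))"
      by (simp add: prods prod.distrib mult_ac)
  qed
  also have "\<dots> = (\<Prod>x\<leftarrow>xs. u x) * (\<Prod>x\<leftarrow>xs. v x) * pdet f xs"
    unfolding pdet_def by (subst det_def'[of _ ?n]) (auto simp: sum_distrib_left[symmetric] intro!: sum.cong prod.cong arg_cong2[of _ _ _ _ times] simp: permutes_in_image)
  finally show ?thesis .
qed

lemma pdet_row_add: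
  assumes "distinct xs" "k \<in> set xs"
  shows "pdet (f(k := (\<lambda>j. a j + b j))) xs = pdet (f(k := a)) xs + pdet (f(k := b)) xs"
proof -
  let ?n = "length xs"
  obtain m where m: "m < ?n" "xs ! m = k" using assms by (metis in_set_conv_nth)
  have eq: "xs ! i = k \<longleftrightarrow> i = m" if "i < ?n" for i
    using assms m that by (auto simp: nth_eq_iff_index_eq)
  have row: "mat ?n ?n (\<lambda>(i, j). (f(k := g)) (xs ! i) (xs ! j)) =
      mat\<^sub>r ?n ?n (\<lambda>i. if i = m then vec ?n (\<lambda>j. g (xs ! j)) else vec ?n (\<lambda>j. f (xs ! i) (xs ! j)))" for g
    by (intro eq_matI) (auto simp: eq)
  have v: "vec ?n (\<lambda>j. a (xs ! j) + b (xs ! j)) = vec ?n (\<lambda>j. a (xs ! j)) + vec ?n (\<lambda>j. b (xs ! j))" by auto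
  show ?thesis unfolding pdet_def row v
    using det_row_add[of "\<lambda>_. vec ?n (\<lambda>j. a (xs ! j))" m ?n "\<lambda>_. vec ?n (\<lambda>j. b (xs ! j))"
      "\<lambda>i. vec ?n (\<lambda>j. f (xs ! i) (xs ! j))"] m(1) by auto
qed

lemma pdet_row_copy:
  assumes "distinct xs" "k \<in> set xs" "q \<in> set xs" "k \<noteq> q" "\<And>j. j \<in> set xs \<Longrightarrow> f k j = f q j"
  shows "pdet f xs = 0"
proof -
  obtain m m' where m: "m < length xs" "xs ! m = k" "m' < length xs" "xs ! m' = q" "m \<noteq> m'"
    using assms by (metis in_set_conv_nth)
  show ?thesis unfolding pdet_def
    by (rule det_identical_rows[of _ "length xs" m m']) (use m assms in \<open>auto intro!: eq_vecI\<close>)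
qed

lemma pdet_subtract_row:
  assumes "distinct xs" "k \<in> set xs" "q \<in> set xs" "k \<noteq> q"
  shows "pdet (f(q := (\<lambda>j. f q j - c * f k j))) xs = pdet f xs"
proof -
  have "f = f(q := (\<lambda>j. (f q j - c * f k j) + c * f k j))" by auto
  hence "pdet f xs = pdet (f(q := (\<lambda>j. (f q j - c * f k j) + c * f k j))) xs" by simp
  also have "\<dots> = pdet (f(q := (\<lambda>j. f q j - c * f k j))) xs + pdet (f(q := (\<lambda>j. c * f k j))) xs"
    by (rule pdet_row_add[OF assms(1,3)])
  also have "f(q := (\<lambda>j. c * f k j)) = (\<lambda>i j. (if i = q then c else 1) * (f(q := f k)) i j * 1)" by auto
  hence "pdet (f(q := (\<lambda>j. c * f k j))) xs = (\<Prod>x\<leftarrow>xs. if x = q then c else 1) * (\<Prod>x\<leftarrow>xs. 1) * pdet (f(q := f k)) xs"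
    by (simp only: pdet_scale)
  also have "pdet (f(q := f k)) xs = 0"
    by (rule pdet_row_copy[OF assms]) (use assms in auto)
  finally show ?thesis by (simp add: fun_upd_def)
qed

lemma pdet_subtract_rows:
  assumes "distinct xs" "k \<in> set xs" "S \<subseteq> set xs" "k \<notin> S"
  shows "pdet (\<lambda>i j. if i \<in> S then f i j - f k j else f i j) xs = pdet f xs"
proof -
  have "finite S" using assms(3) finite_subset by blast
  thus ?thesis using assms(3,4)
  proof (induction S)
    case (insert q S)
    define g where "g = (\<lambda>i j. if i \<in> S then f i j - f k j else f i j)"
    have "(\<lambda>i j. if i \<in> insert q S then f i j - f k j else f i j) = g(q := (\<lambda>j. g q j - 1 * g k j))"
      using insert by (auto simp: g_def fun_eq_iff)
    moreover have "pdet (g(q := (\<lambda>j. g q j - 1 * g k j))) xs = pdet g xs"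
      by (rule pdet_subtract_row) (use assms insert in auto)
    ultimately show ?case using insert by (simp add: g_def)
  qed simp
qed

lemma pdet_subtract_cols:
  assumes "distinct xs" "k \<in> set xs" "S \<subseteq> set xs" "k \<notin> S"
  shows "pdet (\<lambda>i j. if j \<in> S then f i j - f i k else f i j) xs = pdet f xs"
  using pdet_subtract_rows[OF assms, of "\<lambda>i j. f j i"]
  by (subst (1 2) pdet_transpose[symmetric]) simp

lemma pdet_block:
  fixes f :: "'v \<Rightarrow> 'v \<Rightarrow> 'a::idom"
  assumes "\<And>p q. p \<in> set xs \<Longrightarrow> q \<in> set ys \<Longrightarrow> f p q = 0"
  shows "pdet f (xs @ ys) = pdet f xs * pdet f ys"
proof -
  let ?n = "length xs" and ?m = "length ys"
  have "mat (?n + ?m) (?n + ?m) (\<lambda>(i, j). f ((xs @ ys) ! i) ((xs @ ys) ! j)) =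
    four_block_mat (mat ?n ?n (\<lambda>(i, j). f (xs ! i) (xs ! j))) (0\<^sub>m ?n ?m)
      (mat ?m ?n (\<lambda>(i, j). f (ys ! i) (xs ! j))) (mat ?m ?m (\<lambda>(i, j). f (ys ! i) (ys ! j)))"
    by (intro eq_matI) (auto simp: nth_append assms)
  thus ?thesis unfolding pdet_def
    by (simp, subst det_four_block_mat_upper_right_zero[of _ ?n _ ?m]) auto
qed

lemma pdet_block':
  fixes f :: "'v \<Rightarrow> 'v \<Rightarrow> 'a::idom"
  assumes "\<And>p q. p \<in> set xs \<Longrightarrow> q \<in> set ys \<Longrightarrow> f q p = 0"
  shows "pdet f (xs @ ys) = pdet f xs * pdet f ys"
  using pdet_block[of xs ys "\<lambda>i j. f j i"] assms
    pdet_transpose[of f xs] pdet_transpose[of f ys] pdet_transpose[of f "xs @ ys"] by simp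

lemma pdet_Nil [simp]: "pdet f [] = 1" by (simp add: pdet_def)
lemma pdet_single [simp]: "pdet f [x] = f x x" unfolding pdet_def by (subst det_single) auto

lemma pdet_cut_vertex:
  fixes f :: "'v \<Rightarrow> 'v \<Rightarrow> 'a::idom"
  assumes d: "distinct (xs @ k # ys)"
    and z: "\<And>p q. p \<in> set xs \<Longrightarrow> q \<in> set ys \<Longrightarrow> f p q = 0 \<and> f q p = 0"
  shows "pdet f (xs @ k # ys) = pdet f (xs @ [k]) * pdet f ys + pdet f xs * (pdet f (k # ys) - f k k * pdet f ys)"
proof -
  define a where "a = (\<lambda>j. if j \<in> set ys then 0 else f k j)"
  define b where "b = (\<lambda>j. if j \<in> set ys then f k j else 0)"
  have f: "f = f(k := (\<lambda>j. a j + b j))" by (auto simp: a_def b_def fun_eq_iff)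
  have split: "pdet f zs = pdet (f(k := a)) zs + pdet (f(k := b)) zs" if "distinct zs" "k \<in> set zs" for zs
    by (subst f, rule pdet_row_add[OF that])
  have a_split: "pdet (f(k := a)) (zs @ ys) = pdet f zs * pdet f ys" if "set zs \<subseteq> insert k (set xs)" for zs
  proof -
    have "pdet (f(k := a)) (zs @ ys) = pdet (f(k := a)) zs * pdet (f(k := a)) ys"
      by (rule pdet_block) (use that z d in \<open>auto simp: a_def\<close>)
    also have "pdet (f(k := a)) zs = pdet f zs"
      by (rule pdet_cong) (use that d in \<open>auto simp: a_def\<close>)
    also have "pdet (f(k := a)) ys = pdet f ys" by (rule pdet_cong) (use d in auto)
    finally show ?thesis .
  qed
  have "pdet (f(k := b)) (xs @ k # ys) = pdet (f(k := b)) xs * pdet (f(k := b)) (k # ys)"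
    by (rule pdet_block') (use z d in \<open>auto simp: b_def\<close>)
  also have "pdet (f(k := b)) xs = pdet f xs" by (rule pdet_cong) (use d in auto)
  also have "pdet (f(k := b)) (k # ys) = pdet f (k # ys) - f k k * pdet f ys"
    using split[of "k # ys"] a_split[of "[k]"] d by simp
  finally show ?thesis using split[of "xs @ k # ys"] a_split[of "xs @ [k]"] d by (simp add: fun_upd_def)
qed

definition relative :: "('v \<Rightarrow> 'v \<Rightarrow> 'a::comm_ring_1) \<Rightarrow> 'v \<Rightarrow> 'v \<Rightarrow> 'v \<Rightarrow> 'a" where
  "relative f k i j = f i j - f i k - f k j + f k k"

lemma pdet_module:
  fixes f :: "'v \<Rightarrow> 'v \<Rightarrow> 'a::idom"
  assumes d: "distinct (xs @ k # ys)"
    and u: "\<And>p q. p \<in> set xs \<Longrightarrow> q \<in> set ys \<Longrightarrow> f p q = f p k \<and> f q p = f k p"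
  shows "pdet f (xs @ k # ys) = pdet f (xs @ [k]) * pdet (relative f k) ys +
    pdet f xs * (pdet f (k # ys) - f k k * pdet (relative f k) ys)"
proof -
  define g where "g = (\<lambda>i j. if i \<in> set ys then f i j - f k j else f i j)"
  define h where "h = (\<lambda>i j. if j \<in> set ys then g i j - g i k else g i j)"
  have h: "pdet h zs = pdet f zs" if "distinct zs" "k \<in> set zs" "set ys \<subseteq> set zs" for zs
    unfolding h_def using that d by (subst pdet_subtract_cols) (auto simp: g_def intro!: pdet_subtract_rows)
  have hf: "pdet h zs = pdet f zs" if "set zs \<inter> set ys = {}" for zs
    by (rule pdet_cong) (use that in \<open>auto simp: h_def g_def\<close>)
  have hr: "pdet h ys = pdet (relative f k) ys"
    by (rule pdet_cong) (use d in \<open>auto simp: h_def g_def relative_def\<close>)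
  have "pdet h (xs @ k # ys) = pdet h (xs @ [k]) * pdet h ys + pdet h xs * (pdet h (k # ys) - h k k * pdet h ys)"
    by (rule pdet_cut_vertex[OF d]) (use d u in \<open>auto simp: h_def g_def\<close>)
  moreover have "h k k = f k k" using d by (auto simp: h_def g_def)
  moreover have "pdet h (xs @ k # ys) = pdet f (xs @ k # ys)" "pdet h (k # ys) = pdet f (k # ys)"
    by (rule h; use d in auto)+
  ultimately show ?thesis using hf[of "xs @ [k]"] hf[of xs] hr d by (auto simp: disjoint_iff)
qed

lemma det_mat_Suc:
  "det (mat (Suc n) (Suc n) g) = (\<Sum>j<Suc n. g (0, j) * (-1) ^ j *
     det (mat n n (\<lambda>(i, k). g (Suc i, if k < j then k else Suc k))))"
  (is "det ?A = _")
proof -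
  have "det ?A = (\<Sum>j<Suc n. ?A $$ (0, j) * cofactor ?A 0 j)"
    by (subst laplace_expansion_row[of _ "Suc n" 0]) auto
  also have "\<dots> = (\<Sum>j<Suc n. g (0, j) * (-1) ^ j * det (mat n n (\<lambda>(i, k). g (Suc i, if k < j then k else Suc k))))"
  proof (intro sum.cong refl)
    fix j assume "j \<in> {..<Suc n}"
    hence "mat_delete ?A 0 j = mat n n (\<lambda>(i, k). g (Suc i, if k < j then k else Suc k))"
      by (intro eq_matI) (auto simp: mat_delete_def)
    thus "?A $$ (0, j) * cofactor ?A 0 j = g (0, j) * (-1) ^ j *
        det (mat n n (\<lambda>(i, k). g (Suc i, if k < j then k else Suc k)))"
      using \<open>j \<in> _\<close> by (simp add: cofactor_def)
  qed
  finally show ?thesis .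
qed

lemma det_mat_1: "det (mat 1 1 g) = g (0, 0)"
  by (subst det_single) auto

lemma det_mat_2: "det (mat 2 2 g) = g (0, 0) * g (1, 1) - g (0, 1) * g (1, 0)"
proof -
  have "det (mat 2 2 g) = det (mat (Suc 1) (Suc 1) g)" by (simp add: numeral_2_eq_2)
  also have "\<dots> = g (0, 0) * g (1, 1) - g (0, 1) * g (1, 0)"
    unfolding det_mat_Suc[of 1] det_mat_1 by (simp add: lessThan_Suc)
  finally show ?thesis .
qed

lemma det_mat_3: "det (mat 3 3 g) = g (0, 0) * (g (1, 1) * g (2, 2) - g (1, 2) * g (2, 1))
   - g (0, 1) * (g (1, 0) * g (2, 2) - g (1, 2) * g (2, 0)) + g (0, 2) * (g (1, 0) * g (2, 1) - g (1, 1) * g (2, 0))"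
proof -
  have "det (mat 3 3 g) = det (mat (Suc 2) (Suc 2) g)" by (simp add: numeral_3_eq_3 numeral_2_eq_2)
  also have "\<dots> = g (0, 0) * (g (1, 1) * g (2, 2) - g (1, 2) * g (2, 1))
   - g (0, 1) * (g (1, 0) * g (2, 2) - g (1, 2) * g (2, 0)) + g (0, 2) * (g (1, 0) * g (2, 1) - g (1, 1) * g (2, 0))"
    unfolding det_mat_Suc[of 2] det_mat_2 by (simp add: lessThan_Suc numeral_2_eq_2)
  finally show ?thesis .
qed

lemma pdet_2: "pdet f [a, b] = f a a * f b b - f a b * f b a"
  using det_mat_2[of "\<lambda>(i, j). f ([a, b] ! i) ([a, b] ! j)"] by (simp add: pdet_def flip: numeral_2_eq_2)

definition det3 :: "('v \<Rightarrow> 'v \<Rightarrow> 'a::comm_ring_1) \<Rightarrow> 'v \<Rightarrow> 'v \<Rightarrow> 'v \<Rightarrow> 'v \<Rightarrow> 'v \<Rightarrow> 'v \<Rightarrow> 'a" where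
  "det3 f a b c x y z = f a x * (f b y * f c z - f b z * f c y)
   - f a y * (f b x * f c z - f b z * f c x) + f a z * (f b x * f c y - f b y * f c x)"

lemma pdet_3: "pdet f [a, b, c] = det3 f a b c a b c"
  using det_mat_3[of "\<lambda>(i, j). f ([a, b, c] ! i) ([a, b, c] ! j)"] by (simp add: pdet_def det3_def numeral_2_eq_2 flip: numeral_3_eq_3)

lemma pdet_4: "pdet f [a, b, c, d] = f a a * det3 f b c d b c d - f a b * det3 f b c d a c d
   + f a c * det3 f b c d a b d - f a d * det3 f b c d a b c"
proof -
  have "pdet f [a, b, c, d] = det (mat (Suc 3) (Suc 3) (\<lambda>(i, j). f ([a, b, c, d] ! i) ([a, b, c, d] ! j)))"
    by (simp add: pdet_def numeral_3_eq_3)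
  also have "\<dots> = f a a * det3 f b c d b c d - f a b * det3 f b c d a c d
   + f a c * det3 f b c d a b d - f a d * det3 f b c d a b c"
    unfolding det_mat_Suc[of 3] det_mat_3
    by (simp add: det3_def lessThan_Suc numeral_2_eq_2 numeral_3_eq_3)
  finally show ?thesis .
qed

section \<open>Chains of linked pairs\<close>

definition linked_triple :: "('v \<Rightarrow> 'v \<Rightarrow> 'c) \<Rightarrow> 'v \<Rightarrow> 'v \<Rightarrow> 'v \<Rightarrow> bool" where
  "linked_triple r i j k \<longleftrightarrow> r i j \<noteq> r j i \<and> r i k \<noteq> r k i \<and> \<not> twins r k i j \<and> \<not> twins r j i k"
definition linear :: "('v \<Rightarrow> 'v \<Rightarrow> 'c) \<Rightarrow> 'c \<Rightarrow> 'c \<Rightarrow> 'v \<Rightarrow> 'v \<Rightarrow> 'v \<Rightarrow> bool" where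
  "linear r w z i k j \<longleftrightarrow> r i k = w \<and> r k i = z \<and> r k j = w \<and> r j k = z \<and> r i j = w \<and> r j i = z"

lemma walk:
  assumes coh: "coherent V r" and wz: "w \<noteq> z"
    and V: "{i, k, j, x} \<subseteq> V" "distinct [i, k, j, x]"
    and lin: "linear r w z i k j"
    and sym: "\<And>a b. a \<in> V \<Longrightarrow> b \<in> V \<Longrightarrow> c a b = c b a"
    and link: "\<And>a b d. \<lbrakk>{a, b, d} \<subseteq> V; distinct [a, b, d]; linked_triple r a b d\<rbrakk> \<Longrightarrow> c a b = c a d"
    and ne: "c i j \<noteq> c i k" "c i j \<noteq> c k j"
  shows "linked_triple r i k x \<Longrightarrow> linear r w z i x j \<and> c x j = c k j"
    and "linked_triple r k i x \<Longrightarrow> linear r w z x k j \<and> c x j = c i j"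
    and "linked_triple r i j x \<Longrightarrow> linear r w z i k x \<and> c k x = c k j"
proof -
  have d: "i \<noteq> j" "i \<noteq> k" "i \<noteq> x" "j \<noteq> k" "j \<noteq> x" "k \<noteq> x"
    "j \<noteq> i" "k \<noteq> i" "x \<noteq> i" "k \<noteq> j" "x \<noteq> j" "x \<noteq> k" using V by auto
  note c = coh[THEN coherent_subset, OF V(1), unfolded coherent_def, simplified d, simplified]
  have l: "\<forall>a\<in>{i,k,j,x}. \<forall>b\<in>{i,k,j,x}. \<forall>d\<in>{i,k,j,x}. distinct [a, b, d] \<longrightarrow> linked_triple r a b d \<longrightarrow> c a b = c a d"
    using link V(1) by (metis insert_subset subsetD)
  have s: "\<forall>a\<in>{i,k,j,x}. \<forall>b\<in>{i,k,j,x}. c a b = c b a" using sym V(1) by blast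
  note l' = l[unfolded linked_triple_def twins_def, simplified d, simplified]
  note s' = s[simplified d, simplified]
  show "linked_triple r i k x \<Longrightarrow> linear r w z i x j \<and> c x j = c k j"
    using lin wz ne c l' s' d unfolding linear_def linked_triple_def twins_def by (smt (verit))
  show "linked_triple r k i x \<Longrightarrow> linear r w z x k j \<and> c x j = c i j"
    using lin wz ne c l' s' d unfolding linear_def linked_triple_def twins_def by (smt (verit))
  show "linked_triple r i j x \<Longrightarrow> linear r w z i k x \<and> c k x = c k j"
    using lin wz ne c l' s' d unfolding linear_def linked_triple_def twins_def by (smt (verit))
qed

lemma walk_quad:
  assumes coh: "coherent V r" and wz: "w \<noteq> z"
    and V: "{i, k, j, x} \<subseteq> V" "distinct [i, k, j, x]"
    and lin: "linear r w z i k j"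
  shows "r x i = r i x \<Longrightarrow> r x k = r k x \<Longrightarrow> twins r x i k"
    and "r x k = r k x \<Longrightarrow> r x j = r j x \<Longrightarrow> twins r x k j"
    and "r x i = r i x \<Longrightarrow> r x j = r j x \<Longrightarrow> twins r x i j"
proof -
  have d: "i \<noteq> j" "i \<noteq> k" "i \<noteq> x" "j \<noteq> k" "j \<noteq> x" "k \<noteq> x"
    "j \<noteq> i" "k \<noteq> i" "x \<noteq> i" "k \<noteq> j" "x \<noteq> j" "x \<noteq> k" using V by auto
  note c = coh[THEN coherent_subset, OF V(1), unfolded coherent_def, simplified d, simplified]
  show "r x i = r i x \<Longrightarrow> r x k = r k x \<Longrightarrow> twins r x i k"
    using lin wz c d unfolding linear_def twins_def by (smt (verit))
  show "r x k = r k x \<Longrightarrow> r x j = r j x \<Longrightarrow> twins r x k j"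
    using lin wz c d unfolding linear_def twins_def by (smt (verit))
  show "r x i = r i x \<Longrightarrow> r x j = r j x \<Longrightarrow> twins r x i j"
    using lin wz c d unfolding linear_def twins_def by (smt (verit))
qed

definition linked_quad :: "('v \<Rightarrow> 'v \<Rightarrow> 'c) \<Rightarrow> 'v \<Rightarrow> 'v \<Rightarrow> 'v \<Rightarrow> 'v \<Rightarrow> bool" where
  "linked_quad r i j k l \<longleftrightarrow> r i j \<noteq> r j i \<and> r k l \<noteq> r l k \<and>
     r i k = r k i \<and> r i l = r l i \<and> r j k = r k j \<and> r j l = r l j \<and>
     \<not> ((twins r i k l \<and> twins r j k l) \<or> (twins r k i j \<and> twins r l i j))"

inductive_set links :: "'v set \<Rightarrow> ('v \<Rightarrow> 'v \<Rightarrow> 'c) \<Rightarrow> (('v \<times> 'v) \<times> ('v \<times> 'v)) set"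
  for V :: "'v set" and r :: "'v \<Rightarrow> 'v \<Rightarrow> 'c" where
  swap: "i \<in> V \<Longrightarrow> j \<in> V \<Longrightarrow> i \<noteq> j \<Longrightarrow> ((i, j), (j, i)) \<in> links V r"
| triple: "{i, j, k} \<subseteq> V \<Longrightarrow> distinct [i, j, k] \<Longrightarrow> linked_triple r i j k \<Longrightarrow> ((i, j), (i, k)) \<in> links V r"
| quad: "{i, j, k, l} \<subseteq> V \<Longrightarrow> distinct [i, j, k, l] \<Longrightarrow> linked_quad r i j k l \<Longrightarrow> ((i, j), (k, l)) \<in> links V r"

locale labelling =
  fixes V :: "nat set" and r r' :: "nat \<Rightarrow> nat \<Rightarrow> 'c" and c :: "nat \<Rightarrow> nat \<Rightarrow> 'l" and \<rho> :: "'c \<Rightarrow> 'c \<Rightarrow> 'c"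
  assumes coh: "coherent V r" and reo: "reoriented V r r'"
    and rho: "\<rho> x y \<in> {x, y}" "\<rho> x y = \<rho> y x"
    and lnk: "((i, j), (k, l)) \<in> links V r \<Longrightarrow> c i j = c k l"
    and conn: "\<lbrakk>{i, j, k, l} \<subseteq> V; r i j \<noteq> r j i; r k l \<noteq> r l k; c i j = c k l\<rbrakk> \<Longrightarrow>
       ((i, j), (k, l)) \<in> (links V r)\<^sup>*"
    and colour: "\<lbrakk>{i, j, k, l} \<subseteq> V; r i j \<noteq> r j i; r k l \<noteq> r l k; c i j = c k l\<rbrakk> \<Longrightarrow>
       r' i j = r i j \<longleftrightarrow> r' k l = r k l"
    and rep: "\<lbrakk>{i, j} \<subseteq> V; r i j \<noteq> r j i\<rbrakk> \<Longrightarrow> \<exists>a\<in>V. \<exists>b\<in>V. r a b \<noteq> r b a \<and> c a b = c i j \<and>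
       r' a b = \<rho> (r a b) (r b a) \<and> (\<forall>k\<in>V. \<forall>l\<in>V. r k l \<noteq> r l k \<longrightarrow> c k l = c i j \<longrightarrow> a \<le> k)"
begin

lemma sym: "i \<in> V \<Longrightarrow> j \<in> V \<Longrightarrow> c i j = c j i"
  using lnk[OF links.swap[of i V j r]] by (cases "i = j") auto

lemma lnk_triple: "\<lbrakk>{a, b, d} \<subseteq> V; distinct [a, b, d]; linked_triple r a b d\<rbrakk> \<Longrightarrow> c a b = c a d"
  by (rule lnk[OF links.triple])

lemma walks:
  assumes "w \<noteq> z" "{i, k, j, x} \<subseteq> V" "distinct [i, k, j, x]" "linear r w z i k j"
    "c i j \<noteq> c i k" "c i j \<noteq> c k j"
  shows "linked_triple r i k x \<Longrightarrow> linear r w z i x j \<and> c x j = c k j"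
    and "linked_triple r k i x \<Longrightarrow> linear r w z x k j \<and> c x j = c i j"
    and "linked_triple r i j x \<Longrightarrow> linear r w z i k x \<and> c k x = c k j"
  using walk[where c = c, OF coh assms(1-4) sym _ assms(5,6)] lnk_triple by blast+

definition lin where
  "lin w z \<alpha> \<beta> \<gamma> i k j \<longleftrightarrow> {i, k, j} \<subseteq> V \<and> distinct [i, k, j] \<and> linear r w z i k j \<and> w \<noteq> z \<and>
     c i k = \<alpha> \<and> c k j = \<beta> \<and> c i j = \<gamma> \<and> \<alpha> \<noteq> \<gamma> \<and> \<beta> \<noteq> \<gamma>"

lemma lin_reverse: "lin w z \<alpha> \<beta> \<gamma> i k j \<longleftrightarrow> lin z w \<beta> \<alpha> \<gamma> j k i"
  unfolding lin_def linear_def using sym by auto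

lemma lin_no_quad:
  assumes l: "lin w z \<alpha> \<beta> \<gamma> i k j" and ab: "a \<in> {i, k, j}" "b \<in> {i, k, j}" "a \<noteq> b"
    and V: "{a, b, d, e} \<subseteq> V" "distinct [a, b, d, e]"
  shows "\<not> linked_quad r a b d e" "\<not> linked_quad r d e a b"
proof -
  have *: "twins r x a b" if x: "x \<in> V" "x \<noteq> a" "x \<noteq> b" "r a x = r x a" "r b x = r x b" for x
  proof -
    have "x \<notin> {i, k, j}" using l ab x by (auto simp: lin_def linear_def)
    thus ?thesis using walk_quad[OF coh, of w z i k j x] l ab x
      by (auto simp: lin_def twins_sym[of r x k i] twins_sym[of r x j i] twins_sym[of r x j k])
  qed
  show "\<not> linked_quad r a b d e" "\<not> linked_quad r d e a b"
    using *[of d] *[of e] V by (auto simp: linked_quad_def)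
qed

lemma lin_no_triple:
  assumes "lin w z \<alpha> \<beta> \<gamma> i k j" "distinct [a, b, d]" "a \<in> {i, k, j}" "b \<in> {i, k, j}" "d \<in> {i, k, j}"
  shows "\<not> linked_triple r a b d"
  using assms unfolding lin_def linear_def linked_triple_def twins_def by auto

lemma walk_first:
  assumes l: "lin w z \<alpha> \<beta> \<gamma> i k j" and p: "((i, k), p) \<in> (links V r)\<^sup>*"
  shows "lin w z \<alpha> \<beta> \<gamma> (fst p) (snd p) j \<or> lin w z \<alpha> \<beta> \<gamma> (snd p) (fst p) j"
  using p
proof (induction rule: rtrancl_induct)
  case base then show ?case using l by simp
next
  case (step q p)
  obtain a b a1 b1 where q: "q = (a, b)" "p = (a1, b1)" by (metis surj_pair)
  consider "lin w z \<alpha> \<beta> \<gamma> a b j" | "lin w z \<alpha> \<beta> \<gamma> b a j" using step.IH q by auto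
  note ih = this
  from step.hyps(2)[unfolded q] show ?case
  proof (cases rule: links.cases)
    case swap then show ?thesis using step.IH q by auto
  next
    case triple
    define d where "d = b1"
    have t: "p = (a, d)" "{a, b, d} \<subseteq> V" "distinct [a, b, d]" "linked_triple r a b d"
      using triple q by (auto simp: d_def)
    have cad: "c a d = c a b" using lnk_triple[OF t(2-4)] by simp
    from ih show ?thesis
    proof cases
      case 1
      have "d \<noteq> j" using lin_no_triple[OF 1, of a b d] t by auto
      hence "linear r w z a d j \<and> c d j = c b j"
        using walks(1)[of w z a b j d] 1 t by (auto simp: lin_def)
      then show ?thesis using 1 t cad \<open>d \<noteq> j\<close> by (auto simp: lin_def)
    next
      case 2
      have "d \<noteq> j" using lin_no_triple[OF 2, of a b d] t by auto
      hence "linear r w z d a j \<and> c d j = c b j"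
        using walks(2)[of w z b a j d] 2 t by (auto simp: lin_def)
      then show ?thesis using 2 t cad \<open>d \<noteq> j\<close> sym by (auto simp: lin_def)
    qed
  next
    case quad
    then show ?thesis using ih lin_no_quad(1)[of w z \<alpha> \<beta> \<gamma> a b j a b a1 b1]
      lin_no_quad(1)[of w z \<alpha> \<beta> \<gamma> b a j a b a1 b1] by auto
  qed
qed

lemma walk_last:
  assumes l: "lin w z \<alpha> \<beta> \<gamma> i k j" and p: "((i, j), p) \<in> (links V r)\<^sup>*"
  shows "lin w z \<alpha> \<beta> \<gamma> (fst p) k (snd p) \<or> lin w z \<alpha> \<beta> \<gamma> (snd p) k (fst p)"
  using p
proof (induction rule: rtrancl_induct)
  case base then show ?case using l by simp
next
  case (step q p)
  obtain a b a1 b1 where q: "q = (a, b)" "p = (a1, b1)" by (metis surj_pair)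
  consider "lin w z \<alpha> \<beta> \<gamma> a k b" | "lin w z \<alpha> \<beta> \<gamma> b k a" using step.IH q by auto
  note ih = this
  have tr: "lin w z \<alpha> \<beta> \<gamma> a k d"
    if l: "lin w z \<alpha> \<beta> \<gamma> a k b" and t: "{a, b, d} \<subseteq> V" "distinct [a, b, d]" "linked_triple r a b d"
    for w z \<alpha> \<beta> d
  proof -
    have cad: "c a d = c a b" using lnk_triple[OF t] by simp
    have dk: "d \<noteq> k" using lin_no_triple[OF l, of a b d] t by auto
    hence "linear r w z a k d \<and> c k d = c k b"
      using walks(3)[of w z a k b d] l t by (auto simp: lin_def)
    then show ?thesis using l t cad dk by (auto simp: lin_def)
  qed
  from step.hyps(2)[unfolded q] show ?case
  proof (cases rule: links.cases)
    case swap then show ?thesis using step.IH q by auto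
  next
    case triple
    then show ?thesis using ih tr[of w z \<alpha> \<beta> b1] tr[of z w \<beta> \<alpha> b1] q lin_reverse by auto
  next
    case quad
    then show ?thesis using ih lin_no_quad(1)[of w z \<alpha> \<beta> \<gamma> a k b a b a1 b1]
      lin_no_quad(1)[of w z \<alpha> \<beta> \<gamma> b k a a b a1 b1] by auto
  qed
qed

lemma walk_middle:
  assumes l: "lin w z \<alpha> \<beta> \<gamma> i k j" and p: "((k, j), p) \<in> (links V r)\<^sup>*"
  shows "lin w z \<alpha> \<beta> \<gamma> i (fst p) (snd p) \<or> lin w z \<alpha> \<beta> \<gamma> i (snd p) (fst p)"
proof -
  have "((j, k), p) \<in> (links V r)\<^sup>*"
    using l p by (auto simp: lin_def intro!: converse_rtrancl_into_rtrancl[OF links.swap])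
  from walk_first[OF l[unfolded lin_reverse[of w]] this] show ?thesis using lin_reverse by auto
qed

lemma lin_antisym:
  assumes "lin w z \<alpha> \<beta> \<gamma> i k j"
  shows "i \<in> V" "k \<in> V" "j \<in> V" "r i k \<noteq> r k i" "r k j \<noteq> r j k" "r i j \<noteq> r j i"
    "c i k = \<alpha>" "c k j = \<beta>" "c i j = \<gamma>" "r i k = w" "r k j = w" "r i j = w" "r k i = z" "r j k = z" "r j i = z" "w \<noteq> z"
  using assms by (auto simp: lin_def linear_def)

lemma lin_disjoint:
  assumes a: "lin w z \<alpha> \<beta> \<gamma> x k j" and b: "lin w z \<alpha> \<beta> \<gamma> i x l"
  shows False
proof -
  have "((x, k), (i, x)) \<in> (links V r)\<^sup>*"
    by (rule conn) (use lin_antisym[OF a] lin_antisym[OF b] in auto)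
  from walk_first[OF a this] have "lin w z \<alpha> \<beta> \<gamma> i x j \<or> lin w z \<alpha> \<beta> \<gamma> x i j" by simp
  thus False using lin_antisym[OF a] lin_antisym[OF b] by (auto simp: lin_def linear_def)
qed

lemma lin_colours:
  assumes l: "lin w z \<alpha> \<beta> \<gamma> i k j" and eq: "r' i k = r i k \<longleftrightarrow> r' k j = r k j"
  shows "r' i j = r i j \<longleftrightarrow> r' i k = r i k"
proof (rule ccontr)
  assume ne: "\<not> ?thesis"
  note v = lin_antisym[OF l]
  obtain a1 b1 where 1: "a1 \<in> V" "b1 \<in> V" "r a1 b1 \<noteq> r b1 a1" "c a1 b1 = \<alpha>" "r' a1 b1 = \<rho> (r a1 b1) (r b1 a1)"
    and m1: "\<And>k l. \<lbrakk>k \<in> V; l \<in> V; r k l \<noteq> r l k; c k l = \<alpha>\<rbrakk> \<Longrightarrow> a1 \<le> k" using rep[of i k] v by auto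
  obtain a2 b2 where 2: "a2 \<in> V" "b2 \<in> V" "r a2 b2 \<noteq> r b2 a2" "c a2 b2 = \<beta>" "r' a2 b2 = \<rho> (r a2 b2) (r b2 a2)"
    and m2: "\<And>k l. \<lbrakk>k \<in> V; l \<in> V; r k l \<noteq> r l k; c k l = \<beta>\<rbrakk> \<Longrightarrow> a2 \<le> k" using rep[of k j] v by auto
  obtain a3 b3 where 3: "a3 \<in> V" "b3 \<in> V" "r a3 b3 \<noteq> r b3 a3" "c a3 b3 = \<gamma>" "r' a3 b3 = \<rho> (r a3 b3) (r b3 a3)"
    and m3: "\<And>k l. \<lbrakk>k \<in> V; l \<in> V; r k l \<noteq> r l k; c k l = \<gamma>\<rbrakk> \<Longrightarrow> a3 \<le> k" using rep[of i j] v by auto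
  have t1: "lin w z \<alpha> \<beta> \<gamma> a1 b1 j \<or> lin w z \<alpha> \<beta> \<gamma> b1 a1 j"
    using walk_first[OF l conn, of a1 b1] 1 v by auto
  have t2: "lin w z \<alpha> \<beta> \<gamma> i a2 b2 \<or> lin w z \<alpha> \<beta> \<gamma> i b2 a2"
    using walk_middle[OF l conn, of a2 b2] 2 v by auto
  have t3: "lin w z \<alpha> \<beta> \<gamma> a3 k b3 \<or> lin w z \<alpha> \<beta> \<gamma> b3 k a3"
    using walk_last[OF l conn, of a3 b3] 3 v by auto
  have k1: "r' i k = r i k \<longleftrightarrow> r a1 b1 = \<rho> w z"
    using colour[of i k a1 b1] 1 v t1 rho(2)[of w z] lin_antisym[of w z \<alpha> \<beta> \<gamma> a1 b1 j] lin_antisym[of w z \<alpha> \<beta> \<gamma> b1 a1 j] by auto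
  have k2: "r' k j = r k j \<longleftrightarrow> r a2 b2 = \<rho> w z"
    using colour[of k j a2 b2] 2 v t2 rho(2)[of w z] lin_antisym[of w z \<alpha> \<beta> \<gamma> i a2 b2] lin_antisym[of w z \<alpha> \<beta> \<gamma> i b2 a2] by auto
  have k3: "r' i j = r i j \<longleftrightarrow> r a3 b3 = \<rho> w z"
    using colour[of i j a3 b3] 3 v t3 rho(2)[of w z] lin_antisym[of w z \<alpha> \<beta> \<gamma> a3 k b3] lin_antisym[of w z \<alpha> \<beta> \<gamma> b3 k a3] by auto
  have m: "a1 \<le> x" "a3 \<le> x" "a1 \<le> y" "a2 \<le> y" "a2 \<le> u" "a3 \<le> u" if t: "lin w z \<alpha> \<beta> \<gamma> x y u" for x y u
    using lin_antisym[OF t] m1[of x y] m1[of y x] m2[of y u] m2[of u y] m3[of x u] m3[of u x] sym by auto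
  have w1: "lin w z \<alpha> \<beta> \<gamma> a1 b1 j" if "r a1 b1 = w" using t1 that lin_antisym[of w z \<alpha> \<beta> \<gamma> b1 a1 j] by auto
  have z1: "lin w z \<alpha> \<beta> \<gamma> b1 a1 j" if "r a1 b1 \<noteq> w" using t1 that lin_antisym[of w z \<alpha> \<beta> \<gamma> a1 b1 j] by auto
  have w2: "lin w z \<alpha> \<beta> \<gamma> i a2 b2" if "r a2 b2 = w" using t2 that lin_antisym[of w z \<alpha> \<beta> \<gamma> i b2 a2] by auto
  have z2: "lin w z \<alpha> \<beta> \<gamma> i b2 a2" if "r a2 b2 \<noteq> w" using t2 that lin_antisym[of w z \<alpha> \<beta> \<gamma> i a2 b2] by auto
  have w3: "lin w z \<alpha> \<beta> \<gamma> a3 k b3" if "r a3 b3 = w" using t3 that lin_antisym[of w z \<alpha> \<beta> \<gamma> b3 k a3] by auto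
  have z3: "lin w z \<alpha> \<beta> \<gamma> b3 k a3" if "r a3 b3 \<noteq> w" using t3 that lin_antisym[of w z \<alpha> \<beta> \<gamma> a3 k b3] by auto
  have vals: "r a1 b1 = w \<or> r a1 b1 = z" "r a2 b2 = w \<or> r a2 b2 = z" "r a3 b3 = w \<or> r a3 b3 = z"
    using t1 t2 t3 by (auto dest: lin_antisym)
  have \<rho>: "\<rho> w z = w \<or> \<rho> w z = z" "w \<noteq> z" using rho(1)[of w z] v by auto
  have "(r a1 b1 = w \<longleftrightarrow> r a2 b2 = w) \<and> (r a3 b3 = w \<longleftrightarrow> r a1 b1 \<noteq> w)"
    using k1 k2 k3 eq ne vals \<rho> by (smt (verit))
  then consider "r a1 b1 = w" "r a2 b2 = w" "r a3 b3 \<noteq> w" | "r a1 b1 \<noteq> w" "r a2 b2 \<noteq> w" "r a3 b3 = w" by blast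
  thus False
  proof cases
    case A: 1
    have "a1 = a2" using m[OF w1[OF A(1)]] m[OF w2[OF A(2)]] m[OF z3[OF A(3)]] by linarith
    thus False using lin_disjoint w1[OF A(1)] w2[OF A(2)] by blast
  next
    case A: 2
    have "a3 = a1" using m[OF z1[OF A(1)]] m[OF z2[OF A(2)]] m[OF w3[OF A(3)]] by linarith
    thus False using lin_disjoint w3[OF A(3)] z1[OF A(1)] by blast
  qed
qed

theorem compatible: "compatible V r r'"
proof
  show "coherent V r" "reoriented V r r'" by (fact coh reo)+
  have reoD: "(r' i j = r i j \<and> r' j i = r j i) \<or> (r' i j = r j i \<and> r' j i = r i j)"
    if "i \<in> V" "j \<in> V" "i \<noteq> j" for i j using reo that by (auto simp: reoriented_def)
  have red_iff: "red r r' i j \<longleftrightarrow> r i j \<noteq> r j i \<and> r' i j \<noteq> r i j" if "i \<in> V" "j \<in> V" "i \<noteq> j" for i j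
    using reoD[OF that] that by (auto simp: red_def)
  have unlinked: "twins r k i j \<or> twins r j i k"
    if "i \<in> V" "j \<in> V" "k \<in> V" "distinct [i, j, k]" "red r r' i j" "blue r r' i k" for i j k
    using colour[of i j i k] lnk_triple[of i j k] that red_iff[of i j]
    by (auto simp: linked_triple_def blue_def)
  show "triple_compat V r r'"
    unfolding triple_compat_def
  proof (intro ballI impI)
    fix i j k assume V: "i \<in> V" "j \<in> V" "k \<in> V" and d: "distinct [i, j, k]"
      and R: "red r r' i j" and B: "blue r r' i k"
    have sw: "red r r' j i" "blue r r' k i" using R B V d reoD[of i j] reoD[of i k] by (auto simp: red_def blue_def)
    have d': "i \<noteq> j" "i \<noteq> k" "j \<noteq> k" using d by auto
    from unlinked[OF V d R B] have "r j k \<noteq> r k j"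
      using R B red_iff[of i j] V d' by (auto simp: twins_def blue_def)
    then consider "red r r' j k" "red r r' k j" | "blue r r' j k" "blue r r' k j"
      using reoD[of j k] V d' by (auto simp: red_def blue_def)
    thus "(red r r' j k \<and> twins r j i k) \<or> (blue r r' j k \<and> twins r k i j)"
    proof cases
      case 1
      have "twins r j i k"
      proof (rule ccontr)
        assume n: "\<not> twins r j i k"
        hence t: "twins r k i j" "twins r i k j"
          using unlinked[OF V d R B] unlinked[of k j i] 1 sw V d' twins_sym[of r j k i] by auto
        have "linear r (r i j) (r j i) i j k" using t by (auto simp: linear_def twins_def)
        moreover have "c i k \<noteq> c i j" using colour[of i j i k] R B V d' red_iff[of i j] by (auto simp: blue_def)
        moreover have "c i k \<noteq> c j k" using colour[of j k i k] 1 B V d' red_iff[of j k] by (auto simp: blue_def)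
        ultimately have "lin (r i j) (r j i) (c i j) (c j k) (c i k) i j k"
          using V d' R red_iff[of i j] by (auto simp: lin_def)
        from lin_colours[OF this] show False using R B 1 by (auto simp: red_def blue_def)
      qed
      thus ?thesis using 1 by simp
    next
      case 2
      have "twins r k i j"
      proof (rule ccontr)
        assume n: "\<not> twins r k i j"
        hence t: "twins r j i k" "twins r i j k"
          using unlinked[OF V d R B] unlinked[of j i k] 2 sw V d' twins_sym[of r k j i] by auto
        have "linear r (r i k) (r k i) i k j" using t by (auto simp: linear_def twins_def)
        moreover have "c i j \<noteq> c i k" using colour[of i j i k] R B V d' red_iff[of i j] by (auto simp: blue_def)
        moreover have "c i j \<noteq> c k j" using colour[of k j i j] 2 R V d' red_iff[of i j] by (auto simp: blue_def)
        ultimately have "lin (r i k) (r k i) (c i k) (c k j) (c i j) i k j"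
          using V d' B by (auto simp: lin_def blue_def)
        from lin_colours[OF this] show False using R B 2 by (auto simp: red_def blue_def)
      qed
      thus ?thesis using 2 by simp
    qed
  qed
  show "quad_compat V r r'"
    unfolding quad_compat_def
  proof (intro ballI impI, rule ccontr)
    fix i j k l assume V: "i \<in> V" "j \<in> V" "k \<in> V" "l \<in> V" and d: "distinct [i, j, k, l]"
      and R: "red r r' i j" and B: "blue r r' k l"
      and n: "r i k = r k i" "r i l = r l i" "r j k = r k j" "r j l = r l j"
      and "\<not> ((twins r i k l \<and> twins r j k l) \<or> (twins r k i j \<and> twins r l i j))"
    hence "linked_quad r i j k l" using red_iff[of i j] by (auto simp: linked_quad_def blue_def)
    hence "c i j = c k l" using lnk[OF links.quad] V d by auto
    thus False using colour[of i j k l] R B V d red_iff[of i j] by (auto simp: red_def blue_def)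
  qed
qed

end

section \<open>Minors of compatible reorientations\<close>

context compatible begin
lemma four_points:
  assumes "{i, j, k, l} \<subseteq> V" "distinct [i, j, k, l]"
  shows "r' i k = r' i l \<longrightarrow> r' i k \<noteq> r' i j \<longrightarrow> r' j k = r' j l"
proof -
  have d: "i \<noteq> j" "i \<noteq> k" "i \<noteq> l" "j \<noteq> k" "j \<noteq> l" "k \<noteq> l"
    "j \<noteq> i" "k \<noteq> i" "l \<noteq> i" "k \<noteq> j" "l \<noteq> j" "l \<noteq> k" using assms by auto
  note c = coh[THEN coherent_subset, OF assms(1), unfolded coherent_def, simplified d, simplified]
  note q = quad[THEN quad_compat_subset, OF assms(1), unfolded quad_compat_def red_def blue_def twins_def, simplified d, simplified]
  note t = tri[THEN triple_compat_subset, OF assms(1), unfolded triple_compat_def red_def blue_def twins_def, simplified d, simplified]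
  note ro = reo[THEN reoriented_subset, OF assms(1), unfolded reoriented_def, simplified d, simplified]
  show ?thesis using c q t ro d by (smt (verit))
qed

lemma both_transposed: "compatible V (\<lambda>i j. r j i) (\<lambda>i j. r' j i)"
proof
  have tw: "twins (\<lambda>i j. r j i) x a b = twins r x a b" for x a b by (auto simp: twins_def)
  have rd: "red (\<lambda>i j. r j i) (\<lambda>i j. r' j i) i j = R j i" for i j by (auto simp: red_def)
  have bl: "blue (\<lambda>i j. r j i) (\<lambda>i j. r' j i) i j = B j i" for i j by (auto simp: blue_def)
  show "coherent V (\<lambda>i j. r j i)" using coh unfolding coherent_def by blast
  show "reoriented V (\<lambda>i j. r j i) (\<lambda>i j. r' j i)" using reo unfolding reoriented_def by blast
  show "triple_compat V (\<lambda>i j. r j i) (\<lambda>i j. r' j i)"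
    unfolding triple_compat_def tw rd bl
  proof (intro ballI impI)
    fix i j k assume "i \<in> V" "j \<in> V" "k \<in> V" "distinct [i, j, k]" "R j i" "B k i"
    thus "R k j \<and> twins r j i k \<or> B k j \<and> twins r k i j"
      using tri_RB[of i j k] R_sym[of j i] B_sym[of k i] R_sym[of j k] B_sym[of j k] by auto
  qed
  show "quad_compat V (\<lambda>i j. r j i) (\<lambda>i j. r' j i)"
    unfolding quad_compat_def tw rd bl
  proof (intro ballI impI)
    fix i j k l assume "i \<in> V" "j \<in> V" "k \<in> V" "l \<in> V" "distinct [i, j, k, l]" "R j i" "B l k"
      "r k i = r i k" "r l i = r i l" "r k j = r j k" "r l j = r j l"
    thus "twins r i k l \<and> twins r j k l \<or> twins r k i j \<and> twins r l i j"
      using quadD[of i j k l] R_sym[of j i] B_sym[of l k] by auto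
  qed
qed

lemma coherent_reoriented: "coherent V r'"
proof -
  interpret T: compatible V "\<lambda>i j. r j i" "\<lambda>i j. r' j i" by (rule both_transposed)
  show ?thesis unfolding coherent_def
  proof (intro ballI impI, goal_cases)
    case (1 i j k l)
    then show ?case using four_points[of i j k l] T.four_points[of i j k l] by simp
  qed
qed

lemma subset: "W \<subseteq> V \<Longrightarrow> compatible W r r'"
  by (simp add: compatible_def coherent_subset[OF coh] reoriented_subset[OF reo]
    triple_compat_subset[OF tri] quad_compat_subset[OF quad])
end

definition bordered :: "'v \<Rightarrow> ('v \<Rightarrow> 'a::idom) \<Rightarrow> ('v \<Rightarrow> 'v \<Rightarrow> 'a) \<Rightarrow> 'v \<Rightarrow> 'v \<Rightarrow> 'a" where
  "bordered o' \<delta> r i j = (if i = j then \<delta> i else if i = o' \<or> j = o' then 1 else r i j)"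

definition same_minors :: "'v \<Rightarrow> ('v \<Rightarrow> 'a::idom) \<Rightarrow> 'v set \<Rightarrow> ('v \<Rightarrow> 'v \<Rightarrow> 'a) \<Rightarrow> ('v \<Rightarrow> 'v \<Rightarrow> 'a) \<Rightarrow> bool" where
  "same_minors o' \<delta> V r r' \<longleftrightarrow> (\<forall>xs. distinct xs \<longrightarrow> set xs \<subseteq> insert o' V \<longrightarrow>
     pdet (bordered o' \<delta> r) xs = pdet (bordered o' \<delta> r') xs)"

lemma same_minors_trans: "same_minors b \<delta> V r s \<Longrightarrow> same_minors b \<delta> V s t \<Longrightarrow> same_minors b \<delta> V r t"
  by (simp add: same_minors_def)

lemma same_minors_cong:
  assumes "\<And>i j. i \<in> V \<Longrightarrow> j \<in> V \<Longrightarrow> i \<noteq> j \<Longrightarrow> r i j = r' i j"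
  shows "same_minors b \<delta> V r r'"
  unfolding same_minors_def
  by (intro allI impI pdet_cong refl) (use assms in \<open>auto simp: bordered_def\<close>)

lemma same_minors_transpose:
  assumes "\<And>i j. i \<in> V \<Longrightarrow> j \<in> V \<Longrightarrow> i \<noteq> j \<Longrightarrow> r' i j = r j i"
  shows "same_minors b \<delta> V r r'"
  unfolding same_minors_def
proof (intro allI impI)
  fix xs assume xs: "distinct xs" "set xs \<subseteq> insert b V"
  have "pdet (bordered b \<delta> r') xs = pdet (\<lambda>i j. bordered b \<delta> r j i) xs"
    by (rule pdet_cong) (use xs assms in \<open>auto simp: bordered_def\<close>)
  thus "pdet (bordered b \<delta> r) xs = pdet (bordered b \<delta> r') xs" using pdet_transpose[of "bordered b \<delta> r" xs] by simp
qed

text \<open>The minors of the pieces determine all minors: the only quantity of the module \<open>Z\<close> that enters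
  a minor meeting both \<open>Z\<close> and its complement can be read off from the minors of \<open>Z \<union> {b}\<close>.\<close>

lemma same_minors_module:
  assumes b: "b \<notin> V" and Z: "Z \<subseteq> V" and ne: "Z \<noteq> {}"
    and m: "\<And>x p q. x \<in> V - Z \<Longrightarrow> p \<in> Z \<Longrightarrow> q \<in> Z \<Longrightarrow> twins r x p q"
    and m': "\<And>x p q. x \<in> V - Z \<Longrightarrow> p \<in> Z \<Longrightarrow> q \<in> Z \<Longrightarrow> twins r' x p q"
    and inner: "same_minors b \<delta> Z r r'"
    and outer: "\<And>k. k \<in> Z \<Longrightarrow> same_minors b \<delta> (insert k (V - Z)) r r'"
  shows "same_minors b \<delta> V r r'"
  unfolding same_minors_def
proof (intro allI impI)
  fix zs assume zs: "distinct zs" "set zs \<subseteq> insert b V"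
  define f f' where "f = bordered b \<delta> r" and "f' = bordered b \<delta> r'"
  define xs where "xs = filter (\<lambda>x. x \<notin> Z) zs"
  define ys where "ys = filter (\<lambda>x. x \<in> Z) zs"
  have perm: "mset zs = mset (xs @ ys)"
    unfolding xs_def ys_def by (induction zs) auto
  show "pdet f zs = pdet f' zs"
  proof (cases ys)
    case Nil
    hence zZ: "set zs \<inter> Z = {}" by (auto simp: ys_def filter_empty_conv)
    obtain k where "k \<in> Z" using ne by blast
    thus ?thesis using outer zs zZ unfolding same_minors_def f_def f'_def by blast
  next
    case (Cons k ys')
    have k: "k \<in> Z" and ys': "set ys' \<subseteq> Z" using Cons by (auto simp: ys_def dest: filter_eq_ConsD)
    have xsZ: "set xs \<subseteq> insert b (V - Z)" using zs by (auto simp: xs_def)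
    have d: "distinct (xs @ k # ys')"
    proof -
      have "distinct (xs @ ys)" using zs(1) by (auto simp: xs_def ys_def)
      thus ?thesis using Cons by simp
    qed
    have bk: "b \<noteq> k" "b \<notin> set ys'" using b Z k ys' by auto
    have mod: "pdet g (us @ k # ys') = pdet g (us @ [k]) * pdet (relative g k) ys' +
        pdet g us * (pdet g (k # ys') - g k k * pdet (relative g k) ys')"
      if g: "g = bordered b \<delta> s" and s: "\<And>x p q. x \<in> V - Z \<Longrightarrow> p \<in> Z \<Longrightarrow> q \<in> Z \<Longrightarrow> twins s x p q"
        and us: "distinct (us @ k # ys')" "set us \<subseteq> insert b (V - Z)" for g s us
    proof (rule pdet_module[OF us(1)])
      fix p q assume pq: "p \<in> set us" "q \<in> set ys'"
      have "q \<in> Z" "p \<noteq> q" "p \<noteq> k" using pq us ys' by auto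
      thus "g p q = g p k \<and> g q p = g k p"
        using s[of p q k] k us(2) pq bk by (auto simp: g bordered_def twins_def)
    qed
    have rel: "pdet (relative g k) ys' = g b b * pdet g (k # ys') - pdet g (b # k # ys')"
      if g: "g = bordered b \<delta> s" and s: "\<And>x p q. x \<in> V - Z \<Longrightarrow> p \<in> Z \<Longrightarrow> q \<in> Z \<Longrightarrow> twins s x p q" for g s
    proof -
      have two: "pdet g [b, k] = g b b * g k k - 1"
        using bk by (simp add: pdet_2 g bordered_def)
      show ?thesis using mod[OF g s, of "[b]"] d bk by (simp add: two algebra_simps)
    qed
    have in1: "pdet f us = pdet f' us" if "distinct us" "set us \<subseteq> insert b Z" for us
      using inner that unfolding same_minors_def f_def f'_def by blast
    have out1: "pdet f us = pdet f' us" if "distinct us" "set us \<subseteq> insert b (insert k (V - Z))" for us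
      using outer[OF k] that unfolding same_minors_def f_def f'_def by blast
    have fk: "f k k = f' k k" "f b b = f' b b" by (auto simp: f_def f'_def bordered_def)
    have rf: "pdet (relative f k) ys' = f b b * pdet f (k # ys') - pdet f (b # k # ys')"
      "pdet (relative f' k) ys' = f' b b * pdet f' (k # ys') - pdet f' (b # k # ys')"
      by (rule rel[OF f_def], rule m, assumption+) (rule rel[OF f'_def], rule m')
    have sub: "set ys' \<subseteq> insert b Z" "set xs \<subseteq> insert b (insert k (V - Z))" using ys' xsZ by auto
    have r: "pdet (relative f k) ys' = pdet (relative f' k) ys'"
      using in1[of "k # ys'"] in1[of "b # k # ys'"] d bk k sub fk by (simp add: rf)
    have mf: "pdet f (xs @ k # ys') = pdet f (xs @ [k]) * pdet (relative f k) ys' +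
        pdet f xs * (pdet f (k # ys') - f k k * pdet (relative f k) ys')"
      "pdet f' (xs @ k # ys') = pdet f' (xs @ [k]) * pdet (relative f' k) ys' +
        pdet f' xs * (pdet f' (k # ys') - f' k k * pdet (relative f' k) ys')"
      by (rule mod[OF f_def _ d xsZ], rule m, assumption+) (rule mod[OF f'_def _ d xsZ], rule m')
    have "pdet f (xs @ k # ys') = pdet f' (xs @ k # ys')"
      unfolding mf using in1[of "k # ys'"] out1[of xs] out1[of "xs @ [k]"] r fk d sub k by simp
    thus ?thesis using pdet_permute[OF perm, of f] pdet_permute[OF perm, of f'] Cons by simp
  qed
qed

context compatible begin

definition partial_flip where
  "partial_flip Q i j = (if i \<in> Q \<and> j \<in> Q then r' i j else r i j)"

context
  fixes Q
  assumes Q: "Q \<subseteq> V" and mod: "\<And>x a b. x \<in> V - Q \<Longrightarrow> a \<in> Q \<Longrightarrow> b \<in> Q \<Longrightarrow> twins r x a b"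
begin

lemma partial_flip_twins: "x \<in> V - Q \<Longrightarrow> a \<in> Q \<Longrightarrow> b \<in> Q \<Longrightarrow> twins (partial_flip Q) x a b"
  using mod[of x a b] by (auto simp: partial_flip_def twins_def)

lemma partial_flip_compatible: "compatible V r (partial_flip Q)"
proof
  have rd: "red r (partial_flip Q) i j \<longleftrightarrow> i \<in> Q \<and> j \<in> Q \<and> R i j" for i j
    by (auto simp: red_def partial_flip_def)
  have bl: "blue r (partial_flip Q) i j \<longleftrightarrow> (i \<in> Q \<and> j \<in> Q \<and> B i j) \<or> (\<not> (i \<in> Q \<and> j \<in> Q) \<and> \<not> N i j)" for i j
    by (auto simp: blue_def partial_flip_def)
  show "coherent V r" by (rule coh)
  show "reoriented V r (partial_flip Q)"
    using reo unfolding reoriented_def partial_flip_def by auto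
  show "triple_compat V r (partial_flip Q)"
    unfolding triple_compat_def rd bl
  proof (intro ballI impI, goal_cases)
    case (1 i j k)
    show ?case
    proof (cases "k \<in> Q")
      case True
      then show ?thesis using 1 tri_RB[of i j k] by auto
    next
      case False
      then show ?thesis using 1 mod[of k i j] by (auto simp: twins_def)
    qed
  qed
  show "quad_compat V r (partial_flip Q)"
    unfolding quad_compat_def rd bl
  proof (intro ballI impI, goal_cases)
    case (1 i j k l)
    show ?case
    proof (cases "k \<in> Q \<longleftrightarrow> l \<in> Q")
      case True
      then show ?thesis using 1 quadD[of i j k l] mod[of k i j] mod[of l i j] by auto
    next
      case False
      then show ?thesis using 1 mod[of k i l] mod[of l i k] by (auto simp: twins_def)
    qed
  qed
qed

lemma compatible_partial_flip: "compatible V (partial_flip Q) r'"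
proof
  interpret C: compatible V r "partial_flip Q" by (rule partial_flip_compatible)
  define s where "s = partial_flip Q"
  have s: "s i j = (if i \<in> Q \<and> j \<in> Q then r' i j else r i j)" for i j by (simp add: s_def partial_flip_def)
  show "coherent V (partial_flip Q)" by (rule C.coherent_reoriented)
  show "reoriented V (partial_flip Q) r'"
    using reo unfolding reoriented_def partial_flip_def by auto
  have rd: "red s r' i j \<longleftrightarrow> \<not> (i \<in> Q \<and> j \<in> Q) \<and> R i j" for i j
    by (auto simp: red_def s)
  have bl: "blue s r' i j \<longleftrightarrow> (i \<in> Q \<and> j \<in> Q \<and> (B i j \<or> R i j)) \<or> (\<not> (i \<in> Q \<and> j \<in> Q) \<and> B i j)"
    if "i \<in> V" "j \<in> V" "i \<noteq> j" for i j
    using reoD[OF that] that by (auto simp: blue_def red_def s)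
  have ms: "twins s x a b" if "x \<in> V - Q" "a \<in> Q" "b \<in> Q" for x a b
    using partial_flip_twins[OF that] by (simp add: s_def)
  have "triple_compat V s r'"
    unfolding triple_compat_def
  proof (intro ballI impI)
    fix i j k assume V: "i \<in> V" "j \<in> V" "k \<in> V" and d: "distinct [i, j, k]"
      and R1: "red s r' i j" and B1: "blue s r' i k"
    have ij: "\<not> (i \<in> Q \<and> j \<in> Q)" "R i j" using R1 rd by auto
    have d': "i \<noteq> j" "i \<noteq> k" "j \<noteq> k" using d by auto
    consider "i \<in> Q" "k \<in> Q" "j \<notin> Q" | "j \<in> Q" "k \<in> Q" "i \<notin> Q" "B i k"
      | "i \<notin> Q \<or> k \<notin> Q" "j \<notin> Q \<or> k \<notin> Q" "B i k"
      using bl[of i k] B1 ij V d' by blast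
    thus "(red s r' j k \<and> twins s j i k) \<or> (blue s r' j k \<and> twins s k i j)"
    proof cases
      case 1
      have tw: "twins r j i k" using mod[of j i k] 1 V by blast
      have jk: "r j k \<noteq> r k j" using tw colours[of i j] ij V d' by (auto simp: twins_def)
      show ?thesis
      proof (cases "R j k")
        case True
        thus ?thesis using rd ms[of j i k] 1 V by blast
      next
        case False
        hence B: "B j k" using colours[of j k] jk V d' by blast
        have "B i k \<or> R i k" using B1 bl[of i k] 1 V d' by blast
        hence "twins s k i j"
        proof
          assume "B i k"
          hence "twins r k i j" using tri_RB[of i j k] ij B colours[of j k] V d' by blast
          thus ?thesis using 1 \<open>B i k\<close> reoD[of i k] V d' by (auto simp: s twins_def blue_def)
        next
          assume R: "R i k"
          have "twins r i j k" using tri_RB[of j i k] B R R_sym[of i j] ij colours[of i k] V d' B_sym[of j k] by blast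
          thus ?thesis using 1 R tw reoD[of i k] V d' by (auto simp: s twins_def red_def)
        qed
        thus ?thesis using B bl[of j k] 1 V d' by blast
      qed
    next
      case 2
      have t: "(R j k \<and> twins r j i k) \<or> (B j k \<and> twins r k i j)"
        using tri_RB[of i j k] 2 ij V d' by blast
      have mi: "twins r i j k" using mod[of i j k] 2 V by blast
      have "blue s r' j k" using bl[of j k] t 2 V d' by blast
      moreover have "twins s k i j"
        using t
      proof
        assume "R j k \<and> twins r j i k"
        thus ?thesis using 2 mi reoD[of j k] V d' by (auto simp: s twins_def red_def)
      next
        assume "B j k \<and> twins r k i j"
        thus ?thesis using 2 reoD[of j k] V d' by (auto simp: s twins_def blue_def)
      qed
      ultimately show ?thesis by blast
    next
      case 3
      have t: "(R j k \<and> twins r j i k) \<or> (B j k \<and> twins r k i j)"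
        using tri_RB[of i j k] 3 ij V d' by blast
      have e: "s i j = r i j" "s j i = r j i" "s i k = r i k" "s k i = r k i" "s j k = r j k" "s k j = r k j"
        using 3 ij by (auto simp: s)
      show ?thesis using t rd[of j k] bl[of j k] 3 e V d' by (auto simp: twins_def)
    qed
  qed
  thus "triple_compat V (partial_flip Q) r'" by (simp add: s_def)
  have "quad_compat V s r'"
    unfolding quad_compat_def
  proof (intro ballI impI)
    fix i j k l assume V: "i \<in> V" "j \<in> V" "k \<in> V" "l \<in> V" and d: "distinct [i, j, k, l]"
      and R1: "red s r' i j" and B1: "blue s r' k l"
      and n: "s i k = s k i" "s i l = s l i" "s j k = s k j" "s j l = s l j"
    have ij: "\<not> (i \<in> Q \<and> j \<in> Q)" "R i j" using R1 rd by auto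
    have d': "i \<noteq> j" "i \<noteq> k" "i \<noteq> l" "j \<noteq> k" "j \<noteq> l" "k \<noteq> l" using d by auto
    have eq: "s x y = r x y" "s y x = r y x" if "s x y = s y x" "x \<in> V" "y \<in> V" "x \<noteq> y" for x y
      using that reoD[of x y] by (auto simp: s split: if_splits)
    have N: "N i k" "N i l" "N j k" "N j l" using n eq[OF n(1)] eq[OF n(2)] eq[OF n(3)] eq[OF n(4)] V d' by auto
    have e: "twins s a x y = twins r a x y" if "s a x = s x a" "s a y = s y a" "a \<in> V" "x \<in> V" "y \<in> V" "a \<noteq> x" "a \<noteq> y" for a x y
      using eq[OF that(1)] eq[OF that(2)] that by (auto simp: twins_def)
    have "(twins r i k l \<and> twins r j k l) \<or> (twins r k i j \<and> twins r l i j)"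
    proof (cases "B k l")
      case True
      thus ?thesis using quadD[of i j k l] V d ij N by blast
    next
      case False
      hence kl: "k \<in> Q" "l \<in> Q" using B1 bl[of k l] V d' by blast+
      have "i \<notin> Q \<and> j \<notin> Q"
        using ij mod[of j i k] mod[of i j k] kl N colours[of i j] V d' by (auto simp: twins_def)
      thus ?thesis using mod[of i k l] mod[of j k l] kl V by blast
    qed
    thus "(twins s i k l \<and> twins s j k l) \<or> (twins s k i j \<and> twins s l i j)"
      using e[of i k l] e[of j k l] e[of k i j] e[of l i j] n V d' by auto
  qed
  thus "quad_compat V (partial_flip Q) r'" by (simp add: s_def)
qed

end
end

theorem compatible_same_minors:
  assumes "compatible V r r'" "finite V" "b \<notin> V"
  shows "same_minors b \<delta> V r r'"
  using assms
proof (induction "card V" arbitrary: V r r' rule: less_induct)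
  case (less V r r')
  note outer = less.hyps
  from less.prems(1) show ?case
  proof (induction "card {p \<in> V \<times> V. red r r' (fst p) (snd p)}" arbitrary: r rule: less_induct)
    case (less r)
    interpret compatible V r r' by (rule less.prems)
    have fin: "finite V" and bV: "b \<notin> V" by fact+
    have IH: "same_minors b \<delta> W s t" if "W \<subset> V" "compatible W s t" for W s t
      by (rule outer) (use that fin bV psubset_card_mono finite_subset in auto)
    have module_case: "same_minors b \<delta> V s t"
      if st: "compatible V s t" and Z: "Z \<subseteq> V" "x \<in> Z" "y \<in> Z" "x \<noteq> y" "Z \<noteq> V"
        and m: "\<And>x p q. x \<in> V - Z \<Longrightarrow> p \<in> Z \<Longrightarrow> q \<in> Z \<Longrightarrow> twins s x p q"
          "\<And>x p q. x \<in> V - Z \<Longrightarrow> p \<in> Z \<Longrightarrow> q \<in> Z \<Longrightarrow> twins t x p q" for s t Z x y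
    proof (rule same_minors_module[OF bV Z(1) _ m])
      interpret S: compatible V s t by (rule st)
      show "same_minors b \<delta> Z s t" by (rule IH) (use Z S.subset in auto)
      show "same_minors b \<delta> (insert k (V - Z)) s t" if "k \<in> Z" for k
      proof (rule IH)
        obtain u where "u \<in> Z" "u \<noteq> k" using Z(2-4) by metis
        thus "insert k (V - Z) \<subset> V" using Z(1) that by auto
        thus "compatible (insert k (V - Z)) s t" using S.subset by blast
      qed
    qed (use Z in auto)
    show ?case
    proof (cases "\<exists>Z x y. hmodule Z \<and> x \<in> Z \<and> y \<in> Z \<and> x \<noteq> y \<and> Z \<noteq> V")
      case True
      then obtain Z x y where "hmodule Z" "x \<in> Z" "y \<in> Z" "x \<noteq> y" "Z \<noteq> V" by blast
      thus ?thesis by (intro module_case[OF less.prems, of Z x y]) (auto simp: hmodule_def)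
    next
      case simple: False
      show ?thesis
      proof (cases "(\<exists>k\<in>V. \<exists>l\<in>V. k \<noteq> l \<and> R k l) \<and> (\<exists>k\<in>V. \<exists>l\<in>V. B k l)")
        case False
        then consider "\<And>k l. k \<in> V \<Longrightarrow> l \<in> V \<Longrightarrow> k \<noteq> l \<Longrightarrow> \<not> R k l" | "\<And>k l. k \<in> V \<Longrightarrow> l \<in> V \<Longrightarrow> \<not> B k l" by blast
        thus ?thesis
        proof cases
          case 1
          show ?thesis by (rule same_minors_cong) (use 1 in \<open>auto simp: red_def\<close>)
        next
          case 2
          show ?thesis
            by (rule same_minors_transpose) (use 2 reoD in \<open>force simp: blue_def\<close>)
        qed
      next
        case True
        interpret prime_compatible V r r'
          by unfold_locales (use simple True in blast)+
        obtain Q y k l where Q: "Q \<subseteq> V" "y \<in> V - Q" "k \<in> Q" "l \<in> Q" "k \<noteq> l" "R k l"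
          and m: "\<And>x a b. x \<in> V - Q \<Longrightarrow> a \<in> Q \<Longrightarrow> b \<in> Q \<Longrightarrow> twins r x a b"
          by (rule red_module_exists) blast
        let ?s = "partial_flip Q"
        have "same_minors b \<delta> V r ?s"
          by (rule module_case[OF partial_flip_compatible[OF Q(1) m] Q(1,3,4,5)])
            (use Q m partial_flip_twins[OF Q(1) m] in auto)
        moreover have "same_minors b \<delta> V ?s r'"
        proof (rule less.hyps)
          show "compatible V ?s r'" by (rule compatible_partial_flip[OF Q(1) m])
          show "card {p \<in> V \<times> V. red ?s r' (fst p) (snd p)} < card {p \<in> V \<times> V. R (fst p) (snd p)}"
          proof (rule psubset_card_mono)
            have "(k, l) \<in> {p \<in> V \<times> V. R (fst p) (snd p)} - {p \<in> V \<times> V. red ?s r' (fst p) (snd p)}"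
              using Q by (auto simp: red_def partial_flip_def)
            moreover have "{p \<in> V \<times> V. red ?s r' (fst p) (snd p)} \<subseteq> {p \<in> V \<times> V. R (fst p) (snd p)}"
              by (auto simp: red_def partial_flip_def split: if_splits)
            ultimately show "{p \<in> V \<times> V. red ?s r' (fst p) (snd p)} \<subset> {p \<in> V \<times> V. R (fst p) (snd p)}" by blast
          qed (use fin in auto)
        qed
        ultimately show ?thesis by (rule same_minors_trans)
      qed
    qed
  qed
qed

section \<open>Normalisation of the matrix\<close>

lemma principal_minor_pdet:
  assumes A: "A \<in> carrier_mat n n" and S: "S \<subseteq> {..<n}" and xs: "distinct xs" "set xs = S"
  shows "principal_minor A S = pdet (\<lambda>i j. A $$ (i, j)) xs"
proof -
  have fin: "finite S" using S finite_subset by blast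
  define ys where "ys = map (pick S) [0..<card S]"
  have set: "set ys \<subseteq> S" using fin by (auto simp: ys_def pick_in_set_le)
  have dist: "distinct ys"
    unfolding ys_def distinct_map
  proof (intro conjI inj_onI)
    fix x y assume xy: "x \<in> set [0..<card S]" "y \<in> set [0..<card S]" "pick S x = pick S y"
    hence "x < card S" "y < card S" by auto
    from card_pick_le[OF this(1)] card_pick_le[OF this(2)] xy(3) show "x = y" by metis
  qed simp
  have "card (set ys) = card S" using dist by (simp add: distinct_card) (simp add: ys_def)
  hence "set ys = S" using set fin by (simp add: card_subset_eq)
  hence perm: "mset xs = mset ys" using xs dist set_eq_iff_mset_eq_distinct[of xs ys] by simp
  have c: "{i. i < n \<and> i \<in> S} = S" using S by auto
  have "submatrix A S S = mat (card S) (card S) (\<lambda>(i, j). A $$ (ys ! i, ys ! j))"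
    using A by (intro eq_matI) (auto simp: submatrix_def c ys_def)
  hence "principal_minor A S = pdet (\<lambda>i j. A $$ (i, j)) ys"
    unfolding principal_minor_def pdet_def by (simp add: ys_def)
  thus ?thesis using pdet_permute[OF perm] by metis
qed

lemma pick_pair: "x < y \<Longrightarrow> pick {x, y} 0 = x" "x < y \<Longrightarrow> pick {x, y} (Suc 0) = y"
proof -
  assume xy: "x < (y::nat)"
  show *: "pick {x, y} 0 = x" using xy by (auto intro!: Least_equality)
  show "pick {x, y} (Suc 0) = y" unfolding pick.simps(2) * using xy by (auto intro!: Least_equality)
qed

lemma det_submatrix_pair:
  assumes "x < y" "y < dim_row X" "z < w" "w < dim_col X"
  shows "det (submatrix X {x, y} {z, w}) = X $$ (x, z) * X $$ (y, w) - X $$ (x, w) * X $$ (y, z)"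
proof -
  have c: "{i. i < dim_row X \<and> i \<in> {x, y}} = {x, y}" "{i. i < dim_col X \<and> i \<in> {z, w}} = {z, w}"
    using assms by auto
  have "submatrix X {x, y} {z, w} = mat 2 2 (\<lambda>(i, j). X $$ (pick {x, y} i, pick {z, w} j))"
    unfolding submatrix_def c using assms by (simp add: numeral_2_eq_2)
  thus ?thesis using pick_pair assms by (simp add: det_mat_2 del: pick.simps)
qed

lemma rank_submatrix_pair:
  fixes A :: "'a::field mat"
  assumes A: "A \<in> carrier_mat n n" and ij: "i < n" "j < n" "i \<noteq> j" and kl: "k < n" "l < n" "k \<noteq> l"
    and nz: "A $$ (i, k) \<noteq> 0" "A $$ (i, l) \<noteq> 0" "A $$ (j, k) \<noteq> 0" "A $$ (j, l) \<noteq> 0"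
    and eq: "A $$ (i, k) * A $$ (j, l) = A $$ (i, l) * A $$ (j, k)"
  shows "mat_rank (submatrix A {i, j} {k, l}) = 1"
proof -
  have pair: "\<exists>x y. x < y \<and> {a, b} = {x, y} \<and> y < n" if "a < n" "b < n" "a \<noteq> b" for a b
    using that by (cases a b rule: linorder_cases) (auto simp: doubleton_eq_iff)
  obtain x y where xy: "x < y" "{i, j} = {x, y}" "y < n" using pair[OF ij] by blast
  obtain z w where zw: "z < w" "{k, l} = {z, w}" "w < n" using pair[OF kl] by blast
  define X where "X = submatrix A {x, y} {z, w}"
  have c: "{i. i < n \<and> (i = x \<or> i = y)} = {x, y}" "{i. i < n \<and> (i = z \<or> i = w)} = {z, w}"
    using xy zw by auto
  have X: "X \<in> carrier_mat 2 2" using A xy zw by (simp add: X_def submatrix_def c numeral_2_eq_2)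
  have "det X = 0"
    unfolding X_def using det_submatrix_pair[of x y A z w] A xy zw eq
    by (auto simp: doubleton_eq_iff algebra_simps)
  hence lt: "vec_space.rank 2 X < 2" by (rule vec_space.det_zero_low_rank[OF X])
  have "X $$ (0, 0) = A $$ (x, z)"
    unfolding X_def using A xy zw pick_pair by (subst submatrix_index) (auto simp: c simp del: pick.simps)
  hence x00: "X $$ (0, 0) \<noteq> 0" using nz xy zw by (auto simp: doubleton_eq_iff)
  have "submatrix X {0} {0} = mat 1 1 (\<lambda>_. X $$ (0, 0))"
  proof -
    have "{i. i < (2::nat) \<and> i \<in> {0}} = {0}" by auto
    moreover have "pick {0} 0 = (0::nat)" by (simp add: Least_equality)
    ultimately show ?thesis using X by (intro eq_matI) (auto simp: submatrix_def)
  qed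
  hence "det (submatrix X {0} {0}) \<noteq> 0" using x00 det_mat_1[of "\<lambda>_. X $$ (0, 0)"] by simp
  from vec_space.rank_gt_minor[OF X this] have "1 \<le> vec_space.rank 2 X"
    using Collect_conv_if[of "0::nat" "\<lambda>j. j < 2"] by (simp add: conj_commute)
  thus ?thesis using lt X xy zw by (simp add: mat_rank_def X_def)
qed

lemma rank_one_minor:
  fixes A :: "'a::field mat"
  assumes A: "A \<in> carrier_mat n n" and r: "mat_rank (submatrix A S T) = 1"
    and ij: "i \<in> S" "j \<in> S" "i < n" "j < n" and kl: "k \<in> T" "l \<in> T" "k < n" "l < n"
  shows "A $$ (i, k) * A $$ (j, l) = A $$ (i, l) * A $$ (j, k)"
proof -
  define X where "X = submatrix A S T"
  have X: "X \<in> carrier_mat (dim_row X) (dim_col X)" by auto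
  have rank: "vec_space.rank (dim_row X) X = 1" using r by (simp add: mat_rank_def X_def)
  define f where "f = (\<lambda>S a. card {b \<in> S. b < (a::nat)})"
  have ent: "X $$ (f S a, f T b) = A $$ (a, b)" "f S a < dim_row X" "f T b < dim_col X"
    if "a \<in> S" "a < n" "b \<in> T" "b < n" for a b
  proof -
    show "X $$ (f S a, f T b) = A $$ (a, b)"
      unfolding X_def f_def using A that by (intro submatrix_index_card) auto
    have "{b \<in> S. b < a} \<subset> {i. i < n \<and> i \<in> S}" "{c \<in> T. c < b} \<subset> {i. i < n \<and> i \<in> T}" using that by auto
    hence "card {b \<in> S. b < a} < card {i. i < n \<and> i \<in> S}" "card {c \<in> T. c < b} < card {i. i < n \<and> i \<in> T}"
      by (auto intro: psubset_card_mono)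
    thus "f S a < dim_row X" "f T b < dim_col X" using A by (auto simp: X_def dim_submatrix f_def)
  qed
  have main: "X $$ (x, z) * X $$ (y, w) = X $$ (x, w) * X $$ (y, z)"
    if "x < y" "z < w" "y < dim_row X" "w < dim_col X" for x y z w
  proof (rule ccontr)
    assume "\<not> ?thesis"
    hence "det (submatrix X {x, y} {z, w}) \<noteq> 0" using det_submatrix_pair[of x y X z w] that by simp
    from vec_space.rank_gt_minor[OF X this] have "card {j. j < dim_col X \<and> j \<in> {z, w}} \<le> 1" using rank by simp
    moreover have "{j. j < dim_col X \<and> j \<in> {z, w}} = {z, w}" using that by auto
    ultimately show False using that by simp
  qed
  have main': "X $$ (x, z) * X $$ (y, w) = X $$ (x, w) * X $$ (y, z)"
    if "x < dim_row X" "y < dim_row X" "z < dim_col X" "w < dim_col X" for x y z w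
  proof -
    consider "x = y" | "z = w" | "x < y" "z < w" | "x < y" "w < z" | "y < x" "z < w" | "y < x" "w < z"
      using linorder_less_linear[of x y] linorder_less_linear[of z w] by blast
    thus ?thesis
    proof cases
      case 3 thus ?thesis using main[of x y z w] that by blast
    next
      case 4 show ?thesis using main[OF 4 that(2,3)] by (rule sym)
    next
      case 5 show ?thesis using main[OF 5 that(1,4)] by (metis mult.commute)
    next
      case 6 show ?thesis using main[OF 6 that(1,3)] by (metis mult.commute)
    qed (simp_all only: mult.commute)
  qed
  show ?thesis
    using main'[of "f S i" "f S j" "f T k" "f T l"] ent[OF ij(1,3) kl(1,3)] ent[OF ij(2,4) kl(2,4)]
      ent[OF ij(1,3) kl(2,4)] ent[OF ij(2,4) kl(1,3)] by simp
qed

locale normalized =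
  fixes n :: nat and A :: "'a::field mat"
  assumes A: "A \<in> carrier_mat n n" and R: "property_R n A" and n: "0 < n"
begin

definition "V = {1..<n}"
definition "pp i = (if i = 0 then 1 else A $$ (0, i) * A $$ (i, 0))"
definition "sc i = (if i = 0 then 1 else A $$ (0, i))"
definition "M i j = (sc i / pp i) * A $$ (i, j) * (1 / sc j)"
definition "\<delta> i = M i i"

lemma A_nz: "i < n \<Longrightarrow> j < n \<Longrightarrow> i \<noteq> j \<Longrightarrow> A $$ (i, j) \<noteq> 0"
  using R by (auto simp: property_R_def)

lemma pp_nz: "i < n \<Longrightarrow> pp i \<noteq> 0" and sc_nz: "i < n \<Longrightarrow> sc i \<noteq> 0"
  using A_nz[of 0 i] A_nz[of i 0] n by (auto simp: pp_def sc_def)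

lemma M_border: "i \<in> V \<Longrightarrow> M 0 i = 1" "i \<in> V \<Longrightarrow> M i 0 = 1"
  using A_nz[of 0 i] A_nz[of i 0] n by (auto simp: M_def pp_def sc_def V_def)

lemma bordered_M: "i < n \<Longrightarrow> j < n \<Longrightarrow> bordered 0 \<delta> M i j = M i j"
  using M_border[of i] M_border[of j] by (auto simp: bordered_def \<delta>_def V_def)

lemma pdet_M: "pdet M xs = (\<Prod>x\<leftarrow>xs. sc x / pp x) * (\<Prod>x\<leftarrow>xs. 1 / sc x) * pdet (\<lambda>i j. A $$ (i, j)) xs"
proof -
  have "M = (\<lambda>i j. sc i / pp i * A $$ (i, j) * (1 / sc j))" by (intro ext) (simp add: M_def)
  thus ?thesis using pdet_scale[of "\<lambda>i. sc i / pp i" "\<lambda>i j. A $$ (i, j)" "\<lambda>j. 1 / sc j" xs] by simp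
qed

lemma prod_scale: "set xs \<subseteq> {..<n} \<Longrightarrow> (\<Prod>x\<leftarrow>xs. sc x / pp x) * (\<Prod>x\<leftarrow>xs. 1 / sc x) * (\<Prod>x\<leftarrow>xs. pp x) = 1"
  using pp_nz sc_nz by (induction xs) (auto simp: field_simps)

lemma pdet_A: 
  assumes "set xs \<subseteq> {..<n}"
  shows "pdet (\<lambda>i j. A $$ (i, j)) xs = (\<Prod>x\<leftarrow>xs. pp x) * pdet M xs"
  using prod_scale[OF assms] unfolding pdet_M by (simp add: mult_ac)

lemma cut:
  assumes "i < n" "j < n" "k < n" "l < n" and d: "distinct [i, j, k, l]"
    and eq: "M i k * M j l = M i l * M j k"
  obtains S where "S \<subseteq> {..<n}" "i \<in> S" "j \<in> S" "k \<notin> S" "l \<notin> S"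
    "\<And>x y u v. \<lbrakk>x \<in> S; y \<in> S; u < n; v < n; u \<notin> S; v \<notin> S\<rbrakk> \<Longrightarrow> M x u * M y v = M x v * M y u"
proof -
  have conv: "M x u * M y v = M x v * M y u \<longleftrightarrow> A $$ (x, u) * A $$ (y, v) = A $$ (x, v) * A $$ (y, u)"
    if "x < n" "y < n" "u < n" "v < n" for x y u v
    using pp_nz that sc_nz by (auto simp: M_def field_simps)
  have "mat_rank (submatrix A {i, j} {k, l}) = 1"
    by (rule rank_submatrix_pair[OF A]) (use assms A_nz conv in auto)
  hence "distinct [i, j, k, l] \<and> mat_rank (submatrix A {i, j} {k, l}) = 1" using d by simp
  from R[unfolded property_R_def, THEN conjunct2, rule_format, OF assms(1-4) this]
  obtain S where S: "S \<subseteq> {..<n}" "i \<in> S" "j \<in> S" "k \<in> {..<n} - S" "l \<in> {..<n} - S"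
    "mat_rank (submatrix A S ({..<n} - S)) = 1" by blast
  show thesis
  proof (rule that[of S])
    fix x y u v assume "x \<in> S" "y \<in> S" "u < n" "v < n" "u \<notin> S" "v \<notin> S"
    thus "M x u * M y v = M x v * M y u"
      using rank_one_minor[OF A S(6), of x y u v] S(1) conv[of x y u v] by auto
  qed (use S in auto)
qed

lemma coherent_M: "coherent V M"
  unfolding coherent_def
proof (intro ballI impI conjI)
  fix i j k l assume V: "i \<in> V" "j \<in> V" "k \<in> V" "l \<in> V" and d: "distinct [i, j, k, l]"
  hence b: "i < n" "j < n" "k < n" "l < n" "i \<noteq> 0" "j \<noteq> 0" "k \<noteq> 0" "l \<noteq> 0" by (auto simp: V_def)
  note bd = M_border[OF V(1)] M_border[OF V(2)] M_border[OF V(3)] M_border[OF V(4)]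
  show "M j k = M j l" if eq: "M i k = M i l" "M i k \<noteq> M i j"
  proof -
    have "distinct [i, 0, k, l]" "M i k * M 0 l = M i l * M 0 k" using b d eq bd by auto
    then obtain S where S: "S \<subseteq> {..<n}" "i \<in> S" "0 \<in> S" "k \<notin> S" "l \<notin> S" and
      c: "\<And>x y u v. \<lbrakk>x \<in> S; y \<in> S; u < n; v < n; u \<notin> S; v \<notin> S\<rbrakk> \<Longrightarrow> M x u * M y v = M x v * M y u"
      by (rule cut[OF b(1) n b(3,4)]) blast
    show ?thesis using c[of 0 j k l] c[of i 0 k j] S b bd eq by (cases "j \<in> S") auto
  qed
  show "M k j = M l j" if eq: "M k i = M l i" "M k i \<noteq> M j i"
  proof -
    have "distinct [k, l, i, 0]" "M k i * M l 0 = M k 0 * M l i" using b d eq bd by auto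
    then obtain S where S: "S \<subseteq> {..<n}" "k \<in> S" "l \<in> S" "i \<notin> S" "0 \<notin> S" and
      c: "\<And>x y u v. \<lbrakk>x \<in> S; y \<in> S; u < n; v < n; u \<notin> S; v \<notin> S\<rbrakk> \<Longrightarrow> M x u * M y v = M x v * M y u"
      by (rule cut[OF b(3,4,1) n]) blast
    show ?thesis using c[of k l j 0] c[of k j i 0] S b n bd eq by (cases "j \<in> S") auto
  qed
qed

lemma product_coincidence:
  assumes V: "i \<in> V" "j \<in> V" "k \<in> V" "l \<in> V" and d: "distinct [i, j, k, l]"
    and eq: "M i k * M j l = M i l * M j k"
  shows "(M i k = M i l \<and> M j k = M j l) \<or> (M i k = M j k \<and> M i l = M j l)"
proof -
  have b: "i < n" "j < n" "k < n" "l < n" using V by (auto simp: V_def)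
  note bd = M_border[OF V(1)] M_border[OF V(2)] M_border[OF V(3)] M_border[OF V(4)]
  obtain S where S: "S \<subseteq> {..<n}" "i \<in> S" "j \<in> S" "k \<notin> S" "l \<notin> S" and
    c: "\<And>x y u v. \<lbrakk>x \<in> S; y \<in> S; u < n; v < n; u \<notin> S; v \<notin> S\<rbrakk> \<Longrightarrow> M x u * M y v = M x v * M y u"
    by (rule cut[OF b d eq]) blast
  show ?thesis using c[of i 0 k l] c[of j 0 k l] c[of i j k 0] c[of i j l 0] S b n bd by (cases "0 \<in> S") auto
qed

end

definition cyc3 :: "'a::field \<Rightarrow> 'a \<Rightarrow> 'a \<Rightarrow> 'a \<Rightarrow> 'a \<Rightarrow> 'a \<Rightarrow> 'a" where
  "cyc3 a a' b b' c c' = a * b * c + a' * b' * c'"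
definition cyc4 :: "'a::field \<Rightarrow> 'a \<Rightarrow> 'a \<Rightarrow> 'a \<Rightarrow> 'a \<Rightarrow> 'a \<Rightarrow> 'a" where
  "cyc4 a a' b b' c c' = a * b + b * c + c * a + (a' * b' + b' * c' + c' * a')"

definition cycs where "cycs a a' b b' c c' = (cyc3 a a' b b' c c', cyc4 a a' b b' c c')"

lemma cycs_rotate: "cycs b b' c c' a a' = cycs a a' b b' c c'"
  by (simp add: cycs_def cyc3_def cyc4_def algebra_simps)
lemma cycs_reverse: "cycs a' a b' b c' c = cycs a a' b b' c c'"
  by (simp add: cycs_def cyc3_def cyc4_def algebra_simps)

lemma cycs_flip: "cycs a' a b b' c c' = cycs a a' b b' c c' \<longleftrightarrow> a = a' \<or> (b = b' \<and> c = c') \<or> (b = c' \<and> c = b')"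
proof -
  have d: "cyc3 a' a b b' c c' - cyc3 a a' b b' c c' = - ((a - a') * (b * c - b' * c'))"
    "cyc4 a' a b b' c c' - cyc4 a a' b b' c c' = - ((a - a') * (b + c - (b' + c')))"
    by (simp_all add: cyc3_def cyc4_def algebra_simps)
  have "cycs a' a b b' c c' = cycs a a' b b' c c' \<longleftrightarrow> a = a' \<or> (b * c = b' * c' \<and> b + c = b' + c')"
    unfolding cycs_def prod.inject eq_iff_diff_eq_0[of "cyc3 a' a b b' c c'"] eq_iff_diff_eq_0[of "cyc4 a' a b b' c c'"] d
    by auto
  moreover have "b * c = b' * c' \<and> b + c = b' + c' \<longleftrightarrow> (b = b' \<and> c = c') \<or> (b = c' \<and> c = b')"
  proof
    assume h: "b * c = b' * c' \<and> b + c = b' + c'"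
    hence c: "c = b' + c' - b" by (simp add: algebra_simps)
    have "(b - b') * (b - c') = b' * c' - b * c" unfolding c by (simp add: algebra_simps)
    hence "b = b' \<or> b = c'" using h by simp
    thus "(b = b' \<and> c = c') \<or> (b = c' \<and> c = b')" using c by auto
  qed (auto simp: algebra_simps)
  ultimately show ?thesis by blast
qed

lemma cycs_flip_b: "cycs a a' b' b c c' = cycs a a' b b' c c' \<longleftrightarrow> b = b' \<or> (a = a' \<and> c = c') \<or> (c = a' \<and> a = c')"
  using cycs_flip[of b' b c c' a a'] cycs_rotate[of b' b c c' a a'] cycs_rotate[of b b' c c' a a'] by auto
lemma cycs_flip_c: "cycs a a' b b' c' c = cycs a a' b b' c c' \<longleftrightarrow> c = c' \<or> (a = a' \<and> b = b') \<or> (a = b' \<and> b = a')"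
  using cycs_flip[of c' c a a' b b'] cycs_rotate[of a a' b b' c' c] cycs_rotate[of a a' b b' c c'] by auto

lemma cycs_flip_ab: "cycs a' a b' b c c' = cycs a a' b b' c c' \<longleftrightarrow> c = c' \<or> (a = a' \<and> b = b') \<or> (a = b' \<and> b = a')"
  using cycs_flip_c[where a=a and a'=a' and b=b and b'=b' and c=c and c'=c'] cycs_reverse[where a=a and a'=a' and b=b and b'=b' and c=c' and c'=c] by simp
lemma cycs_flip_ac: "cycs a' a b b' c' c = cycs a a' b b' c c' \<longleftrightarrow> b = b' \<or> (a = a' \<and> c = c') \<or> (c = a' \<and> a = c')"
  using cycs_flip_b[where a=a and a'=a' and b=b and b'=b' and c=c and c'=c'] cycs_reverse[where a=a and a'=a' and b=b' and b'=b and c=c and c'=c'] by simp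
lemma cycs_flip_bc: "cycs a a' b' b c' c = cycs a a' b b' c c' \<longleftrightarrow> a = a' \<or> (b = b' \<and> c = c') \<or> (b = c' \<and> c = b')"
  using cycs_flip[where a=a and a'=a' and b=b and b'=b' and c=c and c'=c'] cycs_reverse[where a=a' and a'=a and b=b and b'=b' and c=c and c'=c'] by simp

lemma cycs_tests:
  assumes A: "(A = a \<and> A' = a') \<or> (A = a' \<and> A' = a)" and B: "(B = b \<and> B' = b') \<or> (B = b' \<and> B' = b)"
    and C: "(C = c \<and> C' = c') \<or> (C = c' \<and> C' = c)" and ne: "a \<noteq> a'" "c \<noteq> c'"
  defines "t \<equiv> cycs a a' b b' c c'"
  defines "same \<equiv> cycs A A' B B' C C' = t \<or> cycs A A' B' B C C' = t"
  defines "opp \<equiv> cycs A' A B B' C C' = t \<or> cycs A A' B B' C' C = t"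
  shows "same \<and> opp \<longleftrightarrow> (c = b' \<and> c' = b) \<or> (a' = b \<and> a = b')"
    and "\<not> (same \<and> opp) \<Longrightarrow> same \<longleftrightarrow> (A = a \<longleftrightarrow> C = c)"
proof -
  note fl = cycs_flip cycs_flip_b cycs_flip_c cycs_flip_ab cycs_flip_ac cycs_flip_bc cycs_reverse
  have "same \<longleftrightarrow> (A = a \<longleftrightarrow> C = c) \<or> (c = b' \<and> c' = b) \<or> (a' = b \<and> a = b')"
    using A B C ne unfolding same_def t_def by (elim disjE conjE) (auto simp: fl)
  moreover have "opp \<longleftrightarrow> \<not> (A = a \<longleftrightarrow> C = c) \<or> (c = b' \<and> c' = b) \<or> (a' = b \<and> a = b')"
    using A B C ne unfolding opp_def t_def by (elim disjE conjE) (auto simp: fl)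
  ultimately show "same \<and> opp \<longleftrightarrow> (c = b' \<and> c' = b) \<or> (a' = b \<and> a = b')"
    "\<not> (same \<and> opp) \<Longrightarrow> same \<longleftrightarrow> (A = a \<longleftrightarrow> C = c)" by blast+
qed

lemma cyc_minors:
  assumes d: "distinct [z, i, j, k]" and b: "f z i = 1" "f z j = 1" "f z k = 1" "f i z = 1" "f j z = 1" "f k z = 1"
  shows "pdet f [i, j, k] = f i i * f j j * f k k - f i i * (f j k * f k j) - f j j * (f k i * f i k)
     - f k k * (f i j * f j i) + cyc3 (f i j) (f j i) (f j k) (f k j) (f k i) (f i k)"
    and "pdet f [z, i, j, k] = f z z * pdet f [i, j, k]
     - (f i i * f j j + f j j * f k k + f i i * f k k - f i j * f j i - f j k * f k j - f k i * f i k)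
     + f k k * (f i j + f j i) + f i i * (f j k + f k j) + f j j * (f k i + f i k)
     - cyc4 (f i j) (f j i) (f j k) (f k j) (f k i) (f i k)"
  by (simp_all add: pdet_3 pdet_4 det3_def b cyc3_def cyc4_def algebra_simps)

lemma pdet_4_flip:
  fixes f g :: "'v \<Rightarrow> 'v \<Rightarrow> 'a::field"
  assumes d: "distinct [i, j, k, l]"
    and g: "g i j = f j i" "g j i = f i j"
      "\<And>x y. \<lbrakk>x \<in> {i, j, k, l}; y \<in> {i, j, k, l}; (x, y) \<noteq> (i, j); (x, y) \<noteq> (j, i)\<rbrakk> \<Longrightarrow> g x y = f x y"
    and sym: "f k i = f i k" "f l i = f i l" "f k j = f j k" "f l j = f j l"
  shows "pdet f [i, j, k, l] - pdet g [i, j, k, l] =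
    (f i l * f j k - f i k * f j l) * (f i j - f j i) * (f l k - f k l)"
proof -
  have e: "g i i = f i i" "g j j = f j j" "g k k = f k k" "g l l = f l l"
    "g i k = f i k" "g i l = f i l" "g j k = f j k" "g j l = f j l" "g k l = f k l" "g l k = f l k"
    "g k i = f i k" "g l i = f i l" "g k j = f j k" "g l j = f j l"
    using d sym g(3) by auto
  show ?thesis
    unfolding pdet_4 det3_def e g(1,2) sym by (simp add: algebra_simps)
qed

section \<open>Classes of linked pairs\<close>

lemma links_sym: "(p, q) \<in> links V r \<Longrightarrow> (q, p) \<in> links V r"
proof (cases p; cases q)
  fix a b c d assume pq: "p = (a, b)" "q = (c, d)" and "(p, q) \<in> links V r"
  hence "((a, b), (c, d)) \<in> links V r" by simp
  thus "(q, p) \<in> links V r" unfolding pq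
  proof (cases rule: links.cases)
    case swap thus "((c, d), (a, b)) \<in> links V r" by (auto intro: links.swap)
  next
    case triple thus "((c, d), (a, b)) \<in> links V r"
      by (auto intro!: links.triple simp: linked_triple_def)
  next
    case quad thus "((c, d), (a, b)) \<in> links V r"
      by (auto intro!: links.quad simp: linked_quad_def)
  qed
qed

lemma links_rtrancl_sym: "(p, q) \<in> (links V r)\<^sup>* \<Longrightarrow> (q, p) \<in> (links V r)\<^sup>*"
  using sym_rtrancl[of "links V r"] links_sym by (metis symD symI)

locale solver = normalized +
  fixes \<rho> :: "'a \<Rightarrow> 'a \<Rightarrow> 'a"
  assumes rho: "\<rho> x y \<in> {x, y}" "\<rho> x y = \<rho> y x"
begin

abbreviation E where "E i j \<equiv> M i j \<noteq> M j i"

text \<open>The class of a pair \<open>{i, j}\<close> is named by its representative \<open>{L1 i j, L2 i j}\<close>, whose first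
  index is least in the class and which is oriented canonically.  Minimality excludes
  incompatible orientations of a triple on which \<open>M\<close> is a linear order with two values.\<close>

definition consistent :: "(nat \<Rightarrow> nat \<Rightarrow> 'a) \<Rightarrow> (nat \<Rightarrow> nat \<Rightarrow> nat) \<Rightarrow> (nat \<Rightarrow> nat \<Rightarrow> nat) \<Rightarrow> bool" where
  "consistent R L1 L2 \<longleftrightarrow> reoriented V M R \<and>
    (\<forall>i\<in>V. \<forall>j\<in>V. i \<noteq> j \<longrightarrow> L1 i j = L1 j i \<and> L2 i j = L2 j i) \<and>
    (\<forall>i\<in>V. \<forall>j\<in>V. \<forall>k\<in>V. \<forall>l\<in>V. E i j \<longrightarrow> E k l \<longrightarrow> L1 i j = L1 k l \<longrightarrow> L2 i j = L2 k l \<longrightarrow>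
      (R i j = M i j \<longleftrightarrow> R k l = M k l) \<and> ((i, j), (k, l)) \<in> (links V M)\<^sup>*) \<and>
    (\<forall>i\<in>V. \<forall>j\<in>V. E i j \<longrightarrow> L1 i j \<in> V \<and> L2 i j \<in> V \<and> E (L1 i j) (L2 i j) \<and> L1 i j \<le> i \<and>
      L1 (L1 i j) (L2 i j) = L1 i j \<and> L2 (L1 i j) (L2 i j) = L2 i j \<and>
      R (L1 i j) (L2 i j) = \<rho> (M (L1 i j) (L2 i j)) (M (L2 i j) (L1 i j)))"

lemma E_neq: "E i j \<Longrightarrow> i \<noteq> j" by auto

context
  fixes R L1 L2
  assumes con: "consistent R L1 L2"
begin

lemma con_reo: "reoriented V M R" using con by (simp add: consistent_def)
lemma con_cases: "i \<in> V \<Longrightarrow> j \<in> V \<Longrightarrow> i \<noteq> j \<Longrightarrow>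
    (R i j = M i j \<and> R j i = M j i) \<or> (R i j = M j i \<and> R j i = M i j)"
  using con_reo by (auto simp: reoriented_def)
lemma con_sym: "i \<in> V \<Longrightarrow> j \<in> V \<Longrightarrow> i \<noteq> j \<Longrightarrow> L1 j i = L1 i j \<and> L2 j i = L2 i j"
  using con by (simp add: consistent_def)
lemma con_class: "\<lbrakk>i \<in> V; j \<in> V; k \<in> V; l \<in> V; E i j; E k l; L1 i j = L1 k l; L2 i j = L2 k l\<rbrakk> \<Longrightarrow>
      (R i j = M i j \<longleftrightarrow> R k l = M k l) \<and> ((i, j), (k, l)) \<in> (links V M)\<^sup>*"
  using con unfolding consistent_def by blast
lemma con_rep: "\<lbrakk>i \<in> V; j \<in> V; E i j\<rbrakk> \<Longrightarrow> L1 i j \<in> V \<and> L2 i j \<in> V \<and> E (L1 i j) (L2 i j) \<and> L1 i j \<le> i \<and>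
      L1 (L1 i j) (L2 i j) = L1 i j \<and> L2 (L1 i j) (L2 i j) = L2 i j \<and>
      R (L1 i j) (L2 i j) = \<rho> (M (L1 i j) (L2 i j)) (M (L2 i j) (L1 i j))"
  using con unfolding consistent_def by blast

lemma con_antisym: "i \<in> V \<Longrightarrow> j \<in> V \<Longrightarrow> R i j \<noteq> R j i \<longleftrightarrow> E i j"
  using con_cases[of i j] by (cases "i = j") auto

lemma con_kept: "i \<in> V \<Longrightarrow> j \<in> V \<Longrightarrow> E i j \<Longrightarrow> R j i = M j i \<longleftrightarrow> R i j = M i j"
  using con_cases[of i j] by (cases "i = j") auto

lemma consistent_merge:
  assumes V: "x1 \<in> V" "y1 \<in> V" "x2 \<in> V" "y2 \<in> V" and ee: "E x1 y1" "E x2 y2"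
    and conn: "((x1, y1), (x2, y2)) \<in> (links V M)\<^sup>*"
    and le: "L1 x1 y1 \<le> L1 x2 y2" and ne: "L1 x1 y1 \<noteq> L1 x2 y2 \<or> L2 x1 y1 \<noteq> L2 x2 y2"
    and flag: "flag \<longleftrightarrow> (R x1 y1 = M x1 y1) \<noteq> (R x2 y2 = M x2 y2)"
    and R': "\<And>i j. i \<in> V \<Longrightarrow> j \<in> V \<Longrightarrow> i \<noteq> j \<Longrightarrow> R' i j = (if L1 i j = L1 x2 y2 \<and> L2 i j = L2 x2 y2 \<and> flag then R j i else R i j)"
    and L1': "\<And>i j. i \<in> V \<Longrightarrow> j \<in> V \<Longrightarrow> i \<noteq> j \<Longrightarrow> L1' i j = (if L1 i j = L1 x2 y2 \<and> L2 i j = L2 x2 y2 then L1 x1 y1 else L1 i j)"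
    and L2': "\<And>i j. i \<in> V \<Longrightarrow> j \<in> V \<Longrightarrow> i \<noteq> j \<Longrightarrow> L2' i j = (if L1 i j = L1 x2 y2 \<and> L2 i j = L2 x2 y2 then L2 x1 y1 else L2 i j)"
  shows "consistent R' L1' L2'"
  unfolding consistent_def
proof (intro conjI)
  define lo where "lo = (\<lambda>i j. L1 i j = L1 x2 y2 \<and> L2 i j = L2 x2 y2)"
  have new: "R' i j = (if lo i j \<and> flag then R j i else R i j)"
    "L1' i j = (if lo i j then L1 x1 y1 else L1 i j)" "L2' i j = (if lo i j then L2 x1 y1 else L2 i j)"
    if "i \<in> V" "j \<in> V" "i \<noteq> j" for i j
    using R'[OF that] L1'[OF that] L2'[OF that] by (simp_all add: lo_def)
  have lo_sym: "lo j i = lo i j" if "i \<in> V" "j \<in> V" "i \<noteq> j" for i j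
    using con_sym[OF that] by (simp add: lo_def)
  show "reoriented V M R'"
    unfolding reoriented_def
  proof (intro ballI impI)
    fix i j assume "i \<in> V" "j \<in> V" "i \<noteq> j"
    thus "(R' i j = M i j \<and> R' j i = M j i) \<or> (R' i j = M j i \<and> R' j i = M i j)"
      using con_cases[of i j] lo_sym[of i j] new(1)[of i j] new(1)[of j i] by auto
  qed
  show "\<forall>i\<in>V. \<forall>j\<in>V. i \<noteq> j \<longrightarrow> L1' i j = L1' j i \<and> L2' i j = L2' j i"
  proof (intro ballI impI)
    fix i j assume "i \<in> V" "j \<in> V" "i \<noteq> j"
    thus "L1' i j = L1' j i \<and> L2' i j = L2' j i"
      using con_sym[of i j] lo_sym[of i j] new(2,3)[of i j] new(2,3)[of j i] by auto
  qed
  define p where "p = (\<lambda>i j. if lo i j then (x2, y2) else (i, j))"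
  have kept: "R' i j = M i j \<longleftrightarrow> (if lo i j \<and> flag then R i j \<noteq> M i j else R i j = M i j)"
    if "i \<in> V" "j \<in> V" "E i j" for i j
    using con_cases[of i j] new(1)[of i j] that E_neq[OF that(3)] by auto
  have lo_kept: "(R i j = M i j \<longleftrightarrow> R x2 y2 = M x2 y2) \<and> ((i, j), (x2, y2)) \<in> (links V M)\<^sup>*"
    if "i \<in> V" "j \<in> V" "E i j" "lo i j" for i j
    using con_class[of i j x2 y2] that V ee by (auto simp: lo_def)
  have hi_kept: "(R i j = M i j \<longleftrightarrow> R x1 y1 = M x1 y1) \<and> ((i, j), (x1, y1)) \<in> (links V M)\<^sup>*"
    if "i \<in> V" "j \<in> V" "E i j" "L1 i j = L1 x1 y1" "L2 i j = L2 x1 y1" for i j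
    using con_class[of i j x1 y1] that V ee by auto
  have to_hi: "(R' i j = M i j \<longleftrightarrow> R x1 y1 = M x1 y1) \<and> ((i, j), (x1, y1)) \<in> (links V M)\<^sup>*"
    if "i \<in> V" "j \<in> V" "E i j" "L1' i j = L1 x1 y1" "L2' i j = L2 x1 y1" for i j
  proof (cases "lo i j")
    case True
    thus ?thesis using kept[OF that(1-3)] lo_kept[OF that(1-3) True] flag
        links_rtrancl_sym[OF conn] by (auto intro: rtrancl_trans)
  next
    case False
    thus ?thesis using kept[OF that(1-3)] hi_kept[OF that(1-3)] new(2,3)[of i j] that E_neq[OF that(3)] by auto
  qed
  show "\<forall>i\<in>V. \<forall>j\<in>V. \<forall>k\<in>V. \<forall>l\<in>V. E i j \<longrightarrow> E k l \<longrightarrow> L1' i j = L1' k l \<longrightarrow> L2' i j = L2' k l \<longrightarrow>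
      (R' i j = M i j \<longleftrightarrow> R' k l = M k l) \<and> ((i, j), (k, l)) \<in> (links V M)\<^sup>*"
  proof (intro ballI impI)
    fix i j k l assume ij: "i \<in> V" "j \<in> V" and kl: "k \<in> V" "l \<in> V" and e: "E i j" "E k l"
      and eq: "L1' i j = L1' k l" "L2' i j = L2' k l"
    show "(R' i j = M i j \<longleftrightarrow> R' k l = M k l) \<and> ((i, j), (k, l)) \<in> (links V M)\<^sup>*"
    proof (cases "L1' i j = L1 x1 y1 \<and> L2' i j = L2 x1 y1")
      case True
      hence 1: "(R' i j = M i j \<longleftrightarrow> R x1 y1 = M x1 y1) \<and> ((i, j), (x1, y1)) \<in> (links V M)\<^sup>*"
        and 2: "(R' k l = M k l \<longleftrightarrow> R x1 y1 = M x1 y1) \<and> ((k, l), (x1, y1)) \<in> (links V M)\<^sup>*"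
        using to_hi[OF ij e(1)] to_hi[OF kl e(2)] eq by auto
      from links_rtrancl_sym[OF conjunct2[OF 2]] 1 2 show ?thesis by (auto intro: rtrancl_trans)
    next
      case False
      have "\<not> lo i j" "\<not> lo k l"
        using False eq new(2,3)[OF ij E_neq[OF e(1)]] new(2,3)[OF kl E_neq[OF e(2)]] by auto
      thus ?thesis using con_class[OF ij kl e] kept[OF ij e(1)] kept[OF kl e(2)] eq
          new(2,3)[OF ij E_neq[OF e(1)]] new(2,3)[OF kl E_neq[OF e(2)]] by auto
    qed
  qed
  show "\<forall>i\<in>V. \<forall>j\<in>V. E i j \<longrightarrow> L1' i j \<in> V \<and> L2' i j \<in> V \<and> E (L1' i j) (L2' i j) \<and> L1' i j \<le> i \<and>
      L1' (L1' i j) (L2' i j) = L1' i j \<and> L2' (L1' i j) (L2' i j) = L2' i j \<and>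
      R' (L1' i j) (L2' i j) = \<rho> (M (L1' i j) (L2' i j)) (M (L2' i j) (L1' i j))"
  proof (intro ballI impI)
    fix i j assume ij: "i \<in> V" "j \<in> V" and e: "E i j"
    have "\<exists>k\<in>V. \<exists>l\<in>V. E k l \<and> L1' i j = L1 k l \<and> L2' i j = L2 k l \<and> \<not> lo k l \<and> L1 k l \<le> i"
    proof (cases "lo i j")
      case True
      have "\<not> lo x1 y1" using ne by (auto simp: lo_def)
      moreover have "L1 x1 y1 \<le> i" using con_rep[OF ij e] le True by (auto simp: lo_def)
      ultimately show ?thesis using True new(2,3)[OF ij E_neq[OF e]] V(1,2) ee(1) by auto
    next
      case False
      thus ?thesis using con_rep[OF ij e] new(2,3)[OF ij E_neq[OF e]] ij e by auto
    qed
    then obtain k l where kl: "k \<in> V" "l \<in> V" "E k l" "L1' i j = L1 k l" "L2' i j = L2 k l" "\<not> lo k l" "L1 k l \<le> i"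
      by blast
    note rep = con_rep[OF kl(1-3)]
    have "\<not> lo (L1 k l) (L2 k l)" using rep kl(6) by (auto simp: lo_def)
    moreover have "L1 k l \<noteq> L2 k l" using rep by auto
    ultimately show "L1' i j \<in> V \<and> L2' i j \<in> V \<and> E (L1' i j) (L2' i j) \<and> L1' i j \<le> i \<and>
      L1' (L1' i j) (L2' i j) = L1' i j \<and> L2' (L1' i j) (L2' i j) = L2' i j \<and>
      R' (L1' i j) (L2' i j) = \<rho> (M (L1' i j) (L2' i j)) (M (L2' i j) (L1' i j))"
      unfolding kl(4,5) using rep kl(7) new[of "L1 k l" "L2 k l"] by simp
  qed
qed

lemma consistent_compatible:
  assumes closed: "\<And>i j k l. ((i, j), (k, l)) \<in> links V M \<Longrightarrow> L1 i j = L1 k l \<and> L2 i j = L2 k l"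
  shows "compatible V M R"
proof -
  interpret labelling V M R "\<lambda>i j. (L1 i j, L2 i j)" \<rho>
  proof
    show "coherent V M" by (rule coherent_M)
    show "reoriented V M R" by (rule con_reo)
    show "\<rho> x y \<in> {x, y}" "\<rho> x y = \<rho> y x" for x y by (rule rho)+
    show "(L1 i j, L2 i j) = (L1 k l, L2 k l)" if "((i, j), (k, l)) \<in> links V M" for i j k l
      using closed[OF that] by simp
    show "((i, j), (k, l)) \<in> (links V M)\<^sup>*"
      if "{i, j, k, l} \<subseteq> V" "E i j" "E k l" "(L1 i j, L2 i j) = (L1 k l, L2 k l)" for i j k l
      using con_class[of i j k l] that by simp
    show "R i j = M i j \<longleftrightarrow> R k l = M k l"
      if "{i, j, k, l} \<subseteq> V" "E i j" "E k l" "(L1 i j, L2 i j) = (L1 k l, L2 k l)" for i j k l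
      using con_class[of i j k l] that by simp
    show "\<exists>a\<in>V. \<exists>b\<in>V. E a b \<and> (L1 a b, L2 a b) = (L1 i j, L2 i j) \<and>
       R a b = \<rho> (M a b) (M b a) \<and> (\<forall>k\<in>V. \<forall>l\<in>V. E k l \<longrightarrow> (L1 k l, L2 k l) = (L1 i j, L2 i j) \<longrightarrow> a \<le> k)"
      if "{i, j} \<subseteq> V" "E i j" for i j
    proof (intro bexI conjI)
      note rep = con_rep[of i j]
      show "\<forall>k\<in>V. \<forall>l\<in>V. E k l \<longrightarrow> (L1 k l, L2 k l) = (L1 i j, L2 i j) \<longrightarrow> L1 i j \<le> k"
        using con_rep by force
    qed (use con_rep[of i j] that in auto)
  qed
  show ?thesis by (rule compatible)
qed

lemma consistent_solution:
  assumes closed: "\<And>i j k l. ((i, j), (k, l)) \<in> links V M \<Longrightarrow> L1 i j = L1 k l \<and> L2 i j = L2 k l"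
    and B: "B \<in> carrier_mat n n" "\<And>i j. i < n \<Longrightarrow> j < n \<Longrightarrow> B $$ (i, j) = pp i * bordered 0 \<delta> R i j"
    and S: "S \<subseteq> {..<n}"
  shows "principal_minor A S = principal_minor B S"
proof -
  have fin: "finite S" using S finite_subset by blast
  then obtain xs where xs: "distinct xs" "set xs = S" using finite_distinct_list by blast
  have "same_minors 0 \<delta> V M R"
    by (rule compatible_same_minors[OF consistent_compatible[OF closed]]) (auto simp: V_def)
  moreover have "insert 0 V = {..<n}" using n by (auto simp: V_def)
  ultimately have eq: "pdet (bordered 0 \<delta> M) xs = pdet (bordered 0 \<delta> R) xs"
    using xs S by (auto simp: same_minors_def)
  have "principal_minor B S = pdet (\<lambda>i j. B $$ (i, j)) xs"
    by (rule principal_minor_pdet[OF B(1) S xs])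
  also have "\<dots> = pdet (\<lambda>i j. pp i * bordered 0 \<delta> R i j * 1) xs"
    by (rule pdet_cong) (use B(2) xs S in auto)
  also have "\<dots> = (\<Prod>x\<leftarrow>xs. pp x) * pdet (bordered 0 \<delta> R) xs"
    by (simp only: pdet_scale) (simp add: map_replicate_const)
  also have "\<dots> = (\<Prod>x\<leftarrow>xs. pp x) * pdet M xs"
    unfolding eq[symmetric] by (intro arg_cong2[of _ _ _ _ times] pdet_cong refl bordered_M) (use xs S in auto)
  also have "\<dots> = principal_minor A S"
    using pdet_A[of xs] principal_minor_pdet[OF A S xs] xs S by simp
  finally show ?thesis by simp
qed

lemma triple_test:
  assumes V: "i \<in> V" "j \<in> V" "k \<in> V" and d: "distinct [i, j, k]"
    and ne: "R i j \<noteq> R j i" "R i k \<noteq> R k i"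
    and t: "t = cycs (M i j) (M j i) (M j k) (M k j) (M k i) (M i k)"
  defines "same \<equiv> cycs (R i j) (R j i) (R j k) (R k j) (R k i) (R i k) = t \<or>
    cycs (R i j) (R j i) (R k j) (R j k) (R k i) (R i k) = t"
  defines "opp \<equiv> cycs (R j i) (R i j) (R j k) (R k j) (R k i) (R i k) = t \<or>
    cycs (R i j) (R j i) (R j k) (R k j) (R i k) (R k i) = t"
  shows "linked_triple M i j k \<longleftrightarrow> \<not> (same \<and> opp)"
    and "linked_triple M i j k \<Longrightarrow> same \<longleftrightarrow> (R i j = M i j \<longleftrightarrow> R i k = M i k)"
proof -
  have e: "M i j \<noteq> M j i" "M k i \<noteq> M i k" using con_antisym V ne by auto
  have d': "i \<noteq> j" "j \<noteq> k" "k \<noteq> i" using d by auto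
  note ct = cycs_tests[OF con_cases[OF V(1,2) d'(1)] con_cases[OF V(2,3) d'(2)] con_cases[OF V(3,1) d'(3)] e]
  show 1: "linked_triple M i j k \<longleftrightarrow> \<not> (same \<and> opp)"
    unfolding same_def opp_def t ct(1) using e by (auto simp: linked_triple_def twins_def)
  show "same \<longleftrightarrow> (R i j = M i j \<longleftrightarrow> R i k = M i k)" if "linked_triple M i j k"
    using that ct(2) 1 con_kept[OF V(1,3)] e unfolding same_def opp_def t by auto
qed

lemma quad_test:
  assumes V: "i \<in> V" "j \<in> V" "k \<in> V" "l \<in> V" and d: "distinct [i, j, k, l]"
  shows "linked_quad M i j k l \<longleftrightarrow> R i j \<noteq> R j i \<and> R k l \<noteq> R l k \<and> R i k = R k i \<and> R i l = R l i \<and>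
     R j k = R k j \<and> R j l = R l j \<and> R j k * R i l \<noteq> R j l * R i k"
    and "linked_quad M i j k l \<Longrightarrow> pdet (bordered 0 \<delta> R) [i, j, k, l] = pdet M [i, j, k, l] \<longleftrightarrow>
      (R i j = M i j \<longleftrightarrow> R k l = M k l)"
proof -
  have d': "i \<noteq> j" "i \<noteq> k" "i \<noteq> l" "j \<noteq> k" "j \<noteq> l" "k \<noteq> l" using d by auto
  have symeq: "R x y = M x y \<and> R y x = M x y" if "R x y = R y x \<or> M x y = M y x" "x \<in> V" "y \<in> V" "x \<noteq> y" for x y
    using con_cases[OF that(2-4)] that(1) by auto
  have prod: "(twins M i k l \<and> twins M j k l) \<or> (twins M k i j \<and> twins M l i j) \<longleftrightarrow> M j k * M i l = M j l * M i k"
    if "M i k = M k i" "M i l = M l i" "M j k = M k j" "M j l = M l j"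
    using product_coincidence[of i j k l] V d that by (auto simp: twins_def mult.commute)
  show "linked_quad M i j k l \<longleftrightarrow> R i j \<noteq> R j i \<and> R k l \<noteq> R l k \<and> R i k = R k i \<and> R i l = R l i \<and>
     R j k = R k j \<and> R j l = R l j \<and> R j k * R i l \<noteq> R j l * R i k" (is "_ \<longleftrightarrow> ?rhs")
  proof
    assume q: "linked_quad M i j k l"
    hence s: "M i k = M k i" "M i l = M l i" "M j k = M k j" "M j l = M l j" by (auto simp: linked_quad_def)
    have "M j k * M i l \<noteq> M j l * M i k" using q prod[OF s] by (auto simp: linked_quad_def)
    thus ?rhs using q con_antisym V s symeq[of i k] symeq[of i l] symeq[of j k] symeq[of j l] d'
      by (auto simp: linked_quad_def)
  next
    assume q: ?rhs
    hence s: "M i k = M k i" "M i l = M l i" "M j k = M k j" "M j l = M l j" using con_antisym V by auto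
    show "linked_quad M i j k l"
      using q prod[OF s] con_antisym V s symeq[of i k] symeq[of i l] symeq[of j k] symeq[of j l] d'
      unfolding linked_quad_def by auto
  qed
  assume q: "linked_quad M i j k l"
  hence s: "M i k = M k i" "M i l = M l i" "M j k = M k j" "M j l = M l j" by (auto simp: linked_quad_def)
  have nz: "M j k * M i l \<noteq> M j l * M i k" using q prod[OF s] by (auto simp: linked_quad_def)
  have e: "E i j" "E k l" using q by (auto simp: linked_quad_def)
  define f g where "f = bordered 0 \<delta> M" and "g = bordered 0 \<delta> R"
  have bV: "bordered 0 \<delta> r x y = (if x = y then \<delta> x else r x y)" if "x \<in> V" "y \<in> V" for r :: "nat \<Rightarrow> nat \<Rightarrow> 'a" and x y
    using that by (auto simp: bordered_def V_def)
  have fM: "pdet f [i, j, k, l] = pdet M [i, j, k, l]"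
    by (rule pdet_cong) (use V in \<open>auto simp: f_def bV \<delta>_def\<close>)
  note sy = symeq[of i k] symeq[of i l] symeq[of j k] symeq[of j l] s d' V
  have same: "pdet g [i, j, k, l] = pdet f [i, j, k, l]" if "R i j = M i j \<longleftrightarrow> R k l = M k l"
  proof (cases "R i j = M i j")
    case True
    show ?thesis
      by (rule pdet_cong) (use that True sy con_kept[OF V(1,2) e(1)] con_kept[OF V(3,4) e(2)] in \<open>auto simp: f_def g_def bV\<close>)
  next
    case False
    have "R i j = M j i" "R j i = M i j" "R k l = M l k" "R l k = M k l"
      using that False con_cases[OF V(1,2) d'(1)] con_cases[OF V(3,4) d'(6)] by auto
    hence "pdet g [i, j, k, l] = pdet (\<lambda>x y. f y x) [i, j, k, l]"
      by (intro pdet_cong refl) (use sy in \<open>auto simp: f_def g_def bV\<close>)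
    thus ?thesis using pdet_transpose[of f] by simp
  qed
  have diff: "pdet g [i, j, k, l] \<noteq> pdet f [i, j, k, l]" if ne: "\<not> (R i j = M i j \<longleftrightarrow> R k l = M k l)"
  proof (cases "R i j = M i j")
    case False
    have v: "R i j = M j i" "R j i = M i j" "R k l = M k l" "R l k = M l k"
      using ne False con_cases[OF V(1,2) d'(1)] con_cases[OF V(3,4) d'(6)] by auto
    have "pdet f [i, j, k, l] - pdet g [i, j, k, l] = (f i l * f j k - f i k * f j l) * (f i j - f j i) * (f l k - f k l)"
      by (rule pdet_4_flip[OF d]) (use v sy in \<open>auto simp: f_def g_def bV\<close>)
    also have "\<dots> \<noteq> 0" using nz e d' V by (simp add: f_def bV mult.commute)
    finally show ?thesis by auto
  next
    case True
    have v: "R i j = M i j" "R j i = M j i" "R k l = M l k" "R l k = M k l"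
      using ne True con_cases[OF V(1,2) d'(1)] con_cases[OF V(3,4) d'(6)] by auto
    have p: "pdet h [k, l, i, j] = pdet h [i, j, k, l]" for h :: "nat \<Rightarrow> nat \<Rightarrow> 'a" by (rule pdet_permute) simp
    have "pdet f [k, l, i, j] - pdet g [k, l, i, j] = (f k j * f l i - f k i * f l j) * (f k l - f l k) * (f j i - f i j)"
      by (rule pdet_4_flip) (use d v sy in \<open>auto simp: f_def g_def bV\<close>)
    also have "\<dots> \<noteq> 0" using nz e d' V s by (simp add: f_def bV mult.commute)
    finally show ?thesis by (auto simp: p)
  qed
  show "pdet (bordered 0 \<delta> R) [i, j, k, l] = pdet M [i, j, k, l] \<longleftrightarrow> (R i j = M i j \<longleftrightarrow> R k l = M k l)"
    using same diff fM unfolding g_def by auto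
qed

end
end

section \<open>Running times of programs\<close>

definition sv :: "string \<Rightarrow> nexp" where "sv X = NRead X (NConst 0) (NConst 0)"
definition fv :: "string \<Rightarrow> fexp" where "fv X = FRead X (NConst 0) (NConst 0)"
abbreviation nset :: "string \<Rightarrow> nexp \<Rightarrow> com" where "nset X \<equiv> NAssign X (NConst 0) (NConst 0)"
abbreviation fset :: "string \<Rightarrow> fexp \<Rightarrow> com" where "fset X \<equiv> FAssign X (NConst 0) (NConst 0)"

definition for_loop :: "string \<Rightarrow> nat \<Rightarrow> com \<Rightarrow> com" where
  "for_loop X a c = Seq (nset X (NConst a))
     (While (NLess (sv X) (sv ''n'')) (Seq c (nset X (NAdd (sv X) (NConst 1)))))"

definition for_time :: "nat \<Rightarrow> nat \<Rightarrow> nat" where "for_time n t = (n + 1) * (t + 20) + 20"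

primrec cost :: "nat \<Rightarrow> com \<Rightarrow> nat" where
  "cost \<tau> Skip = 1"
| "cost \<tau> (NAssign X i j e) = 1 + ncost i + ncost j + ncost e"
| "cost \<tau> (FAssign X i j e) = 1 + ncost i + ncost j + fcost \<tau> e"
| "cost \<tau> (Query X i j a b c d) = 1 + ncost i + ncost j + ncost a + ncost b + ncost c + ncost d"
| "cost \<tau> (Seq c1 c2) = 1 + cost \<tau> c1 + cost \<tau> c2"
| "cost \<tau> (Cond b c1 c2) = 1 + bcost \<tau> b + cost \<tau> c1 + cost \<tau> c2"
| "cost \<tau> (While b c) = 0"

lemma upd_apply: "upd m X i j v Y a b = (if Y = X \<and> a = i \<and> b = j then v else m Y a b)"
  by (simp add: upd_def)

lemma upd_other: "Y \<noteq> X \<Longrightarrow> upd m X i j v Y = m Y"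
  by (simp add: upd_def)

lemma polynomially_bounded_const: "polynomially_bounded (\<lambda>n. c)"
  unfolding polynomially_bounded_def by (rule exI[of _ "[:c:]"]) simp
lemma polynomially_bounded_id: "polynomially_bounded (\<lambda>n. n)"
  unfolding polynomially_bounded_def by (rule exI[of _ "[:0, 1:]"]) simp
lemma polynomially_bounded_add:
  assumes "polynomially_bounded f" "polynomially_bounded g"
  shows "polynomially_bounded (\<lambda>n. f n + g n)"
proof -
  obtain p q where "\<And>n. f n \<le> poly p n" "\<And>n. g n \<le> poly q n" using assms unfolding polynomially_bounded_def by blast
  hence "f n + g n \<le> poly (p + q) n" for n by (simp add: add_mono)
  thus ?thesis unfolding polynomially_bounded_def by blast
qed
lemma polynomially_bounded_mult:
  assumes "polynomially_bounded f" "polynomially_bounded g"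
  shows "polynomially_bounded (\<lambda>n. f n * g n)"
proof -
  obtain p q where "\<And>n. f n \<le> poly p n" "\<And>n. g n \<le> poly q n" using assms unfolding polynomially_bounded_def by blast
  hence "f n * g n \<le> poly (p * q) n" for n by (simp add: mult_mono)
  thus ?thesis unfolding polynomially_bounded_def by blast
qed

lemma polynomially_bounded_for:
  "polynomially_bounded f \<Longrightarrow> polynomially_bounded (\<lambda>n. for_time n (f n))"
  unfolding for_time_def
  by (intro polynomially_bounded_add polynomially_bounded_mult polynomially_bounded_const polynomially_bounded_id)

lemma polynomially_bounded_fcost:
  "polynomially_bounded \<tau> \<Longrightarrow> polynomially_bounded (\<lambda>n. fcost (\<tau> n) e)"
  by (induction e) (auto intro!: polynomially_bounded_add polynomially_bounded_const simp del: add_Suc simp flip: Suc_eq_plus1_left)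
lemma polynomially_bounded_bcost:
  "polynomially_bounded \<tau> \<Longrightarrow> polynomially_bounded (\<lambda>n. bcost (\<tau> n) b)"
  by (induction b) (auto intro!: polynomially_bounded_add polynomially_bounded_const polynomially_bounded_fcost simp del: add_Suc simp flip: Suc_eq_plus1_left)
lemma polynomially_bounded_cost:
  "polynomially_bounded \<tau> \<Longrightarrow> polynomially_bounded (\<lambda>n. cost (\<tau> n) c)"
  by (induction c) (auto intro!: polynomially_bounded_add polynomially_bounded_const polynomially_bounded_fcost polynomially_bounded_bcost simp del: add_Suc simp flip: Suc_eq_plus1_left)

locale machine =
  fixes orc :: "nat set \<Rightarrow> 'a::field" and rt as :: "'a \<Rightarrow> 'a" and \<tau> :: nat
begin

definition runs :: "com \<Rightarrow> 'a state \<Rightarrow> nat \<Rightarrow> ('a state \<Rightarrow> bool) \<Rightarrow> bool" where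
  "runs c s t Q \<longleftrightarrow> (\<exists>t' s'. exec orc rt as \<tau> c s t' s' \<and> t' \<le> t \<and> Q s')"

primrec wp :: "com \<Rightarrow> ('a state \<Rightarrow> bool) \<Rightarrow> 'a state \<Rightarrow> bool" where
  "wp Skip Q s = Q s"
| "wp (NAssign X i j e) Q s = Q (s\<lparr>nmem := upd (nmem s) X (neval s i) (neval s j) (neval s e)\<rparr>)"
| "wp (FAssign X i j e) Q s = Q (s\<lparr>fmem := upd (fmem s) X (neval s i) (neval s j) (feval rt as s e)\<rparr>)"
| "wp (Query X i j a b c d) Q s = Q (s\<lparr>fmem := upd (fmem s) X (neval s i) (neval s j)
        (orc {neval s a, neval s b, neval s c, neval s d})\<rparr>)"
| "wp (Seq c1 c2) Q s = wp c1 (wp c2 Q) s"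
| "wp (Cond b c1 c2) Q s = (if beval rt as s b then wp c1 Q s else wp c2 Q s)"
| "wp (While b c) Q s = False"

lemma wp_runs: "wp c Q s \<Longrightarrow> runs c s (cost \<tau> c) Q"
proof (induction c arbitrary: Q s)
  case (Seq c1 c2)
  then obtain t1 s1 where 1: "exec orc rt as \<tau> c1 s t1 s1" "t1 \<le> cost \<tau> c1" "wp c2 Q s1"
    by (fastforce simp: runs_def)
  with Seq.IH(2) obtain t2 s2 where 2: "exec orc rt as \<tau> c2 s1 t2 s2" "t2 \<le> cost \<tau> c2" "Q s2"
    unfolding runs_def by blast
  show ?case unfolding runs_def using exec.Seq[OF 1(1) 2(1)] 1 2 by fastforce
next
  case (Cond b c1 c2)
  show ?case
  proof (cases "beval rt as s b")
    case True
    then obtain t s' where 1: "exec orc rt as \<tau> c1 s t s'" "t \<le> cost \<tau> c1" "Q s'"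
      using Cond by (fastforce simp: runs_def)
    show ?thesis unfolding runs_def using exec.CondTrue[OF True 1(1), of c2] 1 by fastforce
  next
    case False
    then obtain t s' where 1: "exec orc rt as \<tau> c2 s t s'" "t \<le> cost \<tau> c2" "Q s'"
      using Cond by (fastforce simp: runs_def)
    show ?thesis unfolding runs_def using exec.CondFalse[OF False 1(1), of c1] 1 by fastforce
  qed
qed (auto simp: runs_def intro!: exI intro: exec.intros exec.Skip[of orc rt as \<tau>] exec.NAssign[of orc rt as \<tau>, simplified]
   exec.FAssign[of orc rt as \<tau>, simplified] exec.Query[of orc rt as \<tau>, simplified])

lemma runs_mono: "runs c s t Q \<Longrightarrow> t \<le> t' \<Longrightarrow> (\<And>s'. Q s' \<Longrightarrow> Q' s') \<Longrightarrow> runs c s t' Q'"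
  unfolding runs_def by (meson le_trans)

lemma runs_Seq:
  assumes "runs c1 s t1 (\<lambda>s1. runs c2 s1 t2 Q)" shows "runs (Seq c1 c2) s (1 + t1 + t2) Q"
proof -
  obtain u1 s1 where 1: "exec orc rt as \<tau> c1 s u1 s1" "u1 \<le> t1" "runs c2 s1 t2 Q"
    using assms unfolding runs_def by blast
  then obtain u2 s2 where 2: "exec orc rt as \<tau> c2 s1 u2 s2" "u2 \<le> t2" "Q s2" unfolding runs_def by blast
  show ?thesis unfolding runs_def using exec.Seq[OF 1(1) 2(1)] 1 2 by fastforce
qed

lemma runs_Cond:
  assumes "beval rt as s b \<Longrightarrow> runs c1 s t1 Q" "\<not> beval rt as s b \<Longrightarrow> runs c2 s t2 Q"
  shows "runs (Cond b c1 c2) s (1 + bcost \<tau> b + t1 + t2) Q"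
proof (cases "beval rt as s b")
  case True
  then obtain t s' where 1: "exec orc rt as \<tau> c1 s t s'" "t \<le> t1" "Q s'"
    using assms(1) by (fastforce simp: runs_def)
  show ?thesis unfolding runs_def using exec.CondTrue[OF True 1(1), of c2] 1 by fastforce
next
  case False
  then obtain t s' where 1: "exec orc rt as \<tau> c2 s t s'" "t \<le> t2" "Q s'"
    using assms(2) by (fastforce simp: runs_def)
  show ?thesis unfolding runs_def using exec.CondFalse[OF False 1(1), of c1] 1 by fastforce
qed

definition put :: "'a state \<Rightarrow> string \<Rightarrow> nat \<Rightarrow> 'a state" where
  "put s X v = s\<lparr>nmem := upd (nmem s) X 0 0 v\<rparr>"

lemma runs_for:
  assumes an: "a \<le> n" and size: "\<And>m s. I m s \<Longrightarrow> nmem s ''n'' 0 0 = n"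
    and init: "I a (put s X a)"
    and body: "\<And>m s. \<lbrakk>a \<le> m; m < n; I m s; nmem s X 0 0 = m\<rbrakk> \<Longrightarrow>
       runs c s t (\<lambda>s'. nmem s' X 0 0 = m \<and> I (Suc m) (put s' X (Suc m)))"
  shows "runs (for_loop X a c) s (for_time n t) (I n)"
proof -
  let ?w = "While (NLess (sv X) (sv ''n'')) (Seq c (nset X (NAdd (sv X) (NConst 1))))"
  have loop: "runs ?w s ((n - m) * (t + 17) + 8) (I n)"
    if "a \<le> m" "m \<le> n" "I m s" "nmem s X 0 0 = m" for m s
    using that
  proof (induction "n - m" arbitrary: m s)
    case 0
    hence "m = n" by simp
    have "exec orc rt as \<tau> ?w s (1 + bcost \<tau> (NLess (sv X) (sv ''n''))) s"
      by (rule exec.WhileFalse) (use 0 size[OF 0(4)] \<open>m = n\<close> in \<open>simp add: sv_def\<close>)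
    thus ?case unfolding runs_def using 0 \<open>m = n\<close> by (fastforce simp: sv_def)
  next
    case (Suc k)
    hence m: "m < n" by simp
    have b: "beval rt as s (NLess (sv X) (sv ''n''))"
      using Suc m size[OF Suc.prems(3)] by (simp add: sv_def)
    obtain t1 s1 where 1: "exec orc rt as \<tau> c s t1 s1" "t1 \<le> t" "nmem s1 X 0 0 = m" "I (Suc m) (put s1 X (Suc m))"
      using body[OF Suc.prems(1) m Suc.prems(3,4)] unfolding runs_def by blast
    have 2: "exec orc rt as \<tau> (nset X (NAdd (sv X) (NConst 1))) s1 8 (put s1 X (Suc m))"
      using exec.NAssign[of orc rt as \<tau> X "NConst 0" "NConst 0" "NAdd (sv X) (NConst 1)" s1] 1(3)
      by (simp add: sv_def put_def eval_nat_numeral)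
    have "runs ?w (put s1 X (Suc m)) ((n - Suc m) * (t + 17) + 8) (I n)"
      by (rule Suc.hyps(1)) (use Suc m 1 in \<open>auto simp: put_def upd_apply\<close>)
    then obtain t3 s3 where 3: "exec orc rt as \<tau> ?w (put s1 X (Suc m)) t3 s3"
      "t3 \<le> (n - Suc m) * (t + 17) + 8" "I n s3" unfolding runs_def by blast
    have "exec orc rt as \<tau> ?w s (1 + bcost \<tau> (NLess (sv X) (sv ''n'')) + (1 + t1 + 8) + t3) s3"
      by (rule exec.WhileTrue[OF b exec.Seq[OF 1(1) 2] 3(1)])
    moreover have "(n - m) * (t + 17) = (n - Suc m) * (t + 17) + (t + 17)"
      using m by (metis Suc_diff_Suc add.commute mult_Suc)
    ultimately show ?case unfolding runs_def using 3 1(2) by (fastforce simp: sv_def)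
  qed
  have "exec orc rt as \<tau> (nset X (NConst a)) s 4 (put s X a)"
    using exec.NAssign[of orc rt as \<tau> X "NConst 0" "NConst 0" "NConst a" s] by (simp add: put_def eval_nat_numeral)
  moreover have "runs ?w (put s X a) ((n - a) * (t + 17) + 8) (I n)"
    by (rule loop) (use an init in \<open>auto simp: put_def upd_apply\<close>)
  ultimately have "runs (for_loop X a c) s (1 + 4 + ((n - a) * (t + 17) + 8)) (I n)"
    unfolding for_loop_def by (intro runs_Seq) (auto simp: runs_def)
  moreover have "(n - a) * (t + 17) \<le> (n + 1) * (t + 20)" by (intro mult_mono) auto
  ultimately show ?thesis unfolding for_time_def by (elim runs_mono) auto
qed

end

section \<open>The algorithm\<close>

definition neq :: "nexp \<Rightarrow> nexp \<Rightarrow> bexp" where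
  "neq a b = BNot (BAnd (BNot (NLess a b)) (BNot (NLess b a)))"
definition fneq :: "fexp \<Rightarrow> fexp \<Rightarrow> bexp" where "fneq a b = BNot (FEq a b)"
definition bor :: "bexp \<Rightarrow> bexp \<Rightarrow> bexp" where "bor a b = BNot (BAnd (BNot a) (BNot b))"
definition ball :: "bexp list \<Rightarrow> bexp" where "ball bs = foldr BAnd bs (BNot (NLess (NConst 0) (NConst 0)))"
definition block :: "com list \<Rightarrow> com" where "block cs = foldr Seq cs Skip"

lemma beval_simps [simp]:
  "beval rt as s (neq a b) \<longleftrightarrow> neval s a \<noteq> neval s b"
  "beval rt as s (fneq e f) \<longleftrightarrow> feval rt as s e \<noteq> feval rt as s f"
  "beval rt as s (bor c d) \<longleftrightarrow> beval rt as s c \<or> beval rt as s d"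
  "beval rt as s (ball bs) \<longleftrightarrow> (\<forall>b\<in>set bs. beval rt as s b)"
  by (auto simp: neq_def fneq_def bor_def) (induction bs; auto simp: ball_def)+

lemma eval_scalar [simp]:
  "neval s (sv X) = nmem s X 0 0" "feval rt as s (fv X) = fmem s X 0 0"
  by (simp_all add: sv_def fv_def)

lemma (in machine) wp_block [simp]:
  "wp (block []) Q s = Q s" "wp (block (c # cs)) Q s = wp c (wp (block cs) Q) s"
  by (simp_all add: block_def)

abbreviation "vi \<equiv> sv ''i''"
abbreviation "vj \<equiv> sv ''j''"
abbreviation "vk \<equiv> sv ''k''"
abbreviation "vl \<equiv> sv ''l''"
abbreviation "va \<equiv> sv ''a''"
abbreviation "vb \<equiv> sv ''b''"
abbreviation "n0 \<equiv> NConst 0"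
abbreviation "rr \<equiv> FRead ''R''"
abbreviation "pe x \<equiv> FRead ''p'' x (NConst 0)"

definition merge_body :: com where
  "merge_body = Cond (ball [NLess va vb, BNot (neq (NRead ''L1'' va vb) (sv ''v1'')), BNot (neq (NRead ''L2'' va vb) (sv ''v2''))])
    (block [NAssign ''L1'' va vb (sv ''u1''), NAssign ''L2'' va vb (sv ''u2''),
      NAssign ''L1'' vb va (sv ''u1''), NAssign ''L2'' vb va (sv ''u2''),
      Cond (neq (sv ''f'') n0)
        (block [fset ''t'' (rr va vb), FAssign ''R'' va vb (rr vb va), FAssign ''R'' vb va (fv ''t'')]) Skip]) Skip"

definition merge_start :: "nexp \<Rightarrow> nexp \<Rightarrow> nexp \<Rightarrow> nexp \<Rightarrow> com" where
  "merge_start x1 y1 x2 y2 = Cond (NLess (NRead ''L1'' x2 y2) (NRead ''L1'' x1 y1))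
    (block [nset ''u1'' (NRead ''L1'' x2 y2), nset ''u2'' (NRead ''L2'' x2 y2),
      nset ''v1'' (NRead ''L1'' x1 y1), nset ''v2'' (NRead ''L2'' x1 y1)])
    (block [nset ''u1'' (NRead ''L1'' x1 y1), nset ''u2'' (NRead ''L2'' x1 y1),
      nset ''v1'' (NRead ''L1'' x2 y2), nset ''v2'' (NRead ''L2'' x2 y2)])"

definition merge :: "nexp \<Rightarrow> nexp \<Rightarrow> nexp \<Rightarrow> nexp \<Rightarrow> com" where
  "merge x1 y1 x2 y2 = Cond (ball [BNot (neq (NRead ''L1'' x1 y1) (NRead ''L1'' x2 y2)), BNot (neq (NRead ''L2'' x1 y1) (NRead ''L2'' x2 y2))])
    Skip (Seq (merge_start x1 y1 x2 y2) (for_loop ''a'' 1 (for_loop ''b'' 1 merge_body)))"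

definition merge_time :: "nexp \<Rightarrow> nexp \<Rightarrow> nexp \<Rightarrow> nexp \<Rightarrow> nat \<Rightarrow> nat \<Rightarrow> nat" where
  "merge_time x1 y1 x2 y2 n \<tau> = 1 + bcost \<tau> (ball [BNot (neq (NRead ''L1'' x1 y1) (NRead ''L1'' x2 y2)), BNot (neq (NRead ''L2'' x1 y1) (NRead ''L2'' x2 y2))])
    + 1 + (1 + cost \<tau> (merge_start x1 y1 x2 y2) + for_time n (for_time n (cost \<tau> merge_body)))"

lemma (in machine) put_other [simp]: "Y \<noteq> X \<Longrightarrow> nmem (put s X v) Y = nmem s Y" "fmem (put s X v) = fmem s"
    "nmem (put s X v) X 0 0 = v"
  by (simp_all add: put_def upd_def)

locale run = solver n A \<rho> + machine orc rt as \<tau>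
  for n and A :: "'a::field mat" and \<rho> and orc :: "nat set \<Rightarrow> 'a" and rt as :: "'a \<Rightarrow> 'a" and \<tau> :: nat +
  assumes minors: "minor_oracle n A orc"
begin

definition base :: "'a state \<Rightarrow> bool" where
  "base s \<longleftrightarrow> nmem s ''n'' 0 0 = n \<and> (\<forall>i<n. fmem s ''p'' i 0 = pp i) \<and>
     (\<forall>i<n. fmem s ''R'' i i = \<delta> i) \<and> (\<forall>i\<in>V. fmem s ''R'' 0 i = 1 \<and> fmem s ''R'' i 0 = 1)"

definition valid_state :: "'a state \<Rightarrow> bool" where
  "valid_state s \<longleftrightarrow> base s \<and> consistent (fmem s ''R'') (nmem s ''L1'') (nmem s ''L2'')"

definition same_label :: "'a state \<Rightarrow> nat \<Rightarrow> nat \<Rightarrow> nat \<Rightarrow> nat \<Rightarrow> bool" where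
  "same_label s i j k l \<longleftrightarrow> nmem s ''L1'' i j = nmem s ''L1'' k l \<and> nmem s ''L2'' i j = nmem s ''L2'' k l"

definition coarser :: "'a state \<Rightarrow> 'a state \<Rightarrow> bool" where
  "coarser s s' \<longleftrightarrow> (\<forall>i\<in>V. \<forall>j\<in>V. \<forall>k\<in>V. \<forall>l\<in>V. i \<noteq> j \<longrightarrow> k \<noteq> l \<longrightarrow> same_label s i j k l \<longrightarrow> same_label s' i j k l)"

definition pass :: "nat \<Rightarrow> nat \<Rightarrow> nat \<Rightarrow> nat \<Rightarrow> bool" where
  "pass m k x y \<longleftrightarrow> x \<in> V \<and> y \<in> V \<and> x \<noteq> y \<and> (min x y < m \<or> (min x y = m \<and> max x y < k))"

definition merging :: "'a state \<Rightarrow> nat \<Rightarrow> nat \<Rightarrow> 'a state \<Rightarrow> bool" where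
  "merging s0 m k s \<longleftrightarrow> (\<forall>x y. let lo = (pass m k x y \<and> nmem s0 ''L1'' x y = nmem s0 ''v1'' 0 0 \<and> nmem s0 ''L2'' x y = nmem s0 ''v2'' 0 0) in
      nmem s ''L1'' x y = (if lo then nmem s0 ''u1'' 0 0 else nmem s0 ''L1'' x y) \<and>
      nmem s ''L2'' x y = (if lo then nmem s0 ''u2'' 0 0 else nmem s0 ''L2'' x y) \<and>
      fmem s ''R'' x y = (if lo \<and> nmem s0 ''f'' 0 0 \<noteq> 0 then fmem s0 ''R'' y x else fmem s0 ''R'' x y)) \<and>
     fmem s ''p'' = fmem s0 ''p'' \<and>
     (\<forall>X\<in>{''n'', ''i'', ''j'', ''k'', ''l'', ''f'', ''u1'', ''u2'', ''v1'', ''v2''}. nmem s X = nmem s0 X)"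

lemma pass_step: "pass m (Suc k) x y \<longleftrightarrow> pass m k x y \<or> (m \<in> V \<and> k \<in> V \<and> m < k \<and> ((x = m \<and> y = k) \<or> (x = k \<and> y = m)))"
  by (auto simp: pass_def min_def max_def less_Suc_eq)
lemma pass_row: "pass m n x y \<longleftrightarrow> pass (Suc m) (Suc 0) x y"
  by (auto simp: pass_def V_def min_def max_def)
lemma pass_start: "\<not> pass (Suc 0) (Suc 0) x y"
  by (auto simp: pass_def V_def min_def)
lemma pass_end: "pass n (Suc 0) x y \<longleftrightarrow> x \<in> V \<and> y \<in> V \<and> x \<noteq> y"
  by (auto simp: pass_def V_def min_def)

lemma merging_put: "X \<in> {''a'', ''b''} \<Longrightarrow> merging s0 m k (put s X v) = merging s0 m k s"
  unfolding merging_def by (elim insertE) (simp_all add: put_other)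

lemma merging_body:
  assumes I: "merging s0 m k s" and a: "nmem s ''a'' 0 0 = m" "nmem s ''b'' 0 0 = k" and m: "m \<in> V" "k \<in> V"
    and sym: "\<And>x y. \<lbrakk>x \<in> V; y \<in> V; x \<noteq> y\<rbrakk> \<Longrightarrow> nmem s0 ''L1'' x y = nmem s0 ''L1'' y x \<and> nmem s0 ''L2'' x y = nmem s0 ''L2'' y x"
  shows "runs merge_body s (cost \<tau> merge_body) (\<lambda>s'. nmem s' ''a'' 0 0 = m \<and> nmem s' ''b'' 0 0 = k \<and> merging s0 m (Suc k) s')"
proof (rule wp_runs)
  note I' = I[unfolded merging_def Let_def]
  have S: "nmem s ''v1'' = nmem s0 ''v1''" "nmem s ''v2'' = nmem s0 ''v2''" "nmem s ''u1'' = nmem s0 ''u1''"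
    "nmem s ''u2'' = nmem s0 ''u2''" "nmem s ''f'' = nmem s0 ''f''" using I' by auto
  show "wp merge_body (\<lambda>s'. nmem s' ''a'' 0 0 = m \<and> nmem s' ''b'' 0 0 = k \<and> merging s0 m (Suc k) s') s"
  proof (cases "m < k \<and> nmem s0 ''L1'' m k = nmem s0 ''v1'' 0 0 \<and> nmem s0 ''L2'' m k = nmem s0 ''v2'' 0 0")
    case mk: True
    have np: "\<not> pass m k m k" "\<not> pass m k k m" using mk by (auto simp: pass_def)
    have L: "nmem s ''L1'' m k = nmem s0 ''L1'' m k" "nmem s ''L2'' m k = nmem s0 ''L2'' m k"
      "nmem s ''L1'' k m = nmem s0 ''L1'' k m" "nmem s ''L2'' k m = nmem s0 ''L2'' k m"
      "fmem s ''R'' m k = fmem s0 ''R'' m k" "fmem s ''R'' k m = fmem s0 ''R'' k m" using I' np by auto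
    have p: "pass m (Suc k) x y \<longleftrightarrow> pass m k x y \<or> ((x = m \<and> y = k) \<or> (x = k \<and> y = m))" for x y
      using pass_step[of m k x y] m mk by auto
    have "nmem s0 ''L1'' k m = nmem s0 ''v1'' 0 0" "nmem s0 ''L2'' k m = nmem s0 ''v2'' 0 0"
      using sym[of k m] mk m by auto
    note km = this
    define P where "P = (\<lambda>x y. (x = m \<and> y = k) \<or> (x = k \<and> y = m))"
    have fin: "merging s0 m (Suc k) s'"
      if n: "\<And>x y. nmem s' ''L1'' x y = (if P x y then nmem s0 ''u1'' 0 0 else nmem s ''L1'' x y)"
        "\<And>x y. nmem s' ''L2'' x y = (if P x y then nmem s0 ''u2'' 0 0 else nmem s ''L2'' x y)"
        "\<And>x y. fmem s' ''R'' x y = (if P x y \<and> nmem s0 ''f'' 0 0 \<noteq> 0 then fmem s ''R'' y x else fmem s ''R'' x y)"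
        "fmem s' ''p'' = fmem s ''p''"
        "\<forall>X\<in>{''n'', ''i'', ''j'', ''k'', ''l'', ''f'', ''u1'', ''u2'', ''v1'', ''v2''}. nmem s' X = nmem s X" for s'
      unfolding merging_def Let_def
    proof (intro conjI allI)
      fix x y
      have lo: "(pass m (Suc k) x y \<and> nmem s0 ''L1'' x y = nmem s0 ''v1'' 0 0 \<and> nmem s0 ''L2'' x y = nmem s0 ''v2'' 0 0) =
        (P x y \<or> (pass m k x y \<and> nmem s0 ''L1'' x y = nmem s0 ''v1'' 0 0 \<and> nmem s0 ''L2'' x y = nmem s0 ''v2'' 0 0))"
        using p[of x y] km mk by (auto simp: P_def)
      have PL: "P x y \<Longrightarrow> fmem s ''R'' y x = fmem s0 ''R'' y x" "P x y \<Longrightarrow> fmem s ''R'' x y = fmem s0 ''R'' x y"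
        using L by (auto simp: P_def)
      have IL: "nmem s ''L1'' x y = (if pass m k x y \<and> nmem s0 ''L1'' x y = nmem s0 ''v1'' 0 0 \<and> nmem s0 ''L2'' x y = nmem s0 ''v2'' 0 0 then nmem s0 ''u1'' 0 0 else nmem s0 ''L1'' x y)"
        "nmem s ''L2'' x y = (if pass m k x y \<and> nmem s0 ''L1'' x y = nmem s0 ''v1'' 0 0 \<and> nmem s0 ''L2'' x y = nmem s0 ''v2'' 0 0 then nmem s0 ''u2'' 0 0 else nmem s0 ''L2'' x y)"
        "fmem s ''R'' x y = (if (pass m k x y \<and> nmem s0 ''L1'' x y = nmem s0 ''v1'' 0 0 \<and> nmem s0 ''L2'' x y = nmem s0 ''v2'' 0 0) \<and> nmem s0 ''f'' 0 0 \<noteq> 0 then fmem s0 ''R'' y x else fmem s0 ''R'' x y)"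
        using I' by blast+
      show "nmem s' ''L1'' x y = (if pass m (Suc k) x y \<and> nmem s0 ''L1'' x y = nmem s0 ''v1'' 0 0 \<and> nmem s0 ''L2'' x y = nmem s0 ''v2'' 0 0
          then nmem s0 ''u1'' 0 0 else nmem s0 ''L1'' x y)"
        unfolding lo n(1) IL(1) by auto
      show "nmem s' ''L2'' x y = (if pass m (Suc k) x y \<and> nmem s0 ''L1'' x y = nmem s0 ''v1'' 0 0 \<and> nmem s0 ''L2'' x y = nmem s0 ''v2'' 0 0
          then nmem s0 ''u2'' 0 0 else nmem s0 ''L2'' x y)"
        unfolding lo n(2) IL(2) by auto
      show "fmem s' ''R'' x y = (if (pass m (Suc k) x y \<and> nmem s0 ''L1'' x y = nmem s0 ''v1'' 0 0 \<and> nmem s0 ''L2'' x y = nmem s0 ''v2'' 0 0)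
          \<and> nmem s0 ''f'' 0 0 \<noteq> 0 then fmem s0 ''R'' y x else fmem s0 ''R'' x y)"
        unfolding lo n(3) using PL IL(3) by (cases "P x y") auto
      show "fmem s' ''p'' = fmem s0 ''p''" using n(4) I' by simp
      show "\<forall>X\<in>{''n'', ''i'', ''j'', ''k'', ''l'', ''f'', ''u1'', ''u2'', ''v1'', ''v2''}. nmem s' X = nmem s0 X"
        using n(5) I' by simp
    qed
    have test: "m < k" "nmem s ''L1'' m k = nmem s ''v1'' 0 0" "nmem s ''L2'' m k = nmem s ''v2'' 0 0"
      using mk L S by auto
    show ?thesis
      unfolding merge_body_def
      by (simp add: a test upd_apply upd_other) (intro conjI impI fin; use mk S in \<open>auto simp: upd_apply upd_other P_def\<close>)
  next
    case nmk: False
    have "\<not> (m < k \<and> nmem s ''L1'' m k = nmem s ''v1'' 0 0 \<and> nmem s ''L2'' m k = nmem s ''v2'' 0 0)"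
    proof
      assume h: "m < k \<and> nmem s ''L1'' m k = nmem s ''v1'' 0 0 \<and> nmem s ''L2'' m k = nmem s ''v2'' 0 0"
      hence "\<not> pass m k m k" by (auto simp: pass_def)
      thus False using h nmk I' S by auto
    qed
    moreover have "merging s0 m (Suc k) s"
    proof -
      have "(pass m (Suc k) x y \<and> nmem s0 ''L1'' x y = nmem s0 ''v1'' 0 0 \<and> nmem s0 ''L2'' x y = nmem s0 ''v2'' 0 0) =
        (pass m k x y \<and> nmem s0 ''L1'' x y = nmem s0 ''v1'' 0 0 \<and> nmem s0 ''L2'' x y = nmem s0 ''v2'' 0 0)" for x y
        using pass_step[of m k x y] nmk sym[of k m] by auto
      thus ?thesis using I unfolding merging_def by simp
    qed
    ultimately show ?thesis using a unfolding merge_body_def by auto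
  qed
qed

lemma merging_loop:
  assumes n1: "nmem s0 ''n'' 0 0 = n"
    and sym: "\<And>x y. \<lbrakk>x \<in> V; y \<in> V; x \<noteq> y\<rbrakk> \<Longrightarrow> nmem s0 ''L1'' x y = nmem s0 ''L1'' y x \<and> nmem s0 ''L2'' x y = nmem s0 ''L2'' y x"
  shows "runs (for_loop ''a'' 1 (for_loop ''b'' 1 merge_body)) s0 (for_time n (for_time n (cost \<tau> merge_body)))
    (merging s0 n 1)"
proof (rule runs_for[where I = "\<lambda>m. merging s0 m 1"])
  show "1 \<le> n" using n by simp
  have sz: "nmem s ''n'' 0 0 = n" if "merging s0 m k s" for m k s
    using that n1 by (simp add: merging_def)
  show "nmem s ''n'' 0 0 = n" if "merging s0 m 1 s" for m s using sz[OF that] .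
  have "merging s0 1 1 s0" by (auto simp: merging_def pass_start)
  thus "merging s0 1 1 (put s0 ''a'' 1)" by (simp add: merging_put)
  fix m s assume m: "1 \<le> m" "m < n" "merging s0 m 1 s" "nmem s ''a'' 0 0 = m"
  have mV: "m \<in> V" using m by (simp add: V_def)
  have "runs (for_loop ''b'' 1 merge_body) s (for_time n (cost \<tau> merge_body))
      (\<lambda>s'. nmem s' ''a'' 0 0 = m \<and> merging s0 m n s')"
  proof (rule runs_for[where I = "\<lambda>k s'. nmem s' ''a'' 0 0 = m \<and> merging s0 m k s'"])
    show "1 \<le> n" using n by simp
    show "nmem s ''n'' 0 0 = n" if "nmem s ''a'' 0 0 = m \<and> merging s0 m k s" for k s using sz that by blast
    show "nmem (put s ''b'' 1) ''a'' 0 0 = m \<and> merging s0 m 1 (put s ''b'' 1)"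
      using m by (simp add: merging_put)
    fix k s' assume k: "1 \<le> k" "k < n" "nmem s' ''a'' 0 0 = m \<and> merging s0 m k s'" "nmem s' ''b'' 0 0 = k"
    have "k \<in> V" using k by (simp add: V_def)
    from merging_body[OF conjunct2[OF k(3)] conjunct1[OF k(3)] k(4) mV this sym]
    show "runs merge_body s' (cost \<tau> merge_body) (\<lambda>s'. nmem s' ''b'' 0 0 = k \<and>
        nmem (put s' ''b'' (Suc k)) ''a'' 0 0 = m \<and> merging s0 m (Suc k) (put s' ''b'' (Suc k)))"
      by (rule runs_mono) (auto simp: merging_put)
  qed
  thus "runs (for_loop ''b'' 1 merge_body) s (for_time n (cost \<tau> merge_body))
      (\<lambda>s'. nmem s' ''a'' 0 0 = m \<and> merging s0 (Suc m) 1 (put s' ''a'' (Suc m)))"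
    by (rule runs_mono) (auto simp: merging_put merging_def pass_row)
qed

definition eq_vars :: "'a state \<Rightarrow> 'a state \<Rightarrow> bool" where
  "eq_vars s s' \<longleftrightarrow> (\<forall>X\<in>{''i'', ''j'', ''k'', ''l''}. nmem s' X = nmem s X)"

lemma merging_correct:
  assumes v: "valid_state s" and V: "x1 \<in> V" "y1 \<in> V" "x2 \<in> V" "y2 \<in> V" and ee: "E x1 y1" "E x2 y2"
    and conn: "((x1, y1), (x2, y2)) \<in> (links V M)\<^sup>*"
    and le: "nmem s ''L1'' x1 y1 \<le> nmem s ''L1'' x2 y2" and ne: "\<not> same_label s x1 y1 x2 y2"
    and flag: "nmem s ''f'' 0 0 \<noteq> 0 \<longleftrightarrow> (fmem s ''R'' x1 y1 = M x1 y1) \<noteq> (fmem s ''R'' x2 y2 = M x2 y2)"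
    and s0: "fmem s0 = fmem s" "\<And>X. X \<notin> {''u1'', ''u2'', ''v1'', ''v2''} \<Longrightarrow> nmem s0 X = nmem s X"
      "nmem s0 ''u1'' 0 0 = nmem s ''L1'' x1 y1" "nmem s0 ''u2'' 0 0 = nmem s ''L2'' x1 y1"
      "nmem s0 ''v1'' 0 0 = nmem s ''L1'' x2 y2" "nmem s0 ''v2'' 0 0 = nmem s ''L2'' x2 y2"
    and m: "merging s0 n 1 s'"
  shows "valid_state s' \<and> coarser s s' \<and> eq_vars s s' \<and> same_label s' x1 y1 x2 y2"
proof -
  have con: "consistent (fmem s ''R'') (nmem s ''L1'') (nmem s ''L2'')" and b: "base s"
    using v by (auto simp: valid_state_def)
  note s0' = s0(1) s0(2)[of "''L1''", simplified] s0(2)[of "''L2''", simplified] s0(2)[of "''f''", simplified]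
  have val: "nmem s' ''L1'' x y = (if pass n 1 x y \<and> nmem s ''L1'' x y = nmem s ''L1'' x2 y2 \<and> nmem s ''L2'' x y = nmem s ''L2'' x2 y2
        then nmem s ''L1'' x1 y1 else nmem s ''L1'' x y)"
      "nmem s' ''L2'' x y = (if pass n 1 x y \<and> nmem s ''L1'' x y = nmem s ''L1'' x2 y2 \<and> nmem s ''L2'' x y = nmem s ''L2'' x2 y2
        then nmem s ''L2'' x1 y1 else nmem s ''L2'' x y)"
      "fmem s' ''R'' x y = (if pass n 1 x y \<and> nmem s ''L1'' x y = nmem s ''L1'' x2 y2 \<and> nmem s ''L2'' x y = nmem s ''L2'' x2 y2 \<and> nmem s ''f'' 0 0 \<noteq> 0
        then fmem s ''R'' y x else fmem s ''R'' x y)" for x y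
    using m unfolding merging_def Let_def s0' s0(3-6) by auto
  have p: "pass n 1 x y \<longleftrightarrow> x \<in> V \<and> y \<in> V \<and> x \<noteq> y" for x y using pass_end by simp
  have "consistent (fmem s' ''R'') (nmem s' ''L1'') (nmem s' ''L2'')"
    by (rule consistent_merge[OF con V ee conn le _ flag]) (use ne val pass_end in \<open>auto simp: same_label_def\<close>)
  moreover have "base s'"
    using b m s0 val(3) unfolding base_def by (auto simp: merging_def pass_end V_def)
  moreover have "coarser s s'"
    unfolding coarser_def same_label_def by (intro ballI impI) (auto simp: val(1,2) pass_end)
  moreover have "eq_vars s s'"
    using m s0(2) by (auto simp: eq_vars_def merging_def)
  moreover have "same_label s' x1 y1 x2 y2"
    using V E_neq[OF ee(1)] E_neq[OF ee(2)] by (auto simp: same_label_def val(1,2) pass_end)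
  ultimately show ?thesis by (simp add: valid_state_def)
qed

lemma merge_runs:
  assumes v: "valid_state s" and V: "neval s X1 \<in> V" "neval s Y1 \<in> V" "neval s X2 \<in> V" "neval s Y2 \<in> V"
    and ee: "E (neval s X1) (neval s Y1)" "E (neval s X2) (neval s Y2)"
    and conn: "((neval s X1, neval s Y1), (neval s X2, neval s Y2)) \<in> (links V M)\<^sup>*"
    and flag: "nmem s ''f'' 0 0 \<noteq> 0 \<longleftrightarrow> (fmem s ''R'' (neval s X1) (neval s Y1) = M (neval s X1) (neval s Y1)) \<noteq>
      (fmem s ''R'' (neval s X2) (neval s Y2) = M (neval s X2) (neval s Y2))"
    and vars: "X1 \<in> sv ` {''i'', ''j'', ''k'', ''l''}" "Y1 \<in> sv ` {''i'', ''j'', ''k'', ''l''}"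
      "X2 \<in> sv ` {''i'', ''j'', ''k'', ''l''}" "Y2 \<in> sv ` {''i'', ''j'', ''k'', ''l''}"
  shows "runs (merge X1 Y1 X2 Y2) s (merge_time X1 Y1 X2 Y2 n \<tau>)
    (\<lambda>s'. valid_state s' \<and> coarser s s' \<and> eq_vars s s' \<and> same_label s' (neval s X1) (neval s Y1) (neval s X2) (neval s Y2))"
    (is "runs _ _ _ ?Q")
  unfolding merge_def merge_time_def
proof (rule runs_Cond)
  assume "beval rt as s (ball [BNot (neq (NRead ''L1'' X1 Y1) (NRead ''L1'' X2 Y2)), BNot (neq (NRead ''L2'' X1 Y1) (NRead ''L2'' X2 Y2))])"
  hence "?Q s" using v by (simp add: same_label_def coarser_def eq_vars_def)
  thus "runs Skip s 1 ?Q" using wp_runs[of Skip ?Q s] by simp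
next
  assume "\<not> beval rt as s (ball [BNot (neq (NRead ''L1'' X1 Y1) (NRead ''L1'' X2 Y2)), BNot (neq (NRead ''L2'' X1 Y1) (NRead ''L2'' X2 Y2))])"
  hence ne: "\<not> same_label s (neval s X1) (neval s Y1) (neval s X2) (neval s Y2)" by (simp add: same_label_def)
  define x1 y1 x2 y2 where "x1 = neval s X1" "y1 = neval s Y1" "x2 = neval s X2" "y2 = neval s Y2"
  note xy = x1_y1_x2_y2_def[symmetric]
  define P where "P = (\<lambda>s0 :: 'a state. fmem s0 = fmem s \<and> (\<forall>X. X \<notin> {''u1'', ''u2'', ''v1'', ''v2''} \<longrightarrow> nmem s0 X = nmem s X) \<and>
    (if nmem s ''L1'' x2 y2 < nmem s ''L1'' x1 y1
     then nmem s0 ''u1'' 0 0 = nmem s ''L1'' x2 y2 \<and> nmem s0 ''u2'' 0 0 = nmem s ''L2'' x2 y2 \<and>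
          nmem s0 ''v1'' 0 0 = nmem s ''L1'' x1 y1 \<and> nmem s0 ''v2'' 0 0 = nmem s ''L2'' x1 y1
     else nmem s0 ''u1'' 0 0 = nmem s ''L1'' x1 y1 \<and> nmem s0 ''u2'' 0 0 = nmem s ''L2'' x1 y1 \<and>
          nmem s0 ''v1'' 0 0 = nmem s ''L1'' x2 y2 \<and> nmem s0 ''v2'' 0 0 = nmem s ''L2'' x2 y2))"
  have "wp (merge_start X1 Y1 X2 Y2) P s"
  proof -
    have nm: "\<exists>N. X = sv N \<and> N \<noteq> ''u1'' \<and> N \<noteq> ''u2'' \<and> N \<noteq> ''v1'' \<and> N \<noteq> ''v2''"
      if "X \<in> sv ` {''i'', ''j'', ''k'', ''l''}" for X using that by auto
    obtain N1 N2 N3 N4 where N: "X1 = sv N1" "Y1 = sv N2" "X2 = sv N3" "Y2 = sv N4"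
      and ne: "N1 \<noteq> ''u1''" "N1 \<noteq> ''u2''" "N1 \<noteq> ''v1''" "N1 \<noteq> ''v2''"
        "N2 \<noteq> ''u1''" "N2 \<noteq> ''u2''" "N2 \<noteq> ''v1''" "N2 \<noteq> ''v2''"
        "N3 \<noteq> ''u1''" "N3 \<noteq> ''u2''" "N3 \<noteq> ''v1''" "N3 \<noteq> ''v2''"
        "N4 \<noteq> ''u1''" "N4 \<noteq> ''u2''" "N4 \<noteq> ''v1''" "N4 \<noteq> ''v2''"
      using nm[OF vars(1)] nm[OF vars(2)] nm[OF vars(3)] nm[OF vars(4)] by blast
    show ?thesis
      unfolding merge_start_def P_def x1_y1_x2_y2_def N by (simp add: upd_apply upd_other ne)
  qed
  hence start: "runs (merge_start X1 Y1 X2 Y2) s (cost \<tau> (merge_start X1 Y1 X2 Y2)) P" by (rule wp_runs)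
  have loop: "runs (for_loop ''a'' 1 (for_loop ''b'' 1 merge_body)) s0 (for_time n (for_time n (cost \<tau> merge_body))) ?Q"
    if P: "P s0" for s0
  proof (rule runs_mono[OF merging_loop])
    have con: "consistent (fmem s ''R'') (nmem s ''L1'') (nmem s ''L2'')" and b: "base s"
      using v by (auto simp: valid_state_def)
    have eqs: "nmem s0 ''n'' = nmem s ''n''" "nmem s0 ''L1'' = nmem s ''L1''" "nmem s0 ''L2'' = nmem s ''L2''"
      using P by (auto simp: P_def)
    show "nmem s0 ''n'' 0 0 = n" using b eqs by (simp add: base_def)
    show "nmem s0 ''L1'' x y = nmem s0 ''L1'' y x \<and> nmem s0 ''L2'' x y = nmem s0 ''L2'' y x"
      if "x \<in> V" "y \<in> V" "x \<noteq> y" for x y using con_sym[OF con that] eqs by simp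
    fix s' assume m: "merging s0 n 1 s'"
    have fs: "fmem s0 = fmem s" "\<And>X. X \<notin> {''u1'', ''u2'', ''v1'', ''v2''} \<Longrightarrow> nmem s0 X = nmem s X"
      using P by (auto simp: P_def)
    show "?Q s'"
    proof (cases "nmem s ''L1'' x2 y2 < nmem s ''L1'' x1 y1")
      case False
      thus ?thesis
        using merging_correct[OF v V ee conn _ ne flag fs _ _ _ _ m] P unfolding P_def xy by simp
    next
      case True
      have ne': "\<not> same_label s (neval s X2) (neval s Y2) (neval s X1) (neval s Y1)"
        using ne by (auto simp: same_label_def)
      have flag': "nmem s ''f'' 0 0 \<noteq> 0 \<longleftrightarrow> (fmem s ''R'' (neval s X2) (neval s Y2) = M (neval s X2) (neval s Y2)) \<noteq>
        (fmem s ''R'' (neval s X1) (neval s Y1) = M (neval s X1) (neval s Y1))" using flag by blast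
      have "valid_state s' \<and> coarser s s' \<and> eq_vars s s' \<and> same_label s' (neval s X2) (neval s Y2) (neval s X1) (neval s Y1)"
        using merging_correct[OF v V(3,4,1,2) ee(2,1) links_rtrancl_sym[OF conn] _ ne' flag' fs _ _ _ _ m] P True
        unfolding P_def xy by simp
      thus ?thesis by (simp add: same_label_def)
    qed
  qed simp
  show "runs (Seq (merge_start X1 Y1 X2 Y2) (for_loop ''a'' 1 (for_loop ''b'' 1 merge_body))) s
     (1 + cost \<tau> (merge_start X1 Y1 X2 Y2) + for_time n (for_time n (cost \<tau> merge_body))) ?Q"
    by (rule runs_Seq[OF runs_mono[OF start le_refl loop]])
qed

end

abbreviation fadd (infixl "[+]" 65) where "a [+] b \<equiv> FAdd a b"
abbreviation fsub (infixl "[-]" 65) where "a [-] b \<equiv> FSub a b"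
abbreviation fmul (infixl "[*]" 70) where "a [*] b \<equiv> FMul a b"
abbreviation fdiv (infixl "['/]" 70) where "a [/] b \<equiv> FDiv a b"

definition link_step :: "bexp \<Rightarrow> com \<Rightarrow> bexp \<Rightarrow> bexp \<Rightarrow> nexp \<Rightarrow> nexp \<Rightarrow> nexp \<Rightarrow> nexp \<Rightarrow> com" where
  "link_step guard query none same X1 Y1 X2 Y2 = Cond guard (Seq query (Cond none Skip
     (Seq (Cond same (nset ''f'' n0) (nset ''f'' (NConst 1))) (merge X1 Y1 X2 Y2)))) Skip"

definition link_time :: "bexp \<Rightarrow> com \<Rightarrow> bexp \<Rightarrow> bexp \<Rightarrow> nexp \<Rightarrow> nexp \<Rightarrow> nexp \<Rightarrow> nexp \<Rightarrow> nat \<Rightarrow> nat \<Rightarrow> nat" where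
  "link_time guard query none same X1 Y1 X2 Y2 n \<tau> = 1 + bcost \<tau> guard + (1 + cost \<tau> query + (1 + bcost \<tau> none + 1 +
     (1 + cost \<tau> (Cond same (nset ''f'' n0) (nset ''f'' (NConst 1))) + merge_time X1 Y1 X2 Y2 n \<tau>))) + 1"

definition cyc_test :: "fexp \<Rightarrow> fexp \<Rightarrow> fexp \<Rightarrow> fexp \<Rightarrow> fexp \<Rightarrow> fexp \<Rightarrow> bexp" where
  "cyc_test a a' b b' c c' = BAnd (FEq (a [*] b [*] c [+] a' [*] b' [*] c') (fv ''g''))
     (FEq (a [*] b [+] b [*] c [+] c [*] a [+] (a' [*] b' [+] b' [*] c' [+] c' [*] a')) (fv ''h''))"

lemma beval_cyc_test [simp]: "beval rt as s (cyc_test a a' b b' c c') \<longleftrightarrow>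
    cycs (feval rt as s a) (feval rt as s a') (feval rt as s b) (feval rt as s b') (feval rt as s c) (feval rt as s c')
      = (fmem s ''g'' 0 0, fmem s ''h'' 0 0)"
  by (simp add: cyc_test_def cycs_def cyc3_def cyc4_def)

definition triple_guard :: bexp where
  "triple_guard = ball [neq vi vj, neq vi vk, neq vj vk, fneq (rr vi vj) (rr vj vi), fneq (rr vi vk) (rr vk vi)]"

text \<open>The array \<open>p\<close> holds the scaling factors of the rows; the oracle is asked about \<open>A\<close>, so its
  answers are divided by them.  \<open>g\<close> and \<open>h\<close> receive the parts of the minors \<open>{i, j, k}\<close> and
  \<open>{0, i, j, k}\<close> of the normalised matrix that depend on the orientations.\<close>

definition triple_query :: com where
  "triple_query = block [
     Query ''t'' n0 n0 vi vj vk vk, fset ''t'' (fv ''t'' [/] (pe vi [*] pe vj [*] pe vk)),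
     Query ''u'' n0 n0 n0 vi vj vk, fset ''u'' (fv ''u'' [/] (pe vi [*] pe vj [*] pe vk)),
     fset ''g'' (fv ''t'' [-] rr vi vi [*] rr vj vj [*] rr vk vk [+] rr vi vi [*] (rr vj vk [*] rr vk vj)
       [+] rr vj vj [*] (rr vk vi [*] rr vi vk) [+] rr vk vk [*] (rr vi vj [*] rr vj vi)),
     fset ''h'' (rr n0 n0 [*] fv ''t'' [-] (rr vi vi [*] rr vj vj [+] rr vj vj [*] rr vk vk [+] rr vi vi [*] rr vk vk
       [-] rr vi vj [*] rr vj vi [-] rr vj vk [*] rr vk vj [-] rr vk vi [*] rr vi vk)
       [+] rr vk vk [*] (rr vi vj [+] rr vj vi) [+] rr vi vi [*] (rr vj vk [+] rr vk vj)
       [+] rr vj vj [*] (rr vk vi [+] rr vi vk) [-] fv ''u'')]"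

definition triple_same :: bexp where
  "triple_same = bor (cyc_test (rr vi vj) (rr vj vi) (rr vj vk) (rr vk vj) (rr vk vi) (rr vi vk))
     (cyc_test (rr vi vj) (rr vj vi) (rr vk vj) (rr vj vk) (rr vk vi) (rr vi vk))"
definition triple_opp :: bexp where
  "triple_opp = bor (cyc_test (rr vj vi) (rr vi vj) (rr vj vk) (rr vk vj) (rr vk vi) (rr vi vk))
     (cyc_test (rr vi vj) (rr vj vi) (rr vj vk) (rr vk vj) (rr vi vk) (rr vk vi))"

definition triple_step :: com where
  "triple_step = link_step triple_guard triple_query (BAnd triple_same triple_opp) triple_same vi vj vi vk"
definition triple_time :: "nat \<Rightarrow> nat \<Rightarrow> nat" where
  "triple_time = link_time triple_guard triple_query (BAnd triple_same triple_opp) triple_same vi vj vi vk"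

definition det3_exp :: "nexp \<Rightarrow> nexp \<Rightarrow> nexp \<Rightarrow> nexp \<Rightarrow> nexp \<Rightarrow> nexp \<Rightarrow> fexp" where
  "det3_exp a b c x y z = rr a x [*] (rr b y [*] rr c z [-] rr b z [*] rr c y)
     [-] rr a y [*] (rr b x [*] rr c z [-] rr b z [*] rr c x) [+] rr a z [*] (rr b x [*] rr c y [-] rr b y [*] rr c x)"

definition quad_guard :: bexp where
  "quad_guard = ball [neq vi vj, neq vi vk, neq vi vl, neq vj vk, neq vj vl, neq vk vl,
     fneq (rr vi vj) (rr vj vi), fneq (rr vk vl) (rr vl vk), FEq (rr vi vk) (rr vk vi), FEq (rr vi vl) (rr vl vi),
     FEq (rr vj vk) (rr vk vj), FEq (rr vj vl) (rr vl vj), fneq (rr vj vk [*] rr vi vl) (rr vj vl [*] rr vi vk)]"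

definition quad_query :: com where
  "quad_query = block [Query ''t'' n0 n0 vi vj vk vl,
     fset ''t'' (fv ''t'' [/] (pe vi [*] pe vj [*] pe vk [*] pe vl))]"

definition quad_same :: bexp where
  "quad_same = FEq (rr vi vi [*] det3_exp vj vk vl vj vk vl [-] rr vi vj [*] det3_exp vj vk vl vi vk vl
     [+] rr vi vk [*] det3_exp vj vk vl vi vj vl [-] rr vi vl [*] det3_exp vj vk vl vi vj vk) (fv ''t'')"

definition quad_step :: com where
  "quad_step = link_step quad_guard quad_query (NLess n0 n0) quad_same vi vj vk vl"
definition quad_time :: "nat \<Rightarrow> nat \<Rightarrow> nat" where
  "quad_time = link_time quad_guard quad_query (NLess n0 n0) quad_same vi vj vk vl"

lemma (in machine) wp_mono: "wp c Q s \<Longrightarrow> (\<And>s'. Q s' \<Longrightarrow> Q' s') \<Longrightarrow> wp c Q' s"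
proof (induction c arbitrary: Q Q' s)
  case (Seq c1 c2)
  show ?case using Seq.IH(1)[of "wp c2 Q" s "wp c2 Q'"] Seq.IH(2)[OF _ Seq.prems(2)] Seq.prems(1) by simp
next
  case (Cond b c1 c2)
  show ?case using Cond.IH(1)[OF _ Cond.prems(2)] Cond.IH(2)[OF _ Cond.prems(2)] Cond.prems(1) by (simp split: if_splits)
qed simp_all

context run
begin

lemma orc_pdet:
  assumes "distinct xs" "xs \<noteq> []" "length xs \<le> 4" "set xs \<subseteq> {..<n}"
  shows "orc (set xs) = (\<Prod>x\<leftarrow>xs. pp x) * pdet M xs"
proof -
  have "orc (set xs) = principal_minor A (set xs)"
    using minors assms by (simp add: minor_oracle_def distinct_card)
  thus ?thesis using principal_minor_pdet[OF A assms(4,1) refl] pdet_A[OF assms(4)] by simp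
qed

definition agree :: "'a state \<Rightarrow> 'a state \<Rightarrow> bool" where
  "agree s s' \<longleftrightarrow> (\<forall>X\<in>{''n'', ''i'', ''j'', ''k'', ''l'', ''L1'', ''L2''}. nmem s' X = nmem s X) \<and>
     fmem s' ''R'' = fmem s ''R'' \<and> fmem s' ''p'' = fmem s ''p''"

lemma valid_state_cong:
  assumes "nmem s' ''n'' = nmem s ''n''" "nmem s' ''L1'' = nmem s ''L1''" "nmem s' ''L2'' = nmem s ''L2''"
    "fmem s' ''R'' = fmem s ''R''" "fmem s' ''p'' = fmem s ''p''"
  shows "valid_state s' = valid_state s"
  using assms by (simp add: valid_state_def base_def)

lemma agree_valid: "agree s s' \<Longrightarrow> valid_state s' = valid_state s"
  by (rule valid_state_cong) (auto simp: agree_def)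

lemma agree_coarser: "agree s s' \<Longrightarrow> coarser s' s'' = coarser s s''"
  by (simp add: agree_def coarser_def same_label_def)

lemma agree_eq_vars: "agree s s' \<Longrightarrow> eq_vars s' s'' = eq_vars s s''"
  by (simp add: agree_def eq_vars_def)

lemma coarser_refl: "coarser s s" by (simp add: coarser_def)
lemma coarser_trans: "coarser s s' \<Longrightarrow> coarser s' s'' \<Longrightarrow> coarser s s''"
  unfolding coarser_def by blast

lemma link_step_runs:
  fixes X1 Y1 X2 Y2 s
  defines "x1 \<equiv> neval s X1" and "y1 \<equiv> neval s Y1" and "x2 \<equiv> neval s X2" and "y2 \<equiv> neval s Y2"
  assumes v: "valid_state s"
    and guard: "\<not> beval rt as s guard \<Longrightarrow> \<not> linked"
    and query: "beval rt as s guard \<Longrightarrow> wp query (\<lambda>s1. agree s s1 \<and> (beval rt as s1 none \<longleftrightarrow> \<not> linked) \<and>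
      (linked \<longrightarrow> (beval rt as s1 same \<longleftrightarrow> (fmem s ''R'' x1 y1 = M x1 y1) = (fmem s ''R'' x2 y2 = M x2 y2)))) s"
    and linked: "linked \<Longrightarrow> x1 \<in> V \<and> y1 \<in> V \<and> x2 \<in> V \<and> y2 \<in> V \<and> E x1 y1 \<and> E x2 y2 \<and> ((x1, y1), (x2, y2)) \<in> links V M"
    and vars: "X1 \<in> sv ` {''i'', ''j'', ''k'', ''l''}" "Y1 \<in> sv ` {''i'', ''j'', ''k'', ''l''}"
      "X2 \<in> sv ` {''i'', ''j'', ''k'', ''l''}" "Y2 \<in> sv ` {''i'', ''j'', ''k'', ''l''}"
  shows "runs (link_step guard query none same X1 Y1 X2 Y2) s (link_time guard query none same X1 Y1 X2 Y2 n \<tau>)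
    (\<lambda>s'. valid_state s' \<and> coarser s s' \<and> eq_vars s s' \<and> (linked \<longrightarrow> same_label s' x1 y1 x2 y2))"
    (is "runs _ _ _ ?Q")
  unfolding link_step_def link_time_def
proof (rule runs_Cond)
  assume "\<not> beval rt as s guard"
  hence "?Q s" using v guard by (simp add: coarser_refl eq_vars_def)
  thus "runs Skip s 1 ?Q" using wp_runs[of Skip ?Q s] by simp
next
  assume g: "beval rt as s guard"
  show "runs (Seq query (Cond none Skip (Seq (Cond same (nset ''f'' n0) (nset ''f'' (NConst 1))) (merge X1 Y1 X2 Y2)))) s
     (1 + cost \<tau> query + (1 + bcost \<tau> none + 1 + (1 + cost \<tau> (Cond same (nset ''f'' n0) (nset ''f'' (NConst 1))) + merge_time X1 Y1 X2 Y2 n \<tau>))) ?Q"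
  proof (rule runs_Seq[OF runs_mono[OF wp_runs[OF query[OF g]] le_refl]])
    fix s1
    assume s1: "agree s s1 \<and> (beval rt as s1 none \<longleftrightarrow> \<not> linked) \<and>
      (linked \<longrightarrow> (beval rt as s1 same \<longleftrightarrow> (fmem s ''R'' x1 y1 = M x1 y1) = (fmem s ''R'' x2 y2 = M x2 y2)))"
    show "runs (Cond none Skip (Seq (Cond same (nset ''f'' n0) (nset ''f'' (NConst 1))) (merge X1 Y1 X2 Y2))) s1
      (1 + bcost \<tau> none + 1 + (1 + cost \<tau> (Cond same (nset ''f'' n0) (nset ''f'' (NConst 1))) + merge_time X1 Y1 X2 Y2 n \<tau>)) ?Q"
    proof (rule runs_Cond)
      assume "beval rt as s1 none"
      hence "?Q s1" using s1 v agree_valid[of s s1] agree_coarser[of s s1 s1] agree_eq_vars[of s s1 s1]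
        by (simp add: coarser_refl eq_vars_def)
      thus "runs Skip s1 1 ?Q" using wp_runs[of Skip ?Q s1] by simp
    next
      assume "\<not> beval rt as s1 none"
      hence l: linked using s1 by blast
      define P where "P = (\<lambda>s2. agree s s2 \<and>
        (nmem s2 ''f'' 0 0 \<noteq> 0 \<longleftrightarrow> (fmem s ''R'' x1 y1 = M x1 y1) \<noteq> (fmem s ''R'' x2 y2 = M x2 y2)))"
      have "wp (Cond same (nset ''f'' n0) (nset ''f'' (NConst 1))) P s1"
        using s1 l by (auto simp: P_def agree_def upd_other upd_apply)
      note flag = wp_runs[OF this]
      have "runs (merge X1 Y1 X2 Y2) s2 (merge_time X1 Y1 X2 Y2 n \<tau>) ?Q" if s2: "P s2" for s2
      proof -
        have ag: "agree s s2" using s2 by (simp add: P_def)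
        have nv: "neval s2 X = neval s X" if "X \<in> sv ` {''i'', ''j'', ''k'', ''l''}" for X
          using that ag by (auto simp: agree_def)
        have R: "fmem s2 ''R'' = fmem s ''R''" using ag by (simp add: agree_def)
        have e: "neval s2 X1 = x1" "neval s2 Y1 = y1" "neval s2 X2 = x2" "neval s2 Y2 = y2"
          using nv vars by (auto simp: x1_def y1_def x2_def y2_def)
        have "runs (merge X1 Y1 X2 Y2) s2 (merge_time X1 Y1 X2 Y2 n \<tau>) (\<lambda>s'. valid_state s' \<and> coarser s2 s' \<and>
            eq_vars s2 s' \<and> same_label s' (neval s2 X1) (neval s2 Y1) (neval s2 X2) (neval s2 Y2))"
        proof (rule merge_runs[OF _ _ _ _ _ _ _ _ _ vars])
          show "valid_state s2" using v agree_valid[OF ag] by simp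
          show "nmem s2 ''f'' 0 0 \<noteq> 0 \<longleftrightarrow> (fmem s2 ''R'' (neval s2 X1) (neval s2 Y1) = M (neval s2 X1) (neval s2 Y1)) \<noteq>
            (fmem s2 ''R'' (neval s2 X2) (neval s2 Y2) = M (neval s2 X2) (neval s2 Y2))"
            using s2 unfolding e R by (simp add: P_def)
          show "((neval s2 X1, neval s2 Y1), neval s2 X2, neval s2 Y2) \<in> (links V M)\<^sup>*"
            unfolding e using linked[OF l] by blast
        qed (use linked[OF l] in \<open>simp_all add: e\<close>)
        thus ?thesis
          by (rule runs_mono) (simp_all add: e agree_coarser[OF ag] agree_eq_vars[OF ag])
      qed
      thus "runs (Seq (Cond same (nset ''f'' n0) (nset ''f'' (NConst 1))) (merge X1 Y1 X2 Y2)) s1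
          (1 + cost \<tau> (Cond same (nset ''f'' n0) (nset ''f'' (NConst 1))) + merge_time X1 Y1 X2 Y2 n \<tau>) ?Q"
        by (rule runs_Seq[OF runs_mono[OF flag le_refl]])
    qed
  qed
next
qed

lemma triple_step_runs:
  fixes s defines "i \<equiv> nmem s ''i'' 0 0" and "j \<equiv> nmem s ''j'' 0 0" and "k \<equiv> nmem s ''k'' 0 0"
  assumes v: "valid_state s" and V: "i \<in> V" "j \<in> V" "k \<in> V"
  shows "runs triple_step s (triple_time n \<tau>) (\<lambda>s'. valid_state s' \<and> coarser s s' \<and> eq_vars s s' \<and>
    (distinct [i, j, k] \<and> linked_triple M i j k \<longrightarrow> same_label s' i j i k))"
proof -
  have con: "consistent (fmem s ''R'') (nmem s ''L1'') (nmem s ''L2'')" and b: "base s"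
    using v by (auto simp: valid_state_def)
  have ev: "neval s vi = i" "neval s vj = j" "neval s vk = k" by (simp_all add: i_def j_def k_def)
  have lt: "i < n" "j < n" "k < n" "0 < n" using V n by (auto simp: V_def)
  define R where "R = fmem s ''R''"
  have guard: "beval rt as s triple_guard \<longleftrightarrow> distinct [i, j, k] \<and> R i j \<noteq> R j i \<and> R i k \<noteq> R k i"
    by (auto simp: triple_guard_def i_def j_def k_def R_def)
  have query: "wp triple_query (\<lambda>s1. agree s s1 \<and> fmem s1 ''g'' 0 0 = cyc3 (M i j) (M j i) (M j k) (M k j) (M k i) (M i k) \<and>
     fmem s1 ''h'' 0 0 = cyc4 (M i j) (M j i) (M j k) (M k j) (M k i) (M i k)) s"
    if d: "distinct [i, j, k]"
  proof -
    have z: "i \<noteq> 0" "j \<noteq> 0" "k \<noteq> 0" using V by (auto simp: V_def)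
    have ij: "i \<noteq> j" "i \<noteq> k" "j \<noteq> k" using d by auto
    have p: "fmem s ''p'' i 0 = pp i" "fmem s ''p'' j 0 = pp j" "fmem s ''p'' k 0 = pp k"
      using b lt by (auto simp: base_def)
    have dg: "R i i = M i i" "R j j = M j j" "R k k = M k k" "R 0 0 = M 0 0"
      using b lt by (auto simp: base_def R_def \<delta>_def)
    have sp: "R x y * R y x = M x y * M y x \<and> R x y + R y x = M x y + M y x" if "x \<in> V" "y \<in> V" "x \<noteq> y" for x y
      using con_cases[OF con that] by (auto simp: R_def mult.commute add.commute)
    note sps = sp[OF V(1,2) ij(1), THEN conjunct1] sp[OF V(1,2) ij(1), THEN conjunct2]
      sp[OF V(2,3) ij(3), THEN conjunct1] sp[OF V(2,3) ij(3), THEN conjunct2]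
      sp[OF V(3,1) ij(2)[symmetric], THEN conjunct1] sp[OF V(3,1) ij(2)[symmetric], THEN conjunct2]
    have pnz: "pp i * pp j * pp k \<noteq> 0" using pp_nz lt by simp
    have t: "orc {i, j, k} / (pp i * pp j * pp k) = pdet M [i, j, k]"
      using orc_pdet[of "[i, j, k]"] d lt pnz by (simp add: mult.assoc)
    have "pp 0 = 1" by (simp add: pp_def)
    hence u: "orc {0, i, j, k} / (pp i * pp j * pp k) = pdet M [0, i, j, k]"
      using orc_pdet[of "[0, i, j, k]"] d lt pnz z by (simp add: mult.assoc)
    have d0: "distinct [0, i, j, k]" using d z by auto
    note cm = cyc_minors[OF d0 M_border(1)[OF V(1)] M_border(1)[OF V(2)] M_border(1)[OF V(3)]
        M_border(2)[OF V(1)] M_border(2)[OF V(2)] M_border(2)[OF V(3)]]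
    show ?thesis
      unfolding triple_query_def
      apply (simp add: upd_apply upd_other agree_def i_def[symmetric] j_def[symmetric] k_def[symmetric] R_def[symmetric] p t u dg sps)
      apply (simp only: cm)
      apply simp
      done
  qed
  define linked where "linked \<longleftrightarrow> distinct [i, j, k] \<and> linked_triple M i j k"
  have E: "E i j" "E i k" if linked using that by (auto simp: linked_def linked_triple_def)
  have "runs triple_step s (triple_time n \<tau>) (\<lambda>s'. valid_state s' \<and> coarser s s' \<and> eq_vars s s' \<and>
    (linked \<longrightarrow> same_label s' (neval s vi) (neval s vj) (neval s vi) (neval s vk)))"
    unfolding triple_step_def triple_time_def
  proof (rule link_step_runs[OF v])
    show "\<not> linked" if "\<not> beval rt as s triple_guard"
    proof
      assume l: linked
      thus False using that E[OF l] con_antisym[OF con V(1,2)] con_antisym[OF con V(1,3)] unfolding guard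
        by (simp add: linked_def R_def)
    qed
    assume "beval rt as s triple_guard"
    hence d: "distinct [i, j, k]" and ne: "R i j \<noteq> R j i" "R i k \<noteq> R k i" by (auto simp: guard)
    note test = triple_test[OF con V d ne[unfolded R_def] refl]
    show "wp triple_query (\<lambda>s1. agree s s1 \<and> (beval rt as s1 (BAnd triple_same triple_opp) \<longleftrightarrow> \<not> linked) \<and>
      (linked \<longrightarrow> (beval rt as s1 triple_same \<longleftrightarrow> (fmem s ''R'' (neval s vi) (neval s vj) = M (neval s vi) (neval s vj)) =
        (fmem s ''R'' (neval s vi) (neval s vk) = M (neval s vi) (neval s vk))))) s"
    proof (rule wp_mono[OF query[OF d]], elim conjE)
      fix s1
      assume ag: "agree s s1" and gh: "fmem s1 ''g'' 0 0 = cyc3 (M i j) (M j i) (M j k) (M k j) (M k i) (M i k)"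
        "fmem s1 ''h'' 0 0 = cyc4 (M i j) (M j i) (M j k) (M k j) (M k i) (M i k)"
      have e: "nmem s1 ''i'' 0 0 = i" "nmem s1 ''j'' 0 0 = j" "nmem s1 ''k'' 0 0 = k" "fmem s1 ''R'' = fmem s ''R''"
        using ag by (simp_all add: agree_def i_def j_def k_def)
      show "agree s s1 \<and> (beval rt as s1 (BAnd triple_same triple_opp) \<longleftrightarrow> \<not> linked) \<and>
      (linked \<longrightarrow> (beval rt as s1 triple_same \<longleftrightarrow> (fmem s ''R'' (neval s vi) (neval s vj) = M (neval s vi) (neval s vj)) =
        (fmem s ''R'' (neval s vi) (neval s vk) = M (neval s vi) (neval s vk))))"
        unfolding ev i_def[symmetric] j_def[symmetric] k_def[symmetric] triple_same_def triple_opp_def beval.simps beval_simps beval_cyc_test feval.simps eval_scalar e gh cycs_def[symmetric]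
        unfolding linked_def using ag test d by blast
    qed
  next
    assume l: linked
    show "neval s vi \<in> V \<and> neval s vj \<in> V \<and> neval s vi \<in> V \<and> neval s vk \<in> V \<and> E (neval s vi) (neval s vj) \<and>
       E (neval s vi) (neval s vk) \<and> ((neval s vi, neval s vj), neval s vi, neval s vk) \<in> links V M"
      unfolding ev using V E[OF l] links.triple[of i j k V M] l by (simp add: linked_def)
  qed simp_all
  thus ?thesis unfolding ev linked_def .
qed

lemma det3_exp [simp]:
  "feval rt as s (det3_exp a b c x y z) = det3 (fmem s ''R'') (neval s a) (neval s b) (neval s c) (neval s x) (neval s y) (neval s z)"
  by (simp add: det3_exp_def det3_def)

lemma quad_step_runs:
  fixes s defines "i \<equiv> nmem s ''i'' 0 0" and "j \<equiv> nmem s ''j'' 0 0" and "k \<equiv> nmem s ''k'' 0 0" and "l \<equiv> nmem s ''l'' 0 0"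
  assumes v: "valid_state s" and V: "i \<in> V" "j \<in> V" "k \<in> V" "l \<in> V"
  shows "runs quad_step s (quad_time n \<tau>) (\<lambda>s'. valid_state s' \<and> coarser s s' \<and> eq_vars s s' \<and>
    (distinct [i, j, k, l] \<and> linked_quad M i j k l \<longrightarrow> same_label s' i j k l))"
proof -
  have con: "consistent (fmem s ''R'') (nmem s ''L1'') (nmem s ''L2'')" and b: "base s"
    using v by (auto simp: valid_state_def)
  have ev: "neval s vi = i" "neval s vj = j" "neval s vk = k" "neval s vl = l" by (simp_all add: i_def j_def k_def l_def)
  have lt: "i < n" "j < n" "k < n" "l < n" using V by (auto simp: V_def)
  define linked where "linked \<longleftrightarrow> distinct [i, j, k, l] \<and> linked_quad M i j k l"
  have guard: "beval rt as s quad_guard \<longleftrightarrow> linked"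
    using quad_test(1)[OF con V] unfolding quad_guard_def beval_simps linked_def
    by (auto simp: i_def j_def k_def l_def)
  have query: "wp quad_query (\<lambda>s1. agree s s1 \<and> fmem s1 ''t'' 0 0 = pdet M [i, j, k, l]) s"
    if d: "distinct [i, j, k, l]"
  proof -
    have p: "fmem s ''p'' i 0 = pp i" "fmem s ''p'' j 0 = pp j" "fmem s ''p'' k 0 = pp k" "fmem s ''p'' l 0 = pp l"
      using b lt by (auto simp: base_def)
    have pnz: "pp i * pp j * pp k * pp l \<noteq> 0" using pp_nz lt by simp
    have t: "orc {i, j, k, l} / (pp i * pp j * pp k * pp l) = pdet M [i, j, k, l]"
      using orc_pdet[of "[i, j, k, l]"] d lt pnz by (simp add: mult.assoc)
    show ?thesis
      unfolding quad_query_def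
      by (simp add: upd_apply upd_other agree_def i_def[symmetric] j_def[symmetric] k_def[symmetric] l_def[symmetric] p t)
  qed
  have "runs quad_step s (quad_time n \<tau>) (\<lambda>s'. valid_state s' \<and> coarser s s' \<and> eq_vars s s' \<and>
    (linked \<longrightarrow> same_label s' (neval s vi) (neval s vj) (neval s vk) (neval s vl)))"
    unfolding quad_step_def quad_time_def
  proof (rule link_step_runs[OF v])
    show "\<not> linked" if "\<not> beval rt as s quad_guard" using that guard by simp
    assume "beval rt as s quad_guard"
    hence ln: linked by (simp add: guard)
    hence d: "distinct [i, j, k, l]" and q: "linked_quad M i j k l" by (auto simp: linked_def)
    have br: "pdet (bordered 0 \<delta> (fmem s ''R'')) [i, j, k, l] = pdet (fmem s ''R'') [i, j, k, l]"
      by (rule pdet_cong) (use b lt V in \<open>auto simp: bordered_def base_def V_def\<close>)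
    note test = quad_test(2)[OF con V d q, unfolded br]
    show "wp quad_query (\<lambda>s1. agree s s1 \<and> (beval rt as s1 (NLess n0 n0) \<longleftrightarrow> \<not> linked) \<and>
      (linked \<longrightarrow> (beval rt as s1 quad_same \<longleftrightarrow> (fmem s ''R'' (neval s vi) (neval s vj) = M (neval s vi) (neval s vj)) =
        (fmem s ''R'' (neval s vk) (neval s vl) = M (neval s vk) (neval s vl))))) s"
    proof (rule wp_mono[OF query[OF d]], elim conjE)
      fix s1
      assume ag: "agree s s1" and t: "fmem s1 ''t'' 0 0 = pdet M [i, j, k, l]"
      have e: "nmem s1 ''i'' 0 0 = i" "nmem s1 ''j'' 0 0 = j" "nmem s1 ''k'' 0 0 = k" "nmem s1 ''l'' 0 0 = l"
        "fmem s1 ''R'' = fmem s ''R''"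
        using ag by (simp_all add: agree_def i_def j_def k_def l_def)
      have "beval rt as s1 quad_same \<longleftrightarrow> pdet (fmem s ''R'') [i, j, k, l] = pdet M [i, j, k, l]"
        unfolding pdet_4[of "fmem s ''R''"] by (simp add: quad_same_def e t)
      thus "agree s s1 \<and> (beval rt as s1 (NLess n0 n0) \<longleftrightarrow> \<not> linked) \<and>
      (linked \<longrightarrow> (beval rt as s1 quad_same \<longleftrightarrow> (fmem s ''R'' (neval s vi) (neval s vj) = M (neval s vi) (neval s vj)) =
        (fmem s ''R'' (neval s vk) (neval s vl) = M (neval s vk) (neval s vl))))"
        unfolding ev using ag ln test by simp
    qed
  next
    assume ln: linked
    thus "neval s vi \<in> V \<and> neval s vj \<in> V \<and> neval s vk \<in> V \<and> neval s vl \<in> V \<and> E (neval s vi) (neval s vj) \<and>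
       E (neval s vk) (neval s vl) \<and> ((neval s vi, neval s vj), neval s vk, neval s vl) \<in> links V M"
      unfolding ev using V links.quad[of i j k l V M] by (auto simp: linked_def linked_quad_def)
  qed simp_all
  thus ?thesis unfolding ev linked_def .
qed

end

definition triple_loops :: com where
  "triple_loops = for_loop ''i'' 1 (for_loop ''j'' 1 (for_loop ''k'' 1 triple_step))"
definition quad_loops :: com where
  "quad_loops = for_loop ''i'' 1 (for_loop ''j'' 1 (for_loop ''k'' 1 (for_loop ''l'' 1 quad_step)))"

definition init_first :: com where
  "init_first = block [Query ''R'' n0 n0 n0 n0 n0 n0, FAssign ''p'' n0 n0 FOne]"

definition init_vertex :: com where
  "init_vertex = block [Query ''t'' n0 n0 vi vi vi vi, Query ''u'' n0 n0 n0 vi vi vi,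
     FAssign ''p'' vi n0 (rr n0 n0 [*] fv ''t'' [-] fv ''u''), FAssign ''R'' vi vi (fv ''t'' [/] pe vi),
     FAssign ''R'' n0 vi FOne, FAssign ''R'' vi n0 FOne]"

text \<open>\<open>g\<close> and \<open>h\<close> receive the sum and the product of the two entries of a pair.\<close>

definition edge_query :: com where
  "edge_query = block [Query ''u'' n0 n0 vi vj vj vj,
     fset ''h'' (rr vi vi [*] rr vj vj [-] fv ''u'' [/] (pe vi [*] pe vj)),
     Query ''t'' n0 n0 n0 vi vj vj,
     fset ''g'' (fv ''t'' [/] (pe vi [*] pe vj) [-] rr n0 n0 [*] (rr vi vi [*] rr vj vj [-] fv ''h'')
       [+] rr vi vi [+] rr vj vj)]"

definition edge_assign :: "fexp \<Rightarrow> com" where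
  "edge_assign re = block [FAssign ''R'' vi vj re, FAssign ''R'' vj vi (fv ''g'' [-] rr vi vj),
     NAssign ''L1'' vi vj vi, NAssign ''L1'' vj vi vi, NAssign ''L2'' vi vj vj, NAssign ''L2'' vj vi vj]"

definition init_edge :: "fexp \<Rightarrow> com" where
  "init_edge re = Cond (NLess vi vj) (Seq edge_query (edge_assign re)) Skip"

definition write_entry :: com where
  "write_entry = FAssign ''B'' vi vj (pe vi [*] rr vi vj)"

definition init_time :: "fexp \<Rightarrow> nat \<Rightarrow> nat \<Rightarrow> nat" where
  "init_time re n \<tau> = 1 + cost \<tau> init_first + (1 + for_time n (cost \<tau> init_vertex) +
     for_time n (for_time n (cost \<tau> (init_edge re))))"

definition init :: "fexp \<Rightarrow> com" where
  "init re = Seq init_first (Seq (for_loop ''i'' 1 init_vertex) (for_loop ''i'' 1 (for_loop ''j'' 1 (init_edge re))))"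

definition algorithm :: "fexp \<Rightarrow> com" where
  "algorithm re = Cond (NLess n0 (sv ''n'')) (Seq (init re) (Seq triple_loops (Seq quad_loops
     (for_loop ''i'' 0 (for_loop ''j'' 0 write_entry))))) Skip"

definition algorithm_time :: "fexp \<Rightarrow> nat \<Rightarrow> nat \<Rightarrow> nat" where
  "algorithm_time re n \<tau> = 1 + bcost \<tau> (NLess n0 (sv ''n'')) + (1 + init_time re n \<tau> +
     (1 + for_time n (for_time n (for_time n (triple_time n \<tau>))) +
     (1 + for_time n (for_time n (for_time n (for_time n (quad_time n \<tau>)))) +
      for_time n (for_time n (cost \<tau> write_entry))))) + 1"

lemma polynomially_bounded_algorithm_time:
  assumes "polynomially_bounded \<tau>"
  shows "polynomially_bounded (\<lambda>n. algorithm_time re n (\<tau> n))"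
  unfolding algorithm_time_def init_time_def triple_time_def quad_time_def link_time_def merge_time_def
  by (intro polynomially_bounded_add polynomially_bounded_for polynomially_bounded_cost polynomially_bounded_bcost
      polynomially_bounded_const assms)

context run
begin

definition keep :: "string set \<Rightarrow> 'a state \<Rightarrow> 'a state \<Rightarrow> bool" where
  "keep Xs s s' \<longleftrightarrow> (\<forall>X\<in>Xs. nmem s' X = nmem s X)"

definition refines :: "string set \<Rightarrow> com \<Rightarrow> nat \<Rightarrow> ('a state \<Rightarrow> bool) \<Rightarrow> 'a state \<Rightarrow> bool" where
  "refines Xs c t G s \<longleftrightarrow> runs c s t (\<lambda>s'. valid_state s' \<and> coarser s s' \<and> keep Xs s s' \<and> G s')"

lemma refines_loop:
  assumes v: "valid_state s" and X: "X \<in> {''i'', ''j'', ''k'', ''l''} - Xs"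
    and stable: "\<And>m s s'. \<lbrakk>m \<in> V; G m s; coarser s s'\<rbrakk> \<Longrightarrow> G m s'"
    and body: "\<And>m s'. \<lbrakk>m \<in> V; valid_state s'; keep Xs s s'; nmem s' X 0 0 = m\<rbrakk> \<Longrightarrow> refines (insert X Xs) c t (G m) s'"
  shows "refines Xs (for_loop X 1 c) (for_time n t) (\<lambda>s'. \<forall>m\<in>V. G m s') s"
proof -
  have L: "nmem (put s' X m) ''L1'' = nmem s' ''L1''" "nmem (put s' X m) ''L2'' = nmem s' ''L2''" for s' m
    using X by auto
  have Y: "nmem (put s' X m) Y = nmem s' Y" if "Y \<in> Xs" for Y s' m
    using that X by (metis DiffD2 put_other(1))
  have pv: "valid_state (put s' X m) = valid_state s'" for s' m
    using X by (intro valid_state_cong) (auto simp: L)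
  have pc: "coarser s1 (put s' X m) = coarser s1 s'" for s1 s' m
    by (simp add: coarser_def same_label_def L)
  have pk: "keep Xs s1 (put s' X m) = keep Xs s1 s'" for s1 s' m
    using Y by (simp add: keep_def)
  have "runs (for_loop X 1 c) s (for_time n t)
    (\<lambda>s'. valid_state s' \<and> coarser s s' \<and> keep Xs s s' \<and> (\<forall>m'\<in>V. m' < n \<longrightarrow> G m' s'))"
  proof (rule runs_for[where I = "\<lambda>m s'. valid_state s' \<and> coarser s s' \<and> keep Xs s s' \<and> (\<forall>m'\<in>V. m' < m \<longrightarrow> G m' s')"])
    show "1 \<le> n" using n by simp
    show "nmem s' ''n'' 0 0 = n" if "valid_state s' \<and> coarser s s' \<and> keep Xs s s' \<and> (\<forall>m'\<in>V. m' < m \<longrightarrow> G m' s')" for m s'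
      using that by (simp add: valid_state_def base_def)
    show "valid_state (put s X 1) \<and> coarser s (put s X 1) \<and> keep Xs s (put s X 1) \<and> (\<forall>m'\<in>V. m' < 1 \<longrightarrow> G m' (put s X 1))"
      unfolding pv pc pk using v by (auto simp: coarser_refl keep_def V_def)
    fix m s'
    assume m: "1 \<le> m" "m < n" "nmem s' X 0 0 = m"
      and I: "valid_state s' \<and> coarser s s' \<and> keep Xs s s' \<and> (\<forall>m'\<in>V. m' < m \<longrightarrow> G m' s')"
    have "m \<in> V" using m by (simp add: V_def)
    hence "refines (insert X Xs) c t (G m) s'" using body I m by blast
    thus "runs c s' t (\<lambda>s''. nmem s'' X 0 0 = m \<and> valid_state (put s'' X (Suc m)) \<and> coarser s (put s'' X (Suc m)) \<and>
        keep Xs s (put s'' X (Suc m)) \<and> (\<forall>m'\<in>V. m' < Suc m \<longrightarrow> G m' (put s'' X (Suc m))))"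
      unfolding refines_def
    proof (rule runs_mono[OF _ le_refl], elim conjE)
      fix s'' assume s'': "valid_state s''" "coarser s' s''" "keep (insert X Xs) s' s''" "G m s''"
      have "G m' (put s'' X (Suc m))" if "m' \<in> V" "m' < Suc m" for m'
      proof (rule stable[OF that(1)])
        show "coarser s'' (put s'' X (Suc m))" by (simp add: pc coarser_refl)
        show "G m' s''"
          using that I s'' stable[OF that(1) _ s''(2)] by (cases "m' = m") auto
      qed
      thus "nmem s'' X 0 0 = m \<and> valid_state (put s'' X (Suc m)) \<and> coarser s (put s'' X (Suc m)) \<and>
        keep Xs s (put s'' X (Suc m)) \<and> (\<forall>m'\<in>V. m' < Suc m \<longrightarrow> G m' (put s'' X (Suc m)))"
        unfolding pv pc pk using s'' I m coarser_trans[of s s' s''] by (auto simp: keep_def)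
    qed
  qed
  thus ?thesis unfolding refines_def by (rule runs_mono) (auto simp: V_def)
qed

lemma triple_loops_runs:
  assumes v: "valid_state s"
  shows "runs triple_loops s (for_time n (for_time n (for_time n (triple_time n \<tau>)))) (\<lambda>s'. valid_state s' \<and> coarser s s' \<and>
    (\<forall>i\<in>V. \<forall>j\<in>V. \<forall>k\<in>V. distinct [i, j, k] \<and> linked_triple M i j k \<longrightarrow> same_label s' i j i k))"
proof -
  define G where "G = (\<lambda>i j k s'. distinct [i, j, k] \<and> linked_triple M i j k \<longrightarrow> same_label s' i j i k)"
  have st: "G i j k s''" if "i \<in> V" "j \<in> V" "k \<in> V" "G i j k s'" "coarser s' s''" for i j k s' s''
    using that by (auto simp: G_def coarser_def)
  have "refines {} triple_loops (for_time n (for_time n (for_time n (triple_time n \<tau>))))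
      (\<lambda>s'. \<forall>i\<in>V. \<forall>j\<in>V. \<forall>k\<in>V. G i j k s') s"
    unfolding triple_loops_def
  proof (rule refines_loop[OF v])
    show "\<forall>j\<in>V. \<forall>k\<in>V. G i j k s''" if "i \<in> V" "\<forall>j\<in>V. \<forall>k\<in>V. G i j k s'" "coarser s' s''" for i s' s''
      using st that by blast
    fix i s1 assume i: "i \<in> V" "valid_state s1" "nmem s1 ''i'' 0 0 = i"
    show "refines {''i''} (for_loop ''j'' 1 (for_loop ''k'' 1 triple_step)) (for_time n (for_time n (triple_time n \<tau>)))
        (\<lambda>s'. \<forall>j\<in>V. \<forall>k\<in>V. G i j k s') s1"
    proof (rule refines_loop[OF i(2)])
      show "\<forall>k\<in>V. G i j k s''" if "j \<in> V" "\<forall>k\<in>V. G i j k s'" "coarser s' s''" for j s' s''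
        using st i that by blast
      fix j s2 assume j: "j \<in> V" "valid_state s2" "nmem s2 ''j'' 0 0 = j" "keep {''i''} s1 s2"
      show "refines {''j'', ''i''} (for_loop ''k'' 1 triple_step) (for_time n (triple_time n \<tau>)) (\<lambda>s'. \<forall>k\<in>V. G i j k s') s2"
      proof (rule refines_loop[OF j(2)])
        show "G i j k s''" if "k \<in> V" "G i j k s'" "coarser s' s''" for k s' s''
          using st i j that by blast
        fix k s3 assume k: "k \<in> V" "valid_state s3" "nmem s3 ''k'' 0 0 = k" "keep {''j'', ''i''} s2 s3"
        have e: "nmem s3 ''i'' 0 0 = i" "nmem s3 ''j'' 0 0 = j" using i j k by (auto simp: keep_def)
        show "refines {''k'', ''j'', ''i''} triple_step (triple_time n \<tau>) (G i j k) s3"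
          unfolding refines_def
          by (rule runs_mono[OF triple_step_runs[OF k(2)] le_refl])
            (use i(1) j(1) k(1,3) e in \<open>auto simp: G_def keep_def eq_vars_def\<close>)
      qed simp
    qed simp
  qed simp
  thus ?thesis unfolding refines_def G_def by (rule runs_mono) simp_all
qed

lemma quad_loops_runs:
  assumes v: "valid_state s"
  shows "runs quad_loops s (for_time n (for_time n (for_time n (for_time n (quad_time n \<tau>))))) (\<lambda>s'. valid_state s' \<and> coarser s s' \<and>
    (\<forall>i\<in>V. \<forall>j\<in>V. \<forall>k\<in>V. \<forall>l\<in>V. distinct [i, j, k, l] \<and> linked_quad M i j k l \<longrightarrow> same_label s' i j k l))"
proof -
  define G where "G = (\<lambda>i j k l s'. distinct [i, j, k, l] \<and> linked_quad M i j k l \<longrightarrow> same_label s' i j k l)"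
  have st: "G i j k l s''" if "i \<in> V" "j \<in> V" "k \<in> V" "l \<in> V" "G i j k l s'" "coarser s' s''" for i j k l s' s''
    using that by (auto simp: G_def coarser_def)
  have "refines {} quad_loops (for_time n (for_time n (for_time n (for_time n (quad_time n \<tau>)))))
      (\<lambda>s'. \<forall>i\<in>V. \<forall>j\<in>V. \<forall>k\<in>V. \<forall>l\<in>V. G i j k l s') s"
    unfolding quad_loops_def
  proof (rule refines_loop[OF v])
    show "\<forall>j\<in>V. \<forall>k\<in>V. \<forall>l\<in>V. G i j k l s''" if "i \<in> V" "\<forall>j\<in>V. \<forall>k\<in>V. \<forall>l\<in>V. G i j k l s'" "coarser s' s''" for i s' s''
      using st that by blast
    fix i s1 assume i: "i \<in> V" "valid_state s1" "nmem s1 ''i'' 0 0 = i"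
    show "refines {''i''} (for_loop ''j'' 1 (for_loop ''k'' 1 (for_loop ''l'' 1 quad_step))) (for_time n (for_time n (for_time n (quad_time n \<tau>))))
        (\<lambda>s'. \<forall>j\<in>V. \<forall>k\<in>V. \<forall>l\<in>V. G i j k l s') s1"
    proof (rule refines_loop[OF i(2)])
      show "\<forall>k\<in>V. \<forall>l\<in>V. G i j k l s''" if "j \<in> V" "\<forall>k\<in>V. \<forall>l\<in>V. G i j k l s'" "coarser s' s''" for j s' s''
        using st i that by blast
      fix j s2 assume j: "j \<in> V" "valid_state s2" "nmem s2 ''j'' 0 0 = j" "keep {''i''} s1 s2"
      show "refines {''j'', ''i''} (for_loop ''k'' 1 (for_loop ''l'' 1 quad_step)) (for_time n (for_time n (quad_time n \<tau>)))
          (\<lambda>s'. \<forall>k\<in>V. \<forall>l\<in>V. G i j k l s') s2"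
      proof (rule refines_loop[OF j(2)])
        show "\<forall>l\<in>V. G i j k l s''" if "k \<in> V" "\<forall>l\<in>V. G i j k l s'" "coarser s' s''" for k s' s''
          using st i j that by blast
        fix k s3 assume k: "k \<in> V" "valid_state s3" "nmem s3 ''k'' 0 0 = k" "keep {''j'', ''i''} s2 s3"
        show "refines {''k'', ''j'', ''i''} (for_loop ''l'' 1 quad_step) (for_time n (quad_time n \<tau>)) (\<lambda>s'. \<forall>l\<in>V. G i j k l s') s3"
        proof (rule refines_loop[OF k(2)])
          show "G i j k l s''" if "l \<in> V" "G i j k l s'" "coarser s' s''" for l s' s''
            using st i j k that by blast
          fix l s4 assume l: "l \<in> V" "valid_state s4" "nmem s4 ''l'' 0 0 = l" "keep {''k'', ''j'', ''i''} s3 s4"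
          have e: "nmem s4 ''i'' 0 0 = i" "nmem s4 ''j'' 0 0 = j" "nmem s4 ''k'' 0 0 = k"
            using i j k l by (auto simp: keep_def)
          show "refines {''l'', ''k'', ''j'', ''i''} quad_step (quad_time n \<tau>) (G i j k l) s4"
            unfolding refines_def
            by (rule runs_mono[OF quad_step_runs[OF l(2)] le_refl])
              (use i(1) j(1) k(1) l(1,3) e in \<open>auto simp: G_def keep_def eq_vars_def\<close>)
        qed simp
      qed simp
    qed simp
  qed simp
  thus ?thesis unfolding refines_def G_def by (rule runs_mono) simp_all
qed

definition init_base :: "nat \<Rightarrow> 'a state \<Rightarrow> bool" where
  "init_base m s \<longleftrightarrow> nmem s ''n'' 0 0 = n \<and> (\<forall>x<n. x = 0 \<or> x < m \<longrightarrow> fmem s ''p'' x 0 = pp x \<and> fmem s ''R'' x x = \<delta> x \<and>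
     (0 < x \<longrightarrow> fmem s ''R'' 0 x = 1 \<and> fmem s ''R'' x 0 = 1))"

lemma init_vertex_runs:
  assumes m: "m \<in> V" and s: "init_base m s" "nmem s ''i'' 0 0 = m"
  shows "runs init_vertex s (cost \<tau> init_vertex) (\<lambda>s'. nmem s' ''i'' 0 0 = m \<and> init_base (Suc m) s')"
proof (rule wp_runs)
  have lt: "0 < n" "m < n" "0 < m" using m n by (auto simp: V_def)
  have p0: "pp 0 = 1" by (simp add: pp_def)
  have t: "orc {m} = pp m * M m m" using orc_pdet[of "[m]"] lt by (simp add: pdet_single)
  have u: "orc {0, m} = pp m * (M 0 0 * M m m - 1)"
    using orc_pdet[of "[0, m]"] lt p0 M_border[OF m] by (simp add: pdet_2)
  have d: "fmem s ''R'' 0 0 = M 0 0" using s lt by (auto simp: init_base_def \<delta>_def)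
  have p: "M 0 0 * (pp m * M m m) - pp m * (M 0 0 * M m m - 1) = pp m" by (simp add: algebra_simps)
  show "wp init_vertex (\<lambda>s'. nmem s' ''i'' 0 0 = m \<and> init_base (Suc m) s') s"
    unfolding init_vertex_def using s(2) lt pp_nz[OF lt(2)]
    by (simp add: upd_apply upd_other t u d p, insert s(1)) (auto simp: init_base_def upd_apply \<delta>_def less_Suc_eq)
qed

definition edge_set :: "'a state \<Rightarrow> nat \<Rightarrow> nat \<Rightarrow> bool" where
  "edge_set s x y \<longleftrightarrow> fmem s ''R'' x y = \<rho> (M x y) (M y x) \<and> fmem s ''R'' y x = M x y + M y x - \<rho> (M x y) (M y x) \<and>
     nmem s ''L1'' x y = x \<and> nmem s ''L1'' y x = x \<and> nmem s ''L2'' x y = y \<and> nmem s ''L2'' y x = y"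

definition init_edges :: "nat \<Rightarrow> nat \<Rightarrow> 'a state \<Rightarrow> bool" where
  "init_edges m k s \<longleftrightarrow> base s \<and> (\<forall>x y. pass m k x y \<longrightarrow> x < y \<longrightarrow> edge_set s x y)"

lemma init_edges_valid:
  assumes "init_edges n 1 s" shows "valid_state s"
proof -
  have e: "edge_set s x y" if "x \<in> V" "y \<in> V" "x < y" for x y
    using assms that by (auto simp: init_edges_def pass_end)
  have reo: "(fmem s ''R'' x y = M x y \<and> fmem s ''R'' y x = M y x) \<or> (fmem s ''R'' x y = M y x \<and> fmem s ''R'' y x = M x y)"
    if "x \<in> V" "y \<in> V" "x < y" for x y
    using e[OF that] rho(1)[of "M x y" "M y x"] by (auto simp: edge_set_def)
  have lab: "nmem s ''L1'' x y = min x y \<and> nmem s ''L2'' x y = max x y" if "x \<in> V" "y \<in> V" "x \<noteq> y" for x y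
    using e[of x y] e[of y x] that by (cases "x < y") (auto simp: edge_set_def min_def max_def)
  have kept: "fmem s ''R'' y x = M y x \<longleftrightarrow> fmem s ''R'' x y = M x y" if "x \<in> V" "y \<in> V" "E x y" for x y
    using reo[of x y] reo[of y x] that by (cases x y rule: linorder_cases) auto
  have "consistent (fmem s ''R'') (nmem s ''L1'') (nmem s ''L2'')"
    unfolding consistent_def
  proof (intro conjI ballI impI)
    show "reoriented V M (fmem s ''R'')"
      unfolding reoriented_def
    proof (intro ballI impI)
      fix x y assume "x \<in> V" "y \<in> V" "x \<noteq> y"
      thus "(fmem s ''R'' x y = M x y \<and> fmem s ''R'' y x = M y x) \<or> (fmem s ''R'' x y = M y x \<and> fmem s ''R'' y x = M x y)"
        using reo[of x y] reo[of y x] by (cases x y rule: linorder_cases) auto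
    qed
    show "nmem s ''L1'' i j = nmem s ''L1'' j i" "nmem s ''L2'' i j = nmem s ''L2'' j i" if "i \<in> V" "j \<in> V" "i \<noteq> j" for i j
      using lab[of i j] lab[of j i] that by (auto simp: min.commute max.commute)
    fix i j assume ij: "i \<in> V" "j \<in> V" "E i j"
    have nij: "i \<noteq> j" using ij by auto
    have l: "nmem s ''L1'' i j = min i j" "nmem s ''L2'' i j = max i j" using lab[OF ij(1,2) nij] by auto
    have mm: "(min i j = i \<and> max i j = j) \<or> (min i j = j \<and> max i j = i)" by (auto simp: min_def max_def)
    show "nmem s ''L1'' i j \<in> V" "nmem s ''L2'' i j \<in> V" "nmem s ''L1'' i j \<le> i"
      "E (nmem s ''L1'' i j) (nmem s ''L2'' i j)"
      "nmem s ''L1'' (nmem s ''L1'' i j) (nmem s ''L2'' i j) = nmem s ''L1'' i j"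
      "nmem s ''L2'' (nmem s ''L1'' i j) (nmem s ''L2'' i j) = nmem s ''L2'' i j"
      unfolding l using mm ij nij lab[of i j] lab[of j i] by auto
    have "min i j < max i j" using nij by (auto simp: min_def max_def)
    thus "fmem s ''R'' (nmem s ''L1'' i j) (nmem s ''L2'' i j) =
        \<rho> (M (nmem s ''L1'' i j) (nmem s ''L2'' i j)) (M (nmem s ''L2'' i j) (nmem s ''L1'' i j))"
      unfolding l using e[of "min i j" "max i j"] mm ij by (auto simp: edge_set_def)
    fix k l assume kl: "k \<in> V" "l \<in> V" "E k l" "nmem s ''L1'' i j = nmem s ''L1'' k l" "nmem s ''L2'' i j = nmem s ''L2'' k l"
    have "k \<noteq> l" using kl by auto
    hence "min i j = min k l" "max i j = max k l" using lab[OF kl(1,2)] kl(4,5) \<open>nmem s ''L1'' i j = min i j\<close> \<open>nmem s ''L2'' i j = max i j\<close> by auto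
    hence c: "(k = i \<and> l = j) \<or> (k = j \<and> l = i)" by (auto simp: min_def max_def split: if_splits)
    thus "(fmem s ''R'' i j = M i j) = (fmem s ''R'' k l = M k l)" using kept[OF ij] by auto
    show "((i, j), k, l) \<in> (links V M)\<^sup>*" using c links.swap[OF ij(1,2) nij, of M] by auto
  qed
  thus ?thesis using assms by (simp add: valid_state_def init_edges_def)
qed

end

context run
begin

context
  fixes re :: fexp
  assumes root: "\<And>s x y. fmem s ''g'' 0 0 = x + y \<Longrightarrow> fmem s ''h'' 0 0 = x * y \<Longrightarrow> feval rt as s re = \<rho> x y"
begin

lemma edge_query_wp:
  assumes V: "m \<in> V" "k \<in> V" "m < k" and b: "base s" and mk: "nmem s ''i'' 0 0 = m" "nmem s ''j'' 0 0 = k"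
  shows "wp edge_query (\<lambda>s1. nmem s1 = nmem s \<and> fmem s1 ''R'' = fmem s ''R'' \<and> fmem s1 ''p'' = fmem s ''p'' \<and>
    fmem s1 ''g'' 0 0 = M m k + M k m \<and> fmem s1 ''h'' 0 0 = M m k * M k m) s"
proof -
  have lt: "0 < m" "m < n" "k < n" "0 < k" using V by (auto simp: V_def)
  have p: "fmem s ''p'' m 0 = pp m" "fmem s ''p'' k 0 = pp k" using b lt by (auto simp: base_def)
  have dg: "fmem s ''R'' m m = M m m" "fmem s ''R'' k k = M k k" "fmem s ''R'' 0 0 = M 0 0"
    using b lt n by (auto simp: base_def \<delta>_def)
  have pnz: "pp m * pp k \<noteq> 0" using pp_nz lt by simp
  have u: "orc {m, k} / (pp m * pp k) = M m m * M k k - M m k * M k m"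
    using orc_pdet[of "[m, k]"] V lt pnz by (simp add: pdet_2 mult.assoc)
  have "pp 0 = 1" by (simp add: pp_def)
  hence "orc {0, m, k} / (pp m * pp k) = pdet M [0, m, k]"
    using orc_pdet[of "[0, m, k]"] V lt pnz by (simp add: mult.assoc)
  hence t: "orc {0, m, k} / (pp m * pp k) = M 0 0 * (M m m * M k k - M m k * M k m) - M m m - M k k + M m k + M k m"
    using M_border V by (simp add: pdet_3 det3_def algebra_simps)
  show ?thesis
    unfolding edge_query_def by (simp add: upd_apply upd_other mk p dg u t)
qed

lemma init_edge_runs:
  assumes V: "m \<in> V" "k \<in> V" and s: "init_edges m k s" and mk: "nmem s ''i'' 0 0 = m" "nmem s ''j'' 0 0 = k"
  shows "runs (init_edge re) s (cost \<tau> (init_edge re))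
    (\<lambda>s'. nmem s' ''i'' 0 0 = m \<and> nmem s' ''j'' 0 0 = k \<and> init_edges m (Suc k) s')"
proof (rule wp_runs, cases "m < k")
  case False
  hence "init_edges m (Suc k) s" using s by (simp add: init_edges_def pass_step)
  thus "wp (init_edge re) (\<lambda>s'. nmem s' ''i'' 0 0 = m \<and> nmem s' ''j'' 0 0 = k \<and> init_edges m (Suc k) s') s"
    using mk False by (simp add: init_edge_def)
next
  case True
  have b: "base s" using s by (simp add: init_edges_def)
  have "wp (edge_assign re) (\<lambda>s'. nmem s' ''i'' 0 0 = m \<and> nmem s' ''j'' 0 0 = k \<and> init_edges m (Suc k) s') s1"
    if s1: "nmem s1 = nmem s" "fmem s1 ''R'' = fmem s ''R''" "fmem s1 ''p'' = fmem s ''p''"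
      "fmem s1 ''g'' 0 0 = M m k + M k m" "fmem s1 ''h'' 0 0 = M m k * M k m" for s1
  proof -
    have r: "feval rt as s1 re = \<rho> (M m k) (M k m)" by (rule root[OF s1(4,5)])
    define P where "P = (\<lambda>x y. (x = m \<and> y = k) \<or> (x = k \<and> y = m))"
    have fin: "init_edges m (Suc k) s'"
      if n: "\<And>x y. nmem s' ''L1'' x y = (if P x y then m else nmem s ''L1'' x y)"
        "\<And>x y. nmem s' ''L2'' x y = (if P x y then k else nmem s ''L2'' x y)"
        "\<And>x y. fmem s' ''R'' x y = (if x = m \<and> y = k then \<rho> (M m k) (M k m) else if x = k \<and> y = m
          then M m k + M k m - \<rho> (M m k) (M k m) else fmem s ''R'' x y)"
        "nmem s' ''n'' = nmem s ''n''" "fmem s' ''p'' = fmem s ''p''" for s'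
      unfolding init_edges_def
    proof (intro conjI allI impI)
      show "base s'"
        using b True V unfolding base_def n by (auto simp: V_def)
      fix x y assume xy: "pass m (Suc k) x y" "x < y"
      show "edge_set s' x y"
      proof (cases "x = m \<and> y = k")
        case True
        thus ?thesis using xy by (simp add: edge_set_def n P_def)
      next
        case False
        moreover have "\<not> (x = k \<and> y = m)" using xy(2) True by simp
        ultimately have np: "\<not> P x y" "\<not> P y x" by (auto simp: P_def)
        have eq: "nmem s' ''L1'' x y = nmem s ''L1'' x y" "nmem s' ''L1'' y x = nmem s ''L1'' y x"
          "nmem s' ''L2'' x y = nmem s ''L2'' x y" "nmem s' ''L2'' y x = nmem s ''L2'' y x"
          by (simp_all only: n(1,2) np if_False)
        have nn: "\<not> (x = m \<and> y = k)" "\<not> (x = k \<and> y = m)" "\<not> (y = m \<and> x = k)" "\<not> (y = k \<and> x = m)"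
          using np unfolding P_def by blast+
        have R: "fmem s' ''R'' x y = fmem s ''R'' x y" "fmem s' ''R'' y x = fmem s ''R'' y x"
          by (simp_all only: n(3) nn if_False)
        have "pass m k x y" using xy(1) np(1) unfolding pass_step P_def by blast
        hence "edge_set s x y" using s xy(2) unfolding init_edges_def by blast
        thus ?thesis unfolding edge_set_def eq R .
      qed
    qed
    show ?thesis
      unfolding edge_assign_def
      by (simp add: upd_apply upd_other s1 mk r) (rule fin; use True s1 in \<open>auto simp: upd_apply upd_other P_def\<close>)
  qed
  thus "wp (init_edge re) (\<lambda>s'. nmem s' ''i'' 0 0 = m \<and> nmem s' ''j'' 0 0 = k \<and> init_edges m (Suc k) s') s"
    unfolding init_edge_def using True mk wp_mono[OF edge_query_wp[OF V True b mk]] by simp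
qed

lemma init_runs:
  assumes s: "nmem s ''n'' 0 0 = n"
  shows "runs (init re) s (init_time re n \<tau>) valid_state"
  unfolding init_def init_time_def
proof (rule runs_Seq)
  have "wp init_first (init_base 1) s"
    using s n orc_pdet[of "[0]"] by (simp add: init_first_def init_base_def upd_apply upd_other \<delta>_def) (simp add: pp_def)
  note first = wp_runs[OF this]
  have vertices: "runs (for_loop ''i'' 1 init_vertex) s1 (for_time n (cost \<tau> init_vertex)) base"
    if "init_base 1 s1" for s1
  proof -
    have "runs (for_loop ''i'' 1 init_vertex) s1 (for_time n (cost \<tau> init_vertex)) (init_base n)"
    proof (rule runs_for[where I = init_base])
      show "1 \<le> n" using n by simp
      show "nmem s ''n'' 0 0 = n" if "init_base m s" for m s using that by (simp add: init_base_def)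
      show "init_base 1 (put s1 ''i'' 1)" using that by (simp add: init_base_def)
      fix m s assume m: "1 \<le> m" "m < n" "init_base m s" "nmem s ''i'' 0 0 = m"
      have "m \<in> V" using m by (simp add: V_def)
      from init_vertex_runs[OF this m(3,4)]
      show "runs init_vertex s (cost \<tau> init_vertex) (\<lambda>s'. nmem s' ''i'' 0 0 = m \<and> init_base (Suc m) (put s' ''i'' (Suc m)))"
        by (rule runs_mono) (simp_all add: init_base_def)
    qed
    thus ?thesis by (rule runs_mono) (auto simp: init_base_def base_def V_def)
  qed
  have pe: "init_edges m k (put s X v) = init_edges m k s" if "X \<in> {''i'', ''j''}" for m k s X v
    using that by (elim insertE) (simp_all add: init_edges_def base_def edge_set_def)
  have edges: "runs (for_loop ''i'' 1 (for_loop ''j'' 1 (init_edge re))) s2 (for_time n (for_time n (cost \<tau> (init_edge re)))) valid_state"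
    if b: "base s2" for s2
  proof -
    have "runs (for_loop ''i'' 1 (for_loop ''j'' 1 (init_edge re))) s2 (for_time n (for_time n (cost \<tau> (init_edge re)))) (init_edges n 1)"
    proof (rule runs_for[where I = "\<lambda>m. init_edges m 1"])
      show "1 \<le> n" using n by simp
      show "nmem s ''n'' 0 0 = n" if "init_edges m 1 s" for m s using that by (simp add: init_edges_def base_def)
      show "init_edges 1 1 (put s2 ''i'' 1)" using b by (simp add: init_edges_def pass_start base_def)
      fix m s assume m: "1 \<le> m" "m < n" "init_edges m 1 s" "nmem s ''i'' 0 0 = m"
      have mV: "m \<in> V" using m by (simp add: V_def)
      have "runs (for_loop ''j'' 1 (init_edge re)) s (for_time n (cost \<tau> (init_edge re)))
        (\<lambda>s'. nmem s' ''i'' 0 0 = m \<and> init_edges m n s')"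
      proof (rule runs_for[where I = "\<lambda>k s'. nmem s' ''i'' 0 0 = m \<and> init_edges m k s'"])
        show "1 \<le> n" using n by simp
        show "nmem s ''n'' 0 0 = n" if "nmem s ''i'' 0 0 = m \<and> init_edges m k s" for k s
          using that by (simp add: init_edges_def base_def)
        show "nmem (put s ''j'' 1) ''i'' 0 0 = m \<and> init_edges m 1 (put s ''j'' 1)" using m by (simp add: pe)
        fix k s' assume k: "1 \<le> k" "k < n" "nmem s' ''i'' 0 0 = m \<and> init_edges m k s'" "nmem s' ''j'' 0 0 = k"
        have "k \<in> V" using k by (simp add: V_def)
        from init_edge_runs[OF mV this conjunct2[OF k(3)] conjunct1[OF k(3)] k(4)]
        show "runs (init_edge re) s' (cost \<tau> (init_edge re)) (\<lambda>s''. nmem s'' ''j'' 0 0 = k \<and>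
          nmem (put s'' ''j'' (Suc k)) ''i'' 0 0 = m \<and> init_edges m (Suc k) (put s'' ''j'' (Suc k)))"
          by (rule runs_mono) (simp_all add: pe)
      qed
      thus "runs (for_loop ''j'' 1 (init_edge re)) s (for_time n (cost \<tau> (init_edge re)))
        (\<lambda>s'. nmem s' ''i'' 0 0 = m \<and> init_edges (Suc m) 1 (put s' ''i'' (Suc m)))"
        by (rule runs_mono) (auto simp: init_edges_def pass_row base_def edge_set_def)
    qed
    thus ?thesis by (rule runs_mono) (simp_all add: init_edges_valid)
  qed
  show "runs init_first s (cost \<tau> init_first) (\<lambda>s1. runs (Seq (for_loop ''i'' 1 init_vertex) (for_loop ''i'' 1 (for_loop ''j'' 1 (init_edge re)))) s1
     (1 + for_time n (cost \<tau> init_vertex) + for_time n (for_time n (cost \<tau> (init_edge re)))) valid_state)"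
    by (rule runs_mono[OF first le_refl]) (rule runs_Seq, rule runs_mono[OF vertices le_refl edges])
qed

definition written :: "'a state \<Rightarrow> nat \<Rightarrow> nat \<Rightarrow> 'a state \<Rightarrow> bool" where
  "written s m k s' \<longleftrightarrow> nmem s' ''n'' = nmem s ''n'' \<and> fmem s' ''R'' = fmem s ''R'' \<and> fmem s' ''p'' = fmem s ''p'' \<and>
     (\<forall>x y. (x < m \<or> (x = m \<and> y < k)) \<and> y < n \<longrightarrow> fmem s' ''B'' x y = fmem s ''p'' x 0 * fmem s ''R'' x y)"

lemma write_loop:
  assumes s: "nmem s ''n'' 0 0 = n"
  shows "runs (for_loop ''i'' 0 (for_loop ''j'' 0 write_entry)) s (for_time n (for_time n (cost \<tau> write_entry))) (written s n 0)"
proof (rule runs_for[where I = "\<lambda>m. written s m 0"])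
  have pw: "written s m k (put s' X v) = written s m k s'" if "X \<in> {''i'', ''j''}" for m k s' X v
    using that by (elim insertE) (simp_all add: written_def)
  show sz: "nmem s' ''n'' 0 0 = n" if "written s m 0 s'" for m s' using that s by (simp add: written_def)
  show "written s 0 0 (put s ''i'' 0)" by (simp add: written_def)
  fix m s1 assume m: "m < n" "written s m 0 s1" "nmem s1 ''i'' 0 0 = m"
  have "runs (for_loop ''j'' 0 write_entry) s1 (for_time n (cost \<tau> write_entry))
    (\<lambda>s'. nmem s' ''i'' 0 0 = m \<and> written s m n s')"
  proof (rule runs_for[where I = "\<lambda>k s'. nmem s' ''i'' 0 0 = m \<and> written s m k s'"])
    show "nmem s' ''n'' 0 0 = n" if "nmem s' ''i'' 0 0 = m \<and> written s m k s'" for k s' using that s by (simp add: written_def)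
    show "nmem (put s1 ''j'' 0) ''i'' 0 0 = m \<and> written s m 0 (put s1 ''j'' 0)" using m by (simp add: pw)
    fix k s' assume k: "k < n" "nmem s' ''i'' 0 0 = m \<and> written s m k s'" "nmem s' ''j'' 0 0 = k"
    have "wp write_entry (\<lambda>s''. nmem s'' ''j'' 0 0 = k \<and> nmem s'' ''i'' 0 0 = m \<and> written s m (Suc k) s'') s'"
      using k by (auto simp: write_entry_def written_def upd_apply upd_other less_Suc_eq)
    from wp_runs[OF this]
    show "runs write_entry s' (cost \<tau> write_entry) (\<lambda>s''. nmem s'' ''j'' 0 0 = k \<and>
        nmem (put s'' ''j'' (Suc k)) ''i'' 0 0 = m \<and> written s m (Suc k) (put s'' ''j'' (Suc k)))"
      by (rule runs_mono) (simp_all add: pw)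
  qed simp
  thus "runs (for_loop ''j'' 0 write_entry) s1 (for_time n (cost \<tau> write_entry))
    (\<lambda>s'. nmem s' ''i'' 0 0 = m \<and> written s (Suc m) 0 (put s' ''i'' (Suc m)))"
    by (rule runs_mono) (auto simp: pw written_def less_Suc_eq)
qed simp

lemma written_solution:
  assumes v: "valid_state s"
    and triple: "\<And>i j k. \<lbrakk>i \<in> V; j \<in> V; k \<in> V; distinct [i, j, k]; linked_triple M i j k\<rbrakk> \<Longrightarrow> same_label s i j i k"
    and quad: "\<And>i j k l. \<lbrakk>i \<in> V; j \<in> V; k \<in> V; l \<in> V; distinct [i, j, k, l]; linked_quad M i j k l\<rbrakk> \<Longrightarrow> same_label s i j k l"
    and w: "written s n 0 s'" and S: "S \<subseteq> {..<n}"
  shows "principal_minor A S = principal_minor (output_mat n s') S"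
proof -
  have con: "consistent (fmem s ''R'') (nmem s ''L1'') (nmem s ''L2'')" and b: "base s"
    using v by (auto simp: valid_state_def)
  show ?thesis
  proof (rule consistent_solution[OF con _ _ _ S])
    fix i j k l assume "((i, j), (k, l)) \<in> links V M"
    thus "nmem s ''L1'' i j = nmem s ''L1'' k l \<and> nmem s ''L2'' i j = nmem s ''L2'' k l"
    proof cases
      case swap
      thus ?thesis using con_sym[OF con, of i j] by simp
    next
      case triple
      thus ?thesis using assms(2)[of i j l] by (simp add: same_label_def)
    next
      case quad
      thus ?thesis using assms(3)[of i j k l] by (simp add: same_label_def)
    qed
  next
    show "output_mat n s' \<in> carrier_mat n n" by (simp add: output_mat_def)
    fix i j assume ij: "i < n" "j < n"
    have "fmem s ''R'' i j = bordered 0 \<delta> (fmem s ''R'') i j"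
      using b ij by (auto simp: bordered_def base_def V_def)
    thus "output_mat n s' $$ (i, j) = pp i * bordered 0 \<delta> (fmem s ''R'') i j"
      using w b ij by (simp add: output_mat_def written_def base_def)
  qed
qed

lemma algorithm_runs:
  assumes s: "nmem s ''n'' 0 0 = n"
  shows "runs (algorithm re) s (algorithm_time re n \<tau>)
    (\<lambda>s'. \<forall>S. S \<noteq> {} \<and> S \<subseteq> {..<n} \<longrightarrow> principal_minor A S = principal_minor (output_mat n s') S)" (is "runs _ _ _ ?Q")
  unfolding algorithm_def algorithm_time_def
proof (rule runs_Cond)
  assume "\<not> beval rt as s (NLess n0 (sv ''n''))"
  thus "runs Skip s 1 ?Q" using s n by simp
next
  let ?w = "for_loop ''i'' 0 (for_loop ''j'' 0 write_entry)"
  let ?T3 = "for_time n (for_time n (for_time n (triple_time n \<tau>)))"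
  let ?T4 = "for_time n (for_time n (for_time n (for_time n (quad_time n \<tau>))))"
  let ?Tw = "for_time n (for_time n (cost \<tau> write_entry))"
  have "runs (Seq triple_loops (Seq quad_loops ?w)) s1 (1 + ?T3 + (1 + ?T4 + ?Tw)) ?Q" if v1: "valid_state s1" for s1
  proof (rule runs_Seq[OF runs_mono[OF triple_loops_runs[OF v1] le_refl]], elim conjE)
    fix s2 assume v2: "valid_state s2"
      and t: "\<forall>i\<in>V. \<forall>j\<in>V. \<forall>k\<in>V. distinct [i, j, k] \<and> linked_triple M i j k \<longrightarrow> same_label s2 i j i k"
    show "runs (Seq quad_loops ?w) s2 (1 + ?T4 + ?Tw) ?Q"
    proof (rule runs_Seq[OF runs_mono[OF quad_loops_runs[OF v2] le_refl]], elim conjE)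
      fix s3 assume v3: "valid_state s3" and c: "coarser s2 s3"
        and q: "\<forall>i\<in>V. \<forall>j\<in>V. \<forall>k\<in>V. \<forall>l\<in>V. distinct [i, j, k, l] \<and> linked_quad M i j k l \<longrightarrow> same_label s3 i j k l"
      have n3: "nmem s3 ''n'' 0 0 = n" using v3 by (simp add: valid_state_def base_def)
      show "runs ?w s3 ?Tw ?Q"
      proof (rule runs_mono[OF write_loop[OF n3] le_refl], intro allI impI)
        fix s' S assume w: "written s3 n 0 s'" and S: "S \<noteq> {} \<and> S \<subseteq> {..<n}"
        show "principal_minor A S = principal_minor (output_mat n s') S"
        proof (rule written_solution[OF v3 _ _ w conjunct2[OF S]])
          fix i j k assume h: "i \<in> V" "j \<in> V" "k \<in> V" "distinct [i, j, k]" "linked_triple M i j k"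
          have "same_label s2 i j i k" using t h by blast
          thus "same_label s3 i j i k" using c h unfolding coarser_def by simp
        next
          fix i j k l assume "i \<in> V" "j \<in> V" "k \<in> V" "l \<in> V" "distinct [i, j, k, l]" "linked_quad M i j k l"
          thus "same_label s3 i j k l" using q by blast
        qed
      qed
    qed
  qed
  thus "runs (Seq (init re) (Seq triple_loops (Seq quad_loops ?w))) s
     (1 + init_time re n \<tau> + (1 + ?T3 + (1 + ?T4 + ?Tw))) ?Q"
    by (rule runs_Seq[OF runs_mono[OF init_runs[OF s] le_refl]])
qed

end
end

definition sqrt_exp :: fexp where
  "sqrt_exp = (fv ''g'' [+] FSqrt (fv ''g'' [*] fv ''g'' [-] (fv ''h'' [+] fv ''h'' [+] fv ''h'' [+] fv ''h''))) [/] (FOne [+] FOne)"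

text \<open>The factor \<open>1 - \<sigma> / \<sigma>\<close> selects the square root when the sum \<open>\<sigma>\<close> of the roots vanishes,
  since \<open>0 / 0 = 0\<close>.\<close>

definition artin_exp :: fexp where
  "artin_exp = fv ''g'' [*] FArtin (fv ''h'' [/] (fv ''g'' [*] fv ''g'')) [+] (FOne [-] fv ''g'' [/] fv ''g'') [*] FSqrt (fv ''h'')"

definition sqrt_root :: "('a::field \<Rightarrow> 'a) \<Rightarrow> 'a \<Rightarrow> 'a \<Rightarrow> 'a" where
  "sqrt_root rt x y = (let \<sigma> = x + y; q = x * y in (\<sigma> + rt (\<sigma> * \<sigma> - (q + q + q + q))) / (1 + 1))"

definition artin_root :: "('a::field \<Rightarrow> 'a) \<Rightarrow> ('a \<Rightarrow> 'a) \<Rightarrow> 'a \<Rightarrow> 'a \<Rightarrow> 'a" where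
  "artin_root rt as x y = (let \<sigma> = x + y; q = x * y in \<sigma> * as (q / (\<sigma> * \<sigma>)) + (1 - \<sigma> / \<sigma>) * rt q)"

lemma sqrt_root:
  fixes rt :: "'a::field \<Rightarrow> 'a"
  assumes "computes_square_roots rt" "(2::'a) \<noteq> 0"
  shows "sqrt_root rt x y \<in> {x, y}" "sqrt_root rt x y = sqrt_root rt y x"
proof -
  define z where "z = sqrt_root rt x y"
  define d where "d = rt ((x + y) * (x + y) - (x * y + x * y + x * y + x * y))"
  have "(x - y)\<^sup>2 = (x + y) * (x + y) - (x * y + x * y + x * y + x * y)" by (simp add: power2_eq_square algebra_simps)
  hence "d\<^sup>2 = (x - y)\<^sup>2" using assms(1) unfolding computes_square_roots_def d_def by metis
  hence d: "d = x - y \<or> d = y - x" by (auto simp: power2_eq_iff)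
  have two: "(1::'a) + 1 \<noteq> 0" using assms(2) by (simp add: one_add_one)
  have "z * (1 + 1) = x + y + d" using two by (simp add: z_def sqrt_root_def Let_def d_def)
  hence "z * (1 + 1) = x * (1 + 1) \<or> z * (1 + 1) = y * (1 + 1)" using d by (auto simp: algebra_simps)
  thus "sqrt_root rt x y \<in> {x, y}" using mult_right_cancel[OF two] unfolding z_def[symmetric] by blast
  show "sqrt_root rt x y = sqrt_root rt y x" by (simp only: sqrt_root_def add.commute[of x y] mult.commute[of x y])
qed

lemma artin_root:
  fixes rt as :: "'a::field \<Rightarrow> 'a"
  assumes rt: "computes_square_roots rt" and as: "computes_artin_schreier_roots as" and two: "(2::'a) = 0"
  shows "artin_root rt as x y \<in> {x, y}" "artin_root rt as x y = artin_root rt as y x"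
proof -
  have dbl: "u + u = 0" for u :: 'a using two by (metis mult_2 mult_zero_left)
  have neg: "- u = u" for u :: 'a using dbl[of u] by (simp add: add_eq_0_iff)
  define z where "z = artin_root rt as x y"
  have "(z - x) * (z - y) = 0"
  proof (cases "x + y = 0")
    case True
    hence y: "y = x" using neg[of x] by (simp add: add_eq_0_iff)
    have "z = 0 * as (x * x / (0 * 0)) + (1 - 0 / 0) * rt (x * x)"
      by (simp only: z_def artin_root_def Let_def y dbl)
    hence "z = rt (x * x)" by simp
    hence "z\<^sup>2 = x\<^sup>2" using rt unfolding computes_square_roots_def by (metis power2_eq_square)
    thus ?thesis unfolding y by (auto simp: power2_eq_iff neg)
  next
    case False
    define w where "w = as (x * y / ((x + y) * (x + y)))"
    have z: "z = (x + y) * w" using False by (simp add: z_def artin_root_def w_def Let_def)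
    have "(x / (x + y))\<^sup>2 + x / (x + y) = (x * x + x * (x + y)) / ((x + y) * (x + y))"
      using False by (simp add: power2_eq_square add_divide_distrib)
    also have "x * x + x * (x + y) = x * y + (x * x + x * x)" by (simp add: algebra_simps)
    also have "\<dots> = x * y" by (simp only: dbl add_0_right)
    finally have w: "w\<^sup>2 + w = x * y / ((x + y) * (x + y))"
      using as unfolding computes_artin_schreier_roots_def w_def by metis
    have "(z - x) * (z - y) = z * z - (x + y) * z + x * y" by (simp add: algebra_simps)
    also have "\<dots> = z * z + (x + y) * z + x * y" using neg[of "(x + y) * z"] by (simp only: diff_conv_add_uminus)
    also have "\<dots> = (x + y) * (x + y) * (w\<^sup>2 + w) + x * y" by (simp add: z power2_eq_square algebra_simps)
    also have "\<dots> = x * y + x * y" using False by (simp add: w)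
    also have "\<dots> = 0" by (rule dbl)
    finally show ?thesis .
  qed
  thus "artin_root rt as x y \<in> {x, y}" unfolding z_def[symmetric] by auto
  show "artin_root rt as x y = artin_root rt as y x" by (simp only: artin_root_def add.commute[of x y] mult.commute[of x y])
qed

theorem theorem1p5:
  fixes rt as :: "'a::field \<Rightarrow> 'a" and \<tau> :: "nat \<Rightarrow> nat"
  assumes sqrt: "computes_square_roots rt"
    and char2: "(2::'a) = 0 \<Longrightarrow> computes_artin_schreier_roots as"
    and root_time: "polynomially_bounded \<tau>"
  shows "\<exists>(c :: com) (T :: nat \<Rightarrow> nat). polynomially_bounded T \<and>
    (\<forall>(n :: nat) (A :: 'a mat) (orc :: nat set \<Rightarrow> 'a).
       A \<in> carrier_mat n n \<and> property_R n A \<and> minor_oracle n A orc \<longrightarrow>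
       (\<exists>t s. exec orc rt as (\<tau> n) c (init_state n) t s \<and> t \<le> T n \<and>
          (\<forall>S. S \<noteq> {} \<and> S \<subseteq> {..<n} \<longrightarrow>
             principal_minor A S = principal_minor (output_mat n s) S)))"
proof -
  obtain re :: fexp and \<rho> where rho: "\<And>x y. \<rho> x y \<in> {x, y}" "\<And>x y. \<rho> x y = \<rho> y x"
    and re: "\<And>s x y. fmem s ''g'' 0 0 = x + y \<Longrightarrow> fmem s ''h'' 0 0 = x * y \<Longrightarrow> feval rt as s re = \<rho> x y"
  proof (cases "(2::'a) = 0")
    case True
    show thesis
      by (rule that[OF artin_root[OF sqrt char2[OF True] True], of artin_exp]) (simp add: artin_exp_def artin_root_def Let_def)
  next
    case False
    show thesis
      by (rule that[OF sqrt_root[OF sqrt False], of sqrt_exp]) (simp add: sqrt_exp_def sqrt_root_def Let_def)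
  qed
  have "\<exists>t s. exec orc rt as (\<tau> n) (algorithm re) (init_state n) t s \<and> t \<le> algorithm_time re n (\<tau> n) \<and>
      (\<forall>S. S \<noteq> {} \<and> S \<subseteq> {..<n} \<longrightarrow> principal_minor A S = principal_minor (output_mat n s) S)"
    if A: "A \<in> carrier_mat n n" "property_R n A" "minor_oracle n A orc" for n A orc
  proof (cases "n = 0")
    case True
    have "\<not> beval rt as (init_state n) (NLess n0 (sv ''n''))" by (simp add: init_state_def upd_apply True)
    from exec.CondFalse[OF this exec.Skip]
    have "exec orc rt as (\<tau> n) (algorithm re) (init_state n) (1 + bcost (\<tau> n) (NLess n0 (sv ''n'')) + 1) (init_state n)"
      unfolding algorithm_def .
    thus ?thesis using True by (intro exI[of _ "1 + bcost (\<tau> n) (NLess n0 (sv ''n'')) + 1"] exI[of _ "init_state n"])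
        (auto simp: algorithm_time_def)
  next
    case False
    interpret run n A \<rho> orc rt as "\<tau> n"
      by unfold_locales (use A False rho in auto)
    show ?thesis
      using algorithm_runs[OF re, of "init_state n"] by (simp add: runs_def init_state_def upd_apply)
  qed
  thus ?thesis
    using polynomially_bounded_algorithm_time[OF root_time] by blast
qed

end
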